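(* Let $G=G_2$ be the simply connected compact Lie group of type $G_2$, let $m$ be a positive integer and $p$ a prime. Write $m=p^i m'$ with $p\nmid m'$. (1) If $p=3$, then $N(G_2,m,3)$ is the number of pairs $(b_1,b_2)\in\mathbb{Z}^2$ such that $$2b_2>b_1>b_2>0\quad\text{and}\quad p^i>b_1.$$ (2) If $p\neq 3$, then $N(G_2,m,p)$ is the number of pairs $(b_1,b_2)\in\mathbb{Z}^2$ such that $$2b_2>b_1>b_2>0,\quad p^i>b_1,\quad\text{and}\quad 3\mid(b_1+b_2).$$
   Context: Let $G$ be a simply connected simple compact Lie group with maximal torus $T$ and weight lattice $\Pi^*=\mathrm{Hom}(T,S^1)$. $\langle\cdot,\cdot\rangle$ is the unique Weyl-invariant inner product on $\Pi^*$ (extended to $\Pi^*\otimes\mathbb{R}$) with $\langle u,u\rangle=2$ for all long roots $u$ (in the simply laced case all roots are long). The fundamental Weyl chamber $V\subset\Pi^*\otimes\mathbb{R}$ is the set of points having non-negative inner product with all positive roots; $\theta$ is the highest root. The level $m$ fundamental alcove is $A=\{x\in V:\langle\theta,x\rangle\le m\}$. A level $m$ regular weight is an element of $\Pi^*$ in the interior of $A$. $N(G,m,p)$ denotes the number of level $m$ regular weights $a$ such that for every weight $w\in\Pi^*$ the denominator (in lowest terms) of the rational number $\langle w,a\rangle/m$ is a power $p^k$, $k\ge0$, of $p$. *)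

theory Defs
  imports "HOL-Analysis.Analysis"
begin

text \<open>
  A Lie group is given here as a set of invertible bounded operators on a Euclidean space with
  composition as product; up to isomorphism this covers all compact Lie groups, and the
  subspace topology coming from the operator norm is the Lie group topology.
\<close>

abbreviation op_inv :: "('v::euclidean_space \<Rightarrow>\<^sub>L 'v) \<Rightarrow> ('v \<Rightarrow>\<^sub>L 'v)" where
  "op_inv g \<equiv> Blinfun (inv (blinfun_apply g))"

definition linear_group :: "('v::euclidean_space \<Rightarrow>\<^sub>L 'v) set \<Rightarrow> bool" where
  "linear_group G \<longleftrightarrow>
     (\<forall>g\<in>G. bij (blinfun_apply g)) \<and> id_blinfun \<in> G \<and>
     (\<forall>g\<in>G. \<forall>h\<in>G. g o\<^sub>L h \<in> G) \<and> (\<forall>g\<in>G. op_inv g \<in> G)"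

text \<open>A torus is a compact connected abelian Lie group.\<close>

definition torus :: "('v::euclidean_space \<Rightarrow>\<^sub>L 'v) set \<Rightarrow> bool" where
  "torus T \<longleftrightarrow>
     linear_group T \<and> compact T \<and> connected T \<and> (\<forall>s\<in>T. \<forall>t\<in>T. s o\<^sub>L t = t o\<^sub>L s)"

definition maximal_torus ::
  "('v::euclidean_space \<Rightarrow>\<^sub>L 'v) set \<Rightarrow> ('v \<Rightarrow>\<^sub>L 'v) set \<Rightarrow> bool" where
  "maximal_torus G T \<longleftrightarrow>
     torus T \<and> T \<subseteq> G \<and> (\<forall>S. torus S \<and> T \<subseteq> S \<and> S \<subseteq> G \<longrightarrow> S = T)"

text \<open>The tangent space of \<open>G\<close> at the identity.\<close>

definition lie_algebra :: "('v::euclidean_space \<Rightarrow>\<^sub>L 'v) set \<Rightarrow> ('v \<Rightarrow>\<^sub>L 'v) set" where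
  "lie_algebra G =
     {X. \<exists>\<gamma> :: real \<Rightarrow> ('v \<Rightarrow>\<^sub>L 'v).
           (\<forall>s. \<gamma> s \<in> G) \<and> \<gamma> 0 = id_blinfun \<and> (\<gamma> has_vector_derivative X) (at 0)}"

text \<open>
  The weight lattice \<open>Hom(T, S\<^sup>1)\<close>, written multiplicatively. Characters are functions on \<open>T\<close>;
  outside \<open>T\<close> they take the value \<^const>\<open>undefined\<close>, so that equality of characters is equality
  on \<open>T\<close>.
\<close>

type_synonym 'v character = "('v \<Rightarrow>\<^sub>L 'v) \<Rightarrow> complex"

definition weights :: "('v::euclidean_space \<Rightarrow>\<^sub>L 'v) set \<Rightarrow> 'v character set" where
  "weights T =
     {\<mu>. \<mu> \<in> T \<rightarrow>\<^sub>E sphere 0 1 \<and> continuous_on T \<mu> \<and> (\<forall>s\<in>T. \<forall>t\<in>T. \<mu> (s o\<^sub>L t) = \<mu> s * \<mu> t)}"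

definition weight_add ::
  "('v::euclidean_space \<Rightarrow>\<^sub>L 'v) set \<Rightarrow> 'v character \<Rightarrow> 'v character \<Rightarrow> 'v character" where
  "weight_add T \<mu> \<nu> = (\<lambda>t\<in>T. \<mu> t * \<nu> t)"

text \<open>
  The roots are the nontrivial weights of the adjoint representation on the complexified Lie
  algebra. The pair \<open>(X, Y)\<close> stands for \<open>X + \<i> Y\<close>, and the two equations are the real and the
  imaginary part of \<open>Ad t (X + \<i> Y) = \<mu> t \<cdot> (X + \<i> Y)\<close>.
\<close>

definition roots ::
  "('v::euclidean_space \<Rightarrow>\<^sub>L 'v) set \<Rightarrow> ('v \<Rightarrow>\<^sub>L 'v) set \<Rightarrow> 'v character set" where
  "roots G T =
     {\<mu> \<in> weights T. (\<exists>t\<in>T. \<mu> t \<noteq> 1) \<and>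
        (\<exists>X\<in>lie_algebra G. \<exists>Y\<in>lie_algebra G. (X \<noteq> 0 \<or> Y \<noteq> 0) \<and>
           (\<forall>t\<in>T. t o\<^sub>L X o\<^sub>L op_inv t = Re (\<mu> t) *\<^sub>R X - Im (\<mu> t) *\<^sub>R Y \<and>
                  t o\<^sub>L Y o\<^sub>L op_inv t = Im (\<mu> t) *\<^sub>R X + Re (\<mu> t) *\<^sub>R Y))}"

definition normalizer ::
  "('v::euclidean_space \<Rightarrow>\<^sub>L 'v) set \<Rightarrow> ('v \<Rightarrow>\<^sub>L 'v) set \<Rightarrow> ('v \<Rightarrow>\<^sub>L 'v) set" where
  "normalizer G T = {n \<in> G. (\<lambda>t. n o\<^sub>L t o\<^sub>L op_inv n) ` T = T}"

text \<open>The action on weights of the Weyl group element represented by \<open>n\<close>.\<close>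

definition weyl_act ::
  "('v::euclidean_space \<Rightarrow>\<^sub>L 'v) set \<Rightarrow> ('v \<Rightarrow>\<^sub>L 'v) \<Rightarrow> 'v character \<Rightarrow> 'v character" where
  "weyl_act T n \<mu> = (\<lambda>t\<in>T. \<mu> (op_inv n o\<^sub>L t o\<^sub>L n))"

text \<open>
  The map \<open>\<iota>\<close> exhibits the Euclidean space \<open>'e\<close> as the weight lattice tensored with the reals:
  it is additive and maps the weights bijectively onto the integral span of a vector space basis.
\<close>

definition weight_space ::
  "('v::euclidean_space \<Rightarrow>\<^sub>L 'v) set \<Rightarrow> ('v character \<Rightarrow> 'e::euclidean_space) \<Rightarrow> bool" where
  "weight_space T \<iota> \<longleftrightarrow>
     (\<forall>\<mu>\<in>weights T. \<forall>\<nu>\<in>weights T. \<iota> (weight_add T \<mu> \<nu>) = \<iota> \<mu> + \<iota> \<nu>) \<and>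
     (\<exists>B. independent B \<and> span B = UNIV \<and>
          bij_betw \<iota> (weights T) {\<Sum>b\<in>B. of_int (c b) *\<^sub>R b |c :: 'e \<Rightarrow> int. True})"

text \<open>
  The inner product of \<open>'e\<close>, transported along \<open>\<iota>\<close>, is the basic one: it is invariant under the
  Weyl group, and the long roots (those of maximal length) have square length 2.
\<close>

definition basic_inner_product ::
  "('v::euclidean_space \<Rightarrow>\<^sub>L 'v) set \<Rightarrow> ('v \<Rightarrow>\<^sub>L 'v) set \<Rightarrow>
     ('v character \<Rightarrow> 'e::euclidean_space) \<Rightarrow> bool" where
  "basic_inner_product G T \<iota> \<longleftrightarrow>
     (\<forall>n\<in>normalizer G T. \<forall>\<mu>\<in>weights T. \<forall>\<nu>\<in>weights T.
        \<iota> (weyl_act T n \<mu>) \<bullet> \<iota> (weyl_act T n \<nu>) = \<iota> \<mu> \<bullet> \<iota> \<nu>) \<and>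
     (\<forall>u\<in>\<iota> ` roots G T. (\<forall>v\<in>\<iota> ` roots G T. norm v \<le> norm u) \<longrightarrow> u \<bullet> u = 2)"

definition positive_system :: "'e::euclidean_space set \<Rightarrow> 'e set \<Rightarrow> bool" where
  "positive_system \<Phi> P \<longleftrightarrow>
     (\<exists>v. (\<forall>\<alpha>\<in>\<Phi>. v \<bullet> \<alpha> \<noteq> 0) \<and> P = {\<alpha>\<in>\<Phi>. v \<bullet> \<alpha> > 0})"

definition highest_root :: "'e::euclidean_space set \<Rightarrow> 'e set \<Rightarrow> 'e \<Rightarrow> bool" where
  "highest_root \<Phi> P \<theta> \<longleftrightarrow>
     \<theta> \<in> \<Phi> \<and> (\<forall>\<beta>\<in>\<Phi>. \<exists>c :: 'e \<Rightarrow> nat. \<theta> - \<beta> = (\<Sum>\<alpha>\<in>P. of_nat (c \<alpha>) *\<^sub>R \<alpha>))"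

definition weyl_chamber :: "'e::euclidean_space set \<Rightarrow> 'e set" where
  "weyl_chamber P = {x. \<forall>\<alpha>\<in>P. 0 \<le> x \<bullet> \<alpha>}"

definition alcove :: "'e::euclidean_space set \<Rightarrow> 'e \<Rightarrow> nat \<Rightarrow> 'e set" where
  "alcove P \<theta> m = {x \<in> weyl_chamber P. \<theta> \<bullet> x \<le> real m}"

definition regular_weights ::
  "('v::euclidean_space \<Rightarrow>\<^sub>L 'v) set \<Rightarrow> ('v character \<Rightarrow> 'e::euclidean_space) \<Rightarrow>
     'e set \<Rightarrow> 'e \<Rightarrow> nat \<Rightarrow> 'v character set" where
  "regular_weights T \<iota> P \<theta> m = {a \<in> weights T. \<iota> a \<in> interior (alcove P \<theta> m)}"

text \<open>\<open>x\<close> is a rational number whose denominator in lowest terms is a power of \<open>p\<close>.\<close>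

definition denom_power :: "nat \<Rightarrow> real \<Rightarrow> bool" where
  "denom_power p x \<longleftrightarrow> (\<exists>q :: rat. \<exists>k :: nat. x = of_rat q \<and> snd (quotient_of q) = int p ^ k)"

definition N_regular ::
  "('v::euclidean_space \<Rightarrow>\<^sub>L 'v) set \<Rightarrow> ('v character \<Rightarrow> 'e::euclidean_space) \<Rightarrow>
     'e set \<Rightarrow> 'e \<Rightarrow> nat \<Rightarrow> nat \<Rightarrow> nat" where
  "N_regular T \<iota> P \<theta> m p =
     card {a \<in> regular_weights T \<iota> P \<theta> m.
             \<forall>w\<in>weights T. denom_power p ((\<iota> w \<bullet> \<iota> a) / real m)}"

text \<open>
  The compact group of type \<open>G\<^sub>2\<close>, as the automorphism group of the octonions. The octonions are
  obtained from the complex numbers by applying the Cayley-Dickson doubling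
  \<open>(a, b) (c, d) = (a c - d\<^sup>* b, d a + b c\<^sup>*)\<close> twice.
\<close>

type_synonym quat = "complex \<times> complex"
type_synonym oct = "quat \<times> quat"

definition quat_mult :: "quat \<Rightarrow> quat \<Rightarrow> quat" where
  "quat_mult x y =
     (fst x * fst y - cnj (snd y) * snd x, snd y * fst x + snd x * cnj (fst y))"

definition quat_cnj :: "quat \<Rightarrow> quat" where
  "quat_cnj x = (cnj (fst x), - snd x)"

definition oct_mult :: "oct \<Rightarrow> oct \<Rightarrow> oct" where
  "oct_mult x y =
     (quat_mult (fst x) (fst y) - quat_mult (quat_cnj (snd y)) (snd x),
      quat_mult (snd y) (fst x) + quat_mult (snd x) (quat_cnj (fst y)))"

definition G2 :: "(oct \<Rightarrow>\<^sub>L oct) set" where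
  "G2 = {g. bij (blinfun_apply g) \<and>
            (\<forall>x y. blinfun_apply g (oct_mult x y) =
                   oct_mult (blinfun_apply g x) (blinfun_apply g y))}"

end

(*
  A torus in G2 consists of commuting isometries of the imaginary octonions. On an invariant subspace
  of minimal dimension it acts by scalars or by rotations of planes, and the product of an
  orthonormal basis of a rotated plane is a fixed vector; hence the torus fixes an imaginary unit e.
  It then acts complex-linearly on the orthogonal complement of 1 and e, where it has common
  eigenvectors e1 and e2, and the Cayley-Dickson construction extends i, j, l -> e, e1, e2 to an
  automorphism. So every maximal torus is conjugate to the diagonal one, whose weights and roots are
  computed explicitly. An automorphism of order 3 normalizing that torus forces the weights to form
  a hexagonal lattice, in which the short roots A, B at 120 degrees can be chosen such that
  the alcove is given by 2l > k > l and k < m for the weight k A + l B. The condition on the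
  denominators says that k and l are divisible by the p-free part of m, up to a factor 3.
*)

theory Submission
  imports Defs
begin

section \<open>The octonions\<close>

text \<open>Elements of \<open>G2\<close> are only required to be bijective and multiplicative; that
  they fix the unit and preserve the metric is derived from the quadratic equation satisfied by
  every octonion. Commuting isometries of a real space need not have eigenvectors, so Schur's lemma
  is applied to self-adjoint operators built from them: \<open>t + op_inv t\<close>, and products of
  two commuting skew operators such as \<open>t - op_inv t\<close>. The set
  \<open>lie_algebra G2\<close> consists of velocities of curves and is never treated as a vector
  space. Roots are bounded from above by the derivation rule and produced from below by explicit
  curves of unit quaternions, multiplied by symmetries. The threes in the count come from the inner
  product: invariance leaves \<open>s * (k * k - k * l + l * l)\<close>, whose long roots have
  square length \<open>3 * s\<close>, so \<open>s\<close> is two thirds and weights pair in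
  multiples of one third.\<close>

definition oct_one :: oct where
  "oct_one = ((1, 0), (0, 0))"

definition oct_cnj :: "oct \<Rightarrow> oct" where
  "oct_cnj x = (quat_cnj (fst x), - snd x)"

lemmas oct_simps = oct_mult_def quat_mult_def oct_cnj_def quat_cnj_def oct_one_def

lemma oct_eqI:
  "fst (fst x) = fst (fst y) \<Longrightarrow> snd (fst x) = snd (fst y) \<Longrightarrow>
   fst (snd x) = fst (snd y) \<Longrightarrow> snd (snd x) = snd (snd y) \<Longrightarrow> x = (y :: oct)"
  by (simp add: prod_eq_iff)

lemma oct_mult_add_left: "oct_mult (x + y) z = oct_mult x z + oct_mult y z"
  by (rule oct_eqI) (simp_all add: oct_simps algebra_simps)

lemma oct_mult_add_right: "oct_mult x (y + z) = oct_mult x y + oct_mult x z"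
  by (rule oct_eqI) (simp_all add: oct_simps algebra_simps)

lemma oct_mult_scaleR_left: "oct_mult (r *\<^sub>R x) y = r *\<^sub>R oct_mult x y"
  by (rule oct_eqI) (simp_all add: oct_simps scaleR_conv_of_real algebra_simps)

lemma oct_mult_scaleR_right: "oct_mult x (r *\<^sub>R y) = r *\<^sub>R oct_mult x y"
  by (rule oct_eqI) (simp_all add: oct_simps scaleR_conv_of_real algebra_simps)

lemma bounded_bilinear_oct_mult: "bounded_bilinear oct_mult"
  by (intro bilinear_conv_bounded_bilinear[THEN iffD1])
     (auto simp: bilinear_def intro!: linearI
        oct_mult_add_left oct_mult_add_right oct_mult_scaleR_left oct_mult_scaleR_right)

interpretation oct_mult: bounded_bilinear oct_mult
  by (rule bounded_bilinear_oct_mult)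

lemma oct_mult_one_left [simp]: "oct_mult oct_one x = x"
  by (rule oct_eqI) (simp_all add: oct_simps)

lemma oct_mult_one_right [simp]: "oct_mult x oct_one = x"
  by (rule oct_eqI) (simp_all add: oct_simps)

lemma linear_oct_cnj: "linear oct_cnj"
  by (intro linearI oct_eqI) (simp_all add: oct_simps)

lemma oct_cnj_cnj [simp]: "oct_cnj (oct_cnj x) = x"
  by (rule oct_eqI) (simp_all add: oct_simps)

lemma oct_cnj_mult: "oct_cnj (oct_mult x y) = oct_mult (oct_cnj y) (oct_cnj x)"
  by (rule oct_eqI) (simp_all add: oct_simps algebra_simps)

section \<open>Composition identities of the octonions\<close>

lemma of_real_two_inner: "of_real (2 * (a \<bullet> b)) = a * cnj b + cnj a * (b :: complex)"
  by (simp add: complex_eq_iff inner_complex_def)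

lemma inner_oct:
  "x \<bullet> y = fst (fst x) \<bullet> fst (fst y) + snd (fst x) \<bullet> snd (fst y) +
           fst (snd x) \<bullet> fst (snd y) + snd (snd x) \<bullet> snd (snd (y :: oct))"
  by (simp add: inner_prod_def)

text \<open>Doubled and embedded in the complex numbers, the inner product becomes a polynomial in
  the coordinates and their conjugates. Identities involving it can then be checked by ring
  normalisation in each component.\<close>

lemma of_real_two_inner_oct:
  "of_real (2 * (x \<bullet> y)) =
     fst (fst x) * cnj (fst (fst y)) + cnj (fst (fst x)) * fst (fst y) +
     snd (fst x) * cnj (snd (fst y)) + cnj (snd (fst x)) * snd (fst y) +
     fst (snd x) * cnj (fst (snd y)) + cnj (fst (snd x)) * fst (snd y) +
     snd (snd x) * cnj (snd (snd y)) + cnj (snd (snd x)) * snd (snd (y :: oct))"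
  unfolding inner_oct distrib_left of_real_add of_real_two_inner by simp

text \<open>Polarisation of the law that multiplying by \<open>x\<close> and then by
  \<open>oct_cnj x\<close> scales by \<open>x \<bullet> x\<close>. For orthogonal \<open>x\<close>
  and \<open>y\<close> it exchanges two left factors, which takes the place of associativity in what
  follows.\<close>

lemma oct_left_polar:
  "oct_mult (oct_cnj x) (oct_mult y z) + oct_mult (oct_cnj y) (oct_mult x z) = (2 * (x \<bullet> y)) *\<^sub>R z"
  by (rule oct_eqI;
      simp only: fst_scaleR snd_scaleR scaleR_conv_of_real of_real_two_inner_oct;
      simp add: oct_simps algebra_simps)

lemma oct_right_polar:
  "oct_mult (oct_mult z x) (oct_cnj y) + oct_mult (oct_mult z y) (oct_cnj x) = (2 * (x \<bullet> y)) *\<^sub>R z"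
  by (rule oct_eqI;
      simp only: fst_scaleR snd_scaleR scaleR_conv_of_real of_real_two_inner_oct;
      simp add: oct_simps algebra_simps)

lemma inner_oct_mult_left: "oct_mult a x \<bullet> y = x \<bullet> oct_mult (oct_cnj a) y"
proof -
  have "complex_of_real (2 * (oct_mult a x \<bullet> y)) = of_real (2 * (x \<bullet> oct_mult (oct_cnj a) y))"
    unfolding of_real_two_inner_oct by (simp add: oct_simps algebra_simps)
  then show ?thesis by (simp only: of_real_eq_iff)
qed

lemma inner_oct_cnj: "oct_cnj x \<bullet> y = x \<bullet> oct_cnj y"
  by (simp add: inner_oct oct_simps inner_complex_def)

lemma oct_cnj_eq: "oct_cnj x = (2 * (x \<bullet> oct_one)) *\<^sub>R oct_one - x"
  by (rule oct_eqI) (simp_all add: oct_simps inner_oct inner_complex_def complex_eq_iff)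

lemma oct_one_norm [simp]: "oct_one \<bullet> oct_one = 1" "oct_one \<noteq> 0" "oct_cnj oct_one = oct_one"
  by (simp_all add: inner_oct oct_one_def oct_cnj_def quat_cnj_def prod_eq_iff)

text \<open>The real quadratic equation of an octonion: multiplication alone remembers real part and
  norm, which is what makes homomorphisms isometric.\<close>

lemma oct_square: "oct_mult x x = (2 * (x \<bullet> oct_one)) *\<^sub>R x - (x \<bullet> x) *\<^sub>R oct_one"
proof -
  have "oct_mult (oct_cnj x) x = (x \<bullet> x) *\<^sub>R oct_one"
    using oct_left_polar[of x x oct_one] by (simp add: scaleR_2[symmetric] flip: scaleR_scaleR)
  then show ?thesis
    unfolding oct_cnj_eq
    by (simp add: oct_mult.diff_left oct_mult_scaleR_left algebra_simps)
qed

section \<open>Octonion homomorphisms\<close>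

lemma oct_mult_imaginary:
  assumes "l \<bullet> oct_one = 0" "a \<bullet> l = 0"
  shows "oct_mult l a = oct_mult (oct_cnj a) l"
proof -
  have "oct_cnj l = - l"
    using assms(1) by (simp add: oct_cnj_eq)
  then show ?thesis
    using oct_left_polar[of l a oct_one] assms(2)
    by (simp add: oct_mult.minus_left inner_commute)
qed

text \<open>This and the next two lemmas give the mixed terms of the doubling formula, where the
  pair \<open>(a, b)\<close> stands for \<open>a\<close> plus \<open>b\<close> times
  \<open>l\<close>. Orthogonality to \<open>l\<close> is demanded just for the elements and products
  that occur, so no subalgebra has to be named.\<close>

lemma cayley_dickson_right:
  assumes l: "l \<bullet> oct_one = 0" and a: "a \<bullet> l = 0" and b: "b \<bullet> l = 0" and ba: "oct_mult b a \<bullet> l = 0"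
  shows "oct_mult a (oct_mult b l) = oct_mult (oct_mult b a) l"
proof -
  have cnj: "oct_cnj l = - l"
    using l by (simp add: oct_cnj_eq)
  have cnj_orth: "oct_cnj x \<bullet> l = 0" if "x \<bullet> l = 0" for x
    using that by (simp add: inner_oct_cnj cnj)
  have "oct_mult b l = oct_mult l (oct_cnj b)"
    using oct_mult_imaginary[OF l cnj_orth[OF b]] by simp
  moreover have "oct_mult a (oct_mult l (oct_cnj b)) = oct_mult l (oct_mult (oct_cnj a) (oct_cnj b))"
    using oct_left_polar[of "oct_cnj a" l "oct_cnj b"] cnj_orth[OF a]
    by (simp add: cnj oct_mult.minus_left)
  moreover have "oct_mult l (oct_mult (oct_cnj a) (oct_cnj b)) = oct_mult (oct_mult b a) l"
    using oct_mult_imaginary[OF l cnj_orth[OF ba]] by (simp add: oct_cnj_mult)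
  ultimately show ?thesis by simp
qed

lemma cayley_dickson_left:
  assumes l: "l \<bullet> oct_one = 0" and a: "a \<bullet> l = 0" and b: "b \<bullet> l = 0"
    and ab: "oct_mult a (oct_cnj b) \<bullet> l = 0"
  shows "oct_mult (oct_mult a l) b = oct_mult (oct_mult a (oct_cnj b)) l"
proof -
  have cnj: "oct_cnj l = - l"
    using l by (simp add: oct_cnj_eq)
  have cnj_orth: "oct_cnj x \<bullet> l = 0" if "x \<bullet> l = 0" for x
    using that by (simp add: inner_oct_cnj cnj)
  have al: "oct_cnj (oct_mult x l) = - oct_mult x l" if "x \<bullet> l = 0" for x
    using oct_mult_imaginary[OF l cnj_orth[OF that]]
    by (simp add: oct_cnj_mult cnj oct_mult.minus_left)
  have "oct_cnj (oct_mult (oct_mult a l) b) = - oct_mult (oct_cnj b) (oct_mult a l)"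
    by (simp add: oct_cnj_mult[of "oct_mult a l"] al[OF a] oct_mult.minus_right)
  also have "\<dots> = - oct_mult (oct_mult a (oct_cnj b)) l"
    by (simp add: cayley_dickson_right[OF l cnj_orth[OF b] a ab])
  also have "\<dots> = oct_cnj (oct_mult (oct_mult a (oct_cnj b)) l)"
    by (simp add: al[OF ab])
  finally show ?thesis by (metis oct_cnj_cnj)
qed

lemma cayley_dickson_both:
  assumes l: "l \<bullet> oct_one = 0" "l \<bullet> l = 1" and a: "a \<bullet> l = 0" and b: "b \<bullet> l = 0"
    and ab: "oct_mult (oct_cnj a) b \<bullet> l = 0"
  shows "oct_mult (oct_mult a l) (oct_mult b l) = - oct_mult (oct_cnj b) a"
proof -
  have cnj: "oct_cnj l = - l"
    using l(1) by (simp add: oct_cnj_eq)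
  have cnj_orth: "oct_cnj x \<bullet> l = 0" if "x \<bullet> l = 0" for x
    using that by (simp add: inner_oct_cnj cnj)
  have al: "oct_cnj (oct_mult a l) = - oct_mult a l"
    using oct_mult_imaginary[OF l(1) cnj_orth[OF a]]
    by (simp add: oct_cnj_mult cnj oct_mult.minus_left)
  have "oct_mult a l \<bullet> b = 0"
    using ab inner_oct_mult_left[of a l b] by (simp add: inner_commute)
  then have "oct_mult (oct_mult a l) (oct_mult b l) = oct_mult (oct_cnj b) (oct_mult (oct_mult a l) l)"
    using oct_left_polar[of "oct_mult a l" b l] by (simp add: al oct_mult.minus_left)
  moreover have "oct_mult (oct_mult a l) l = - a"
    using oct_right_polar[of a l l] l by (simp add: cnj oct_mult.minus_right scaleR_2[symmetric] flip: minus_add_distrib)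
       (metis add.inverse_inverse scaleR_left_imp_eq scaleR_minus_right zero_neq_numeral)
  ultimately show ?thesis by (simp add: oct_mult.minus_right)
qed

section \<open>Homomorphisms and the images of i, j and l\<close>

definition oct_alg_hom :: "(oct \<Rightarrow> oct) \<Rightarrow> bool" where
  "oct_alg_hom g \<longleftrightarrow> linear g \<and> (\<forall>x y. g (oct_mult x y) = oct_mult (g x) (g y)) \<and> g oct_one = oct_one"

abbreviation oct_i :: oct where "oct_i \<equiv> ((\<i>, 0), (0, 0))"
abbreviation oct_j :: oct where "oct_j \<equiv> ((0, 1), (0, 0))"
abbreviation oct_l :: oct where "oct_l \<equiv> ((0, 0), (1, 0))"

definition oct_of_complex :: "oct \<Rightarrow> complex \<Rightarrow> oct" where
  "oct_of_complex e z = Re z *\<^sub>R oct_one + Im z *\<^sub>R e"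

definition oct_of_quat :: "oct \<Rightarrow> oct \<Rightarrow> quat \<Rightarrow> oct" where
  "oct_of_quat e e1 q = oct_of_complex e (fst q) + oct_mult (oct_of_complex e (snd q)) e1"

definition oct_of_triple :: "oct \<Rightarrow> oct \<Rightarrow> oct \<Rightarrow> oct \<Rightarrow> oct" where
  "oct_of_triple e e1 e2 x = oct_of_quat e e1 (fst x) + oct_mult (oct_of_quat e e1 (snd x)) e2"

text \<open>Every octonion is thus an expression in \<open>oct_i\<close>, \<open>oct_j\<close>,
  \<open>oct_l\<close>, so a homomorphism is determined by the images of these three.\<close>

lemma oct_of_triple_standard: "oct_of_triple oct_i oct_j oct_l x = x"
  by (rule oct_eqI)
     (simp_all add: oct_of_triple_def oct_of_quat_def oct_of_complex_def oct_simps complex_eq_iff)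

lemma oct_alg_hom_of_triple:
  assumes "oct_alg_hom g"
  shows "g (oct_of_triple e e1 e2 x) = oct_of_triple (g e) (g e1) (g e2) x"
proof -
  have "linear g" "\<And>x y. g (oct_mult x y) = oct_mult (g x) (g y)" "g oct_one = oct_one"
    using assms unfolding oct_alg_hom_def by auto
  then show ?thesis
    by (simp add: oct_of_triple_def oct_of_quat_def oct_of_complex_def linear_add linear_scale)
qed

lemma oct_alg_hom_eqI:
  assumes "oct_alg_hom g" "oct_alg_hom h" "g oct_i = h oct_i" "g oct_j = h oct_j" "g oct_l = h oct_l"
  shows "g = h"
  using assms oct_alg_hom_of_triple[of g oct_i oct_j oct_l] oct_alg_hom_of_triple[of h oct_i oct_j oct_l]
  unfolding oct_of_triple_standard by (metis ext)

text \<open>Orthogonality of \<open>e2\<close> to \<open>oct_mult e e1\<close> completes its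
  orthogonality to the quaternion algebra generated by \<open>e\<close> and \<open>e1\<close>, so
  that a second doubling, by \<open>e2\<close>, is possible.\<close>

locale oct_triple =
  fixes e e1 e2 :: oct
  assumes norms: "e \<bullet> e = 1" "e1 \<bullet> e1 = 1" "e2 \<bullet> e2 = 1"
    and imag: "e \<bullet> oct_one = 0" "e1 \<bullet> oct_one = 0" "e2 \<bullet> oct_one = 0"
    and orth: "e1 \<bullet> e = 0" "e2 \<bullet> e = 0" "e2 \<bullet> e1 = 0" "e2 \<bullet> oct_mult e e1 = 0"
begin

abbreviation "\<phi> \<equiv> oct_of_complex e"
abbreviation "\<psi> \<equiv> oct_of_quat e e1"

lemma phi_add: "\<phi> (a + b) = \<phi> a + \<phi> b"
  by (simp add: oct_of_complex_def algebra_simps)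

lemma phi_minus: "\<phi> (a - b) = \<phi> a - \<phi> b"
  by (simp add: oct_of_complex_def algebra_simps)

lemma phi_uminus: "\<phi> (- b) = - \<phi> b"
  by (simp add: oct_of_complex_def algebra_simps)

lemma phi_mult: "oct_mult (\<phi> a) (\<phi> b) = \<phi> (a * b)"
proof -
  have "oct_mult e e = - oct_one"
    using norms imag by (simp add: oct_square)
  then show ?thesis
    by (simp add: oct_of_complex_def oct_mult_add_left oct_mult_add_right oct_mult_scaleR_left
        oct_mult_scaleR_right algebra_simps)
qed

lemma phi_cnj: "oct_cnj (\<phi> a) = \<phi> (cnj a)"
  using imag(1)
  by (simp add: oct_of_complex_def oct_cnj_eq inner_add_left algebra_simps flip: scaleR_add_left)

lemma phi_orth1: "\<phi> a \<bullet> e1 = 0"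
  using imag orth by (simp add: oct_of_complex_def inner_add_left inner_add_right inner_commute)

lemma psi_add: "\<psi> (a + b) = \<psi> a + \<psi> b"
  by (simp add: oct_of_quat_def phi_add oct_mult_add_left)

lemma psi_minus: "\<psi> (a - b) = \<psi> a - \<psi> b"
  by (simp add: oct_of_quat_def phi_minus oct_mult.diff_left)

lemma psi_mult: "oct_mult (\<psi> a) (\<psi> b) = \<psi> (quat_mult a b)"
proof -
  have 1: "oct_mult (\<phi> a) (oct_mult (\<phi> b) e1) = oct_mult (\<phi> (b * a)) e1" for a b
    using cayley_dickson_right[of e1 "\<phi> a" "\<phi> b"] imag by (simp add: phi_mult phi_orth1)
  have 2: "oct_mult (oct_mult (\<phi> a) e1) (\<phi> b) = oct_mult (\<phi> (a * cnj b)) e1" for a b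
    using cayley_dickson_left[of e1 "\<phi> a" "\<phi> b"] imag by (simp add: phi_mult phi_orth1 phi_cnj)
  have 3: "oct_mult (oct_mult (\<phi> a) e1) (oct_mult (\<phi> b) e1) = - \<phi> (cnj b * a)" for a b
    using cayley_dickson_both[of e1 "\<phi> a" "\<phi> b"] imag norms
    by (simp add: phi_mult phi_orth1 phi_cnj)
  show ?thesis
    by (simp add: oct_of_quat_def quat_mult_def oct_mult_add_left oct_mult_add_right 1 2 3
        phi_mult phi_add phi_minus algebra_simps)
qed

lemma psi_cnj: "oct_cnj (\<psi> a) = \<psi> (quat_cnj a)"
proof -
  have "oct_cnj (oct_mult (\<phi> b) e1) = - oct_mult (\<phi> b) e1" for b
    using oct_mult_imaginary[of e1 "\<phi> (cnj b)"] imag(2)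
    by (simp add: oct_cnj_mult phi_orth1 phi_cnj oct_cnj_eq[of e1] oct_mult.minus_left)
  then show ?thesis
    by (simp add: oct_of_quat_def quat_cnj_def linear_add[OF linear_oct_cnj] phi_cnj phi_uminus
        oct_mult.minus_left)
qed

lemma psi_orth2: "\<psi> a \<bullet> e2 = 0"
  using imag orth
  by (simp add: oct_of_quat_def oct_of_complex_def inner_add_left inner_add_right inner_commute
      oct_mult_add_left oct_mult_scaleR_left)

text \<open>The computation of \<open>psi_mult\<close> one level higher: \<open>e2\<close> replaces
  \<open>e1\<close>, and the quaternions embedded by \<open>\<psi>\<close> replace the complex
  numbers embedded by \<open>\<phi>\<close>. It supplies the automorphisms that move the standard
  triple to an adapted one.\<close>

lemma oct_alg_hom_triple: "oct_alg_hom (oct_of_triple e e1 e2)"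
proof -
  have 1: "oct_mult (\<psi> a) (oct_mult (\<psi> b) e2) = oct_mult (\<psi> (quat_mult b a)) e2" for a b
    using cayley_dickson_right[of e2 "\<psi> a" "\<psi> b"] imag by (simp add: psi_mult psi_orth2)
  have 2: "oct_mult (oct_mult (\<psi> a) e2) (\<psi> b) = oct_mult (\<psi> (quat_mult a (quat_cnj b))) e2" for a b
    using cayley_dickson_left[of e2 "\<psi> a" "\<psi> b"] imag by (simp add: psi_mult psi_orth2 psi_cnj)
  have 3: "oct_mult (oct_mult (\<psi> a) e2) (oct_mult (\<psi> b) e2) = - \<psi> (quat_mult (quat_cnj b) a)" for a b
    using cayley_dickson_both[of e2 "\<psi> a" "\<psi> b"] imag norms
    by (simp add: psi_mult psi_orth2 psi_cnj)
  have "linear (oct_of_triple e e1 e2)"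
    by (rule linearI)
       (simp_all add: oct_of_triple_def oct_of_quat_def oct_of_complex_def oct_mult_add_left
          oct_mult_scaleR_left algebra_simps)
  moreover have "oct_of_triple e e1 e2 (oct_mult x y) =
      oct_mult (oct_of_triple e e1 e2 x) (oct_of_triple e e1 e2 y)" for x y
  proof -
    have f: "fst (oct_mult x y) = quat_mult (fst x) (fst y) - quat_mult (quat_cnj (snd y)) (snd x)"
      "snd (oct_mult x y) = quat_mult (snd y) (fst x) + quat_mult (snd x) (quat_cnj (fst y))"
      by (simp_all add: oct_mult_def)
    show ?thesis
      unfolding oct_of_triple_def f
      by (simp add: oct_mult_add_left oct_mult_add_right 1 2 3
          psi_mult psi_add psi_minus algebra_simps)
  qed
  moreover have "oct_of_triple e e1 e2 oct_one = oct_one"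
    by (simp add: oct_of_triple_def oct_of_quat_def oct_of_complex_def oct_one_def)
       (simp add: oct_mult_def quat_mult_def quat_cnj_def prod_eq_iff)
  ultimately show ?thesis
    unfolding oct_alg_hom_def by blast
qed

end

section \<open>Homomorphisms are bijective isometries\<close>

lemma oct_alg_hom_bij:
  assumes "oct_alg_hom g"
  shows "bij g"
proof -
  have g: "linear g" "\<And>x y. g (oct_mult x y) = oct_mult (g x) (g y)" "g oct_one = oct_one"
    using assms unfolding oct_alg_hom_def by auto
  have "x = 0" if "g x = 0" for x
  proof -
    have "oct_mult (oct_cnj x) x = (x \<bullet> x) *\<^sub>R oct_one"
      using oct_left_polar[of x x oct_one] by (simp add: scaleR_2[symmetric] flip: scaleR_scaleR)
    then have "(x \<bullet> x) *\<^sub>R oct_one = g (oct_mult (oct_cnj x) x)"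
      using g by (simp add: linear_scale)
    also have "\<dots> = 0" by (simp add: g that oct_mult.zero_right)
    finally show ?thesis by simp
  qed
  then have "inj g"
    using g(1) linear_injective_0 by blast
  then show ?thesis
    using g(1) linear_injective_imp_surjective by (auto simp: bij_def)
qed

text \<open>If \<open>u\<close> is mapped to the unit, then the image of
  \<open>oct_mult oct_one u\<close> is both \<open>g oct_one\<close> and the unit.\<close>

lemma oct_alg_hom_if_surj:
  assumes "linear g" "surj g" "\<And>x y. g (oct_mult x y) = oct_mult (g x) (g y)"
  shows "oct_alg_hom g"
proof -
  obtain u where "g u = oct_one" using assms(2) by (metis surjD)
  then have "g oct_one = oct_one"
    using assms(3)[of oct_one u] by simp
  then show ?thesis using assms unfolding oct_alg_hom_def by blast
qed

text \<open>The norm of an imaginary element can be read off from its square, which a homomorphism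
  respects. The real part splits off because the unit is fixed, and polarisation gives the inner
  product.\<close>

lemma oct_alg_hom_inner:
  assumes "oct_alg_hom g"
  shows "g x \<bullet> g y = x \<bullet> y"
proof -
  have g: "linear g" "\<And>x y. g (oct_mult x y) = oct_mult (g x) (g y)" "g oct_one = oct_one"
    using assms unfolding oct_alg_hom_def by auto
  have inj: "inj g" using oct_alg_hom_bij[OF assms] by (rule bij_is_inj)
  have imag: "g x \<bullet> oct_one = 0 \<and> g x \<bullet> g x = x \<bullet> x" if x: "x \<bullet> oct_one = 0" for x
  proof -
    have "oct_mult (g x) (g x) = - (x \<bullet> x) *\<^sub>R oct_one"
      using x g(1,3) oct_square[of x] unfolding g(2)[symmetric]
      by (simp add: linear_neg linear_scale)
    then have *: "(2 * (g x \<bullet> oct_one)) *\<^sub>R g x = (g x \<bullet> g x - x \<bullet> x) *\<^sub>R oct_one"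
      by (simp add: oct_square[of "g x"] algebra_simps)
    \<comment> \<open>If \<open>g x\<close> had a real part, \<open>*\<close> would make it a real
      multiple of the unit; by injectivity \<open>x\<close> would be real as well as imaginary,
      hence zero.\<close>
    have "g x \<bullet> oct_one = 0"
    proof (rule ccontr)
      assume nz: "g x \<bullet> oct_one \<noteq> 0"
      define c where "c = (g x \<bullet> g x - x \<bullet> x) / (2 * (g x \<bullet> oct_one))"
      have "g x = c *\<^sub>R oct_one"
        using * nz unfolding c_def
        by (metis (no_types, lifting) divide_inverse mult.commute mult_eq_0_iff scaleR_one
            scaleR_scaleR right_inverse zero_neq_numeral)
      then have "g x = g (c *\<^sub>R oct_one)" by (simp add: g linear_scale)
      then have "x = c *\<^sub>R oct_one" using inj by (simp add: inj_eq)
      then show False using x nz by (simp add: linear_0 g)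
    qed
    then show ?thesis using * by simp
  qed
  have sq: "g x \<bullet> g x = x \<bullet> x" for x
  proof -
    define r u where "r = x \<bullet> oct_one" and "u = x - r *\<^sub>R oct_one"
    have x: "x = r *\<^sub>R oct_one + u" by (simp add: u_def)
    have u: "u \<bullet> oct_one = 0" by (simp add: u_def r_def inner_diff_left)
    have "g x = r *\<^sub>R oct_one + g u" by (subst x) (simp add: g linear_add linear_scale)
    then show ?thesis
      using imag[OF u] u by (simp add: x inner_add_left inner_add_right inner_commute)
  qed
  show ?thesis
    using sq[of "x + y"] sq[of x] sq[of y]
    by (simp add: linear_add[OF g(1)] inner_add_left inner_add_right inner_commute)
qed

section \<open>Invariant subspaces\<close>

text \<open>The quadratic form of \<open>A\<close> attains its maximum \<open>c\<close> on the unit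
  sphere of \<open>W\<close>. Then \<open>c - A\<close> is positive semidefinite on \<open>W\<close>
  and vanishes as a form at the maximiser, which is therefore an eigenvector.\<close>

lemma selfadjoint_eigenvector:
  fixes A :: "'a::euclidean_space \<Rightarrow> 'a"
  assumes A: "linear A" and W: "subspace W" "W \<noteq> {0}"
    and inv: "\<And>x. x \<in> W \<Longrightarrow> A x \<in> W"
    and sym: "\<And>x y. x \<in> W \<Longrightarrow> y \<in> W \<Longrightarrow> A x \<bullet> y = x \<bullet> A y"
  obtains c x where "x \<in> W" "x \<noteq> 0" "A x = c *\<^sub>R x"
proof -
  define S where "S = W \<inter> sphere 0 1"
  have "compact S"
    unfolding S_def using closed_subspace[OF W(1)] by (intro closed_Int_compact compact_sphere)
  moreover have "S \<noteq> {}"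
  proof -
    obtain y where "y \<in> W" "y \<noteq> 0" using W subspace_0 by blast
    then have "y /\<^sub>R norm y \<in> S" using W(1) by (simp add: S_def subspace_scale)
    then show ?thesis by blast
  qed
  moreover have "continuous_on S (\<lambda>x. x \<bullet> A x)"
    using A by (intro continuous_intros linear_continuous_on) (simp add: linear_conv_bounded_linear)
  ultimately obtain x0 where x0: "x0 \<in> S" and max: "\<And>y. y \<in> S \<Longrightarrow> y \<bullet> A y \<le> x0 \<bullet> A x0"
    using continuous_attains_sup[of S "\<lambda>x. x \<bullet> A x"] by blast
  define c where "c = x0 \<bullet> A x0"
  have x0W: "x0 \<in> W" and nx0: "x0 \<bullet> x0 = 1"
    using x0 by (auto simp: S_def dot_square_norm)
  define B where "B = (\<lambda>z. c *\<^sub>R z - A z)"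
  have q: "0 \<le> z \<bullet> B z" if "z \<in> W" for z
  proof (cases "z = 0")
    case False
    have "z /\<^sub>R norm z \<in> S" using that W(1) False by (simp add: S_def subspace_scale)
    then have "(z /\<^sub>R norm z) \<bullet> A (z /\<^sub>R norm z) \<le> c"
      using max c_def by blast
    then have "(z \<bullet> A z) / (norm z)\<^sup>2 \<le> c"
      by (simp add: linear_scale[OF A] power2_eq_square divide_simps)
    then show ?thesis
      using False by (simp add: B_def inner_diff_right dot_square_norm divide_simps mult.commute)
  qed (simp add: B_def)
  define z where "z = B x0"
  have zW: "z \<in> W"
    unfolding z_def B_def using W(1) x0W inv by (simp add: subspace_diff subspace_scale)
  have "z = 0"
  proof (rule ccontr)
    assume "z \<noteq> 0"
    then have n: "0 < z \<bullet> z" by simp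
    \<comment> \<open>With this step length the first-order decrease along \<open>z\<close>
      outweighs the second-order term, contradicting \<open>q\<close>. Adding 1 keeps the
      denominator positive when \<open>z \<bullet> B z\<close> is zero.\<close>
    define s where "s = (z \<bullet> z) / (z \<bullet> B z + 1)"
    have s: "0 < s" using n q[OF zW] by (simp add: s_def)
    have xz: "x0 \<bullet> B z = z \<bullet> z" and zx: "z \<bullet> B x0 = z \<bullet> z" and xx: "x0 \<bullet> B x0 = 0"
      using sym[OF x0W zW] nx0 by (auto simp: z_def B_def inner_simps c_def inner_commute)
    have Blin: "B (x0 - s *\<^sub>R z) = B x0 - s *\<^sub>R B z"
      by (simp add: B_def linear_diff[OF A] linear_scale[OF A] algebra_simps)
    have "0 \<le> (x0 - s *\<^sub>R z) \<bullet> B (x0 - s *\<^sub>R z)"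
      using W(1) x0W zW by (intro q) (simp add: subspace_diff subspace_scale)
    also have "\<dots> = s * (s * (z \<bullet> B z) - 2 * (z \<bullet> z))"
      unfolding Blin by (simp add: inner_simps xz zx xx algebra_simps)
    finally have "2 * (z \<bullet> z) \<le> s * (z \<bullet> B z)"
      using s by (simp add: zero_le_mult_iff)
    also have "\<dots> \<le> s * (z \<bullet> B z + 1)" using s by simp
    also have "\<dots> = z \<bullet> z" using q[OF zW] by (simp add: s_def)
    finally show False using n by simp
  qed
  then have "A x0 = c *\<^sub>R x0" by (simp add: z_def B_def)
  then show ?thesis using that[of x0 c] x0W nx0 by force
qed

text \<open>On an invariant subspace of minimal dimension Schur's lemma holds for self-adjoint operators.\<close>

lemma invariant_subspace_schur:
  fixes V :: "'a::euclidean_space set"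
  assumes V: "subspace V" "V \<noteq> {0}"
    and F: "\<forall>t\<in>T. linear (f t)" "\<forall>t\<in>T. \<forall>x\<in>V. f t x \<in> V"
  shows "\<exists>W. subspace W \<and> W \<subseteq> V \<and> W \<noteq> {0} \<and> (\<forall>t\<in>T. \<forall>x\<in>W. f t x \<in> W) \<and>
    (\<forall>A. linear A \<longrightarrow> (\<forall>x\<in>W. A x \<in> W) \<longrightarrow> (\<forall>t\<in>T. \<forall>x\<in>W. A (f t x) = f t (A x)) \<longrightarrow>
      (\<forall>x\<in>W. \<forall>y\<in>W. A x \<bullet> y = x \<bullet> A y) \<longrightarrow> (\<exists>c. \<forall>x\<in>W. A x = c *\<^sub>R x))"
proof -
  define Q where "Q = (\<lambda>W. subspace W \<and> W \<subseteq> V \<and> W \<noteq> {0} \<and> (\<forall>t\<in>T. \<forall>x\<in>W. f t x \<in> W))"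
  have "Q V" using V F by (auto simp: Q_def)
  then obtain W where W: "Q W" and min: "\<And>U. Q U \<Longrightarrow> dim W \<le> dim U"
    using ex_has_least_nat[of Q V dim] by blast
  have "\<exists>c. \<forall>x\<in>W. A x = c *\<^sub>R x"
    if A: "linear A" "\<And>x. x \<in> W \<Longrightarrow> A x \<in> W"
      "\<And>t x. t \<in> T \<Longrightarrow> x \<in> W \<Longrightarrow> A (f t x) = f t (A x)"
      "\<And>x y. x \<in> W \<Longrightarrow> y \<in> W \<Longrightarrow> A x \<bullet> y = x \<bullet> A y" for A
  proof -
    obtain c x where x: "x \<in> W" "x \<noteq> 0" "A x = c *\<^sub>R x"
      using selfadjoint_eigenvector[of A W] A W unfolding Q_def by metis
    \<comment> \<open>The eigenspace is invariant because \<open>A\<close> commutes with the family,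
      so minimality of the dimension forces it to be all of \<open>W\<close>.\<close>
    define U where "U = {x \<in> W. A x = c *\<^sub>R x}"
    have "subspace U"
      using W A(1) unfolding Q_def U_def subspace_def
      by (auto simp: linear_0 linear_add linear_scale algebra_simps)
    moreover have "f t y \<in> U" if "t \<in> T" "y \<in> U" for t y
      using that A(3)[of t y] W F(1) by (auto simp: U_def Q_def linear_scale)
    ultimately have "Q U" using x W by (auto simp: Q_def U_def)
    then have "U = W"
      using min[of U] W by (intro subspace_dim_equal) (auto simp: Q_def U_def)
    then show ?thesis by (auto simp: U_def)
  qed
  then have "\<forall>A. linear A \<longrightarrow> (\<forall>x\<in>W. A x \<in> W) \<longrightarrow> (\<forall>t\<in>T. \<forall>x\<in>W. A (f t x) = f t (A x)) \<longrightarrow>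
      (\<forall>x\<in>W. \<forall>y\<in>W. A x \<bullet> y = x \<bullet> A y) \<longrightarrow> (\<exists>c. \<forall>x\<in>W. A x = c *\<^sub>R x)"
    by (intro allI impI) simp
  with W show ?thesis
    unfolding Q_def by (elim conjE) (intro exI[of _ W] conjI; assumption)
qed

section \<open>Inverses of operators and the group structure of \<open>G2\<close>\<close>

lemma linear_blinfun_apply: "linear (blinfun_apply g)"
  by (simp add: blinfun.bounded_linear_right bounded_linear.linear)

text \<open>\<open>Blinfun\<close> returns the given function only if that is bounded and linear;
  for the inverse this holds by finite dimension.\<close>

lemma op_inv_apply:
  fixes g :: "'v::euclidean_space \<Rightarrow>\<^sub>L 'v"
  assumes "bij (blinfun_apply g)"
  shows "blinfun_apply (op_inv g) = inv (blinfun_apply g)"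
proof -
  have "linear (inv (blinfun_apply g))"
    using assms linear_blinfun_apply[of g]
    by (simp add: inj_linear_imp_inv_linear bij_is_inj)
  then show ?thesis
    by (simp add: bounded_linear_Blinfun_apply linear_conv_bounded_linear)
qed

lemma op_inv_cancel [simp]:
  fixes g :: "'v::euclidean_space \<Rightarrow>\<^sub>L 'v"
  assumes "bij (blinfun_apply g)"
  shows "blinfun_apply (op_inv g) (g x) = x" "g (blinfun_apply (op_inv g) x) = x"
    "op_inv g o\<^sub>L g = id_blinfun" "g o\<^sub>L op_inv g = id_blinfun"
  using assms
  by (auto simp: op_inv_apply bij_is_inj bij_is_surj surj_f_inv_f intro!: blinfun_eqI)

lemma op_inv_unique:
  fixes g h :: "'v::euclidean_space \<Rightarrow>\<^sub>L 'v"
  assumes "\<And>x. blinfun_apply h (blinfun_apply g x) = x" "\<And>x. blinfun_apply g (blinfun_apply h x) = x"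
  shows "bij (blinfun_apply g)" "op_inv g = h"
proof -
  show b: "bij (blinfun_apply g)"
    using assms by (metis bijI')
  show "op_inv g = h"
    by (rule blinfun_eqI) (metis assms(2) b op_inv_cancel(1))
qed

lemma G2_bij: "g \<in> G2 \<Longrightarrow> bij (blinfun_apply g)"
  by (simp add: G2_def)

lemma G2_oct_alg_hom:
  assumes "g \<in> G2"
  shows "oct_alg_hom (blinfun_apply g)"
proof (rule oct_alg_hom_if_surj)
  show "surj (blinfun_apply g)" using assms by (simp add: G2_bij bij_is_surj)
  show "g (oct_mult x y) = oct_mult (g x) (g y)" for x y
    using assms unfolding G2_def by blast
qed (rule linear_blinfun_apply)

lemma oct_alg_hom_in_G2:
  assumes "oct_alg_hom (blinfun_apply g)"
  shows "g \<in> G2"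
proof -
  have "\<forall>x y. g (oct_mult x y) = oct_mult (g x) (g y)"
    using assms unfolding oct_alg_hom_def by (elim conjE)
  then show ?thesis
    unfolding G2_def mem_Collect_eq by (intro conjI oct_alg_hom_bij[OF assms])
qed

lemma G2_mult: "g \<in> G2 \<Longrightarrow> blinfun_apply g (oct_mult x y) = oct_mult (g x) (g y)"
  unfolding G2_def by blast

lemma linear_group_G2: "linear_group G2"
proof -
  have "op_inv g \<in> G2" if g: "g \<in> G2" for g
  proof (rule oct_alg_hom_in_G2, rule oct_alg_hom_if_surj)
    note b = G2_bij[OF g]
    show "linear (blinfun_apply (op_inv g))" by (rule linear_blinfun_apply)
    show "surj (blinfun_apply (op_inv g))"
      using b op_inv_cancel(1) by (metis surjI)
    fix x y
    have "g (op_inv g (oct_mult x y)) = g (oct_mult (op_inv g x) (op_inv g y))"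
      by (simp add: G2_mult[OF g] b)
    then show "op_inv g (oct_mult x y) = oct_mult (op_inv g x) (op_inv g y)"
      using b by (metis op_inv_cancel(1))
  qed
  moreover have "g o\<^sub>L h \<in> G2" if "g \<in> G2" "h \<in> G2" for g h
  proof (intro oct_alg_hom_in_G2 oct_alg_hom_if_surj linear_blinfun_apply)
    show "surj (blinfun_apply (g o\<^sub>L h))"
      using comp_surj[of "blinfun_apply h" "blinfun_apply g"] that
      by (simp add: G2_bij bij_is_surj blinfun_compose.rep_eq)
  qed (simp add: G2_mult that)
  moreover have "id_blinfun \<in> G2"
    by (intro oct_alg_hom_in_G2 oct_alg_hom_if_surj linear_blinfun_apply) simp_all
  ultimately show ?thesis
    unfolding linear_group_def using G2_bij by blast
qed

lemma G2_inner: "g \<in> G2 \<Longrightarrow> blinfun_apply g x \<bullet> blinfun_apply g y = x \<bullet> y"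
  by (simp add: oct_alg_hom_inner G2_oct_alg_hom)

lemma G2_one: "g \<in> G2 \<Longrightarrow> blinfun_apply g oct_one = oct_one"
  using G2_oct_alg_hom by (simp add: oct_alg_hom_def)

lemma G2_inner_op_inv:
  assumes "g \<in> G2"
  shows "blinfun_apply g x \<bullet> y = x \<bullet> op_inv g y" "blinfun_apply (op_inv g) x \<bullet> y = x \<bullet> g y"
proof -
  note cancel = op_inv_cancel(2)[OF G2_bij[OF assms]]
  show "blinfun_apply g x \<bullet> y = x \<bullet> op_inv g y"
    using G2_inner[OF assms, of x "op_inv g y"] unfolding cancel .
  show "blinfun_apply (op_inv g) x \<bullet> y = x \<bullet> g y"
    using G2_inner[OF assms, of "op_inv g x" y] unfolding cancel by (rule sym)
qed

section \<open>A common fixed imaginary unit of a torus\<close>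

lemma connected_subset_pm_one:
  assumes "connected S" "S \<subseteq> {1, - 1 :: real}" "1 \<in> S"
  shows "S = {1}"
proof -
  have False if "- 1 \<in> S"
    using connectedD_interval[OF assms(1) that assms(3), of 0] assms(2) by auto
  then show ?thesis using assms by auto
qed

text \<open>Recovers \<open>t x\<close> from its symmetric and skew parts, with \<open>v\<close> the
  image under the inverse; with \<open>v = 0\<close> it cancels a factor 2.\<close>

lemma scaleR_half_sum_diff: "u = (1 / 2) *\<^sub>R ((u + v) + (u - v :: 'a::real_vector))"
proof -
  have "(u + v) + (u - v) = 2 *\<^sub>R u" by (simp add: scaleR_2)
  then show ?thesis by (simp only: scaleR_scaleR) simp
qed

text \<open>Orthogonal imaginary \<open>x\<close> and \<open>y\<close> anticommute, and unit ones
  have square minus one. Hence the product of the two is unchanged when both are rotated in their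
  plane, which is the third claim for \<open>p * p + q * q = 1\<close>.\<close>

lemma oct_mult_orthonormal:
  assumes "x \<bullet> oct_one = 0" "y \<bullet> oct_one = 0" "x \<bullet> y = 0" "x \<bullet> x = 1" "y \<bullet> y = 1"
  shows "oct_mult x y \<bullet> oct_one = 0" "oct_mult x y \<bullet> oct_mult x y = 1"
    "oct_mult (p *\<^sub>R x + q *\<^sub>R y) (p *\<^sub>R y - q *\<^sub>R x) = (p * p + q * q) *\<^sub>R oct_mult x y"
proof -
  have cx: "oct_cnj x = - x" and cy: "oct_cnj y = - y"
    using assms by (simp_all add: oct_cnj_eq)
  have yx: "oct_mult y x = - oct_mult x y"
    using oct_left_polar[of x y oct_one] assms(3)
    by (simp add: cx cy oct_mult.minus_left algebra_simps eq_neg_iff_add_eq_0)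
  show "oct_mult x y \<bullet> oct_one = 0"
    using inner_oct_mult_left[of x y oct_one] assms(3) by (simp add: cx inner_commute)
  have "(1 / 2) *\<^sub>R (- oct_mult x (oct_mult x y) - oct_mult x (oct_mult x y)) = y"
    using oct_left_polar[of x x y] assms(4) by (simp add: cx oct_mult.minus_left)
  then have "- oct_mult x (oct_mult x y) = y"
    using scaleR_half_sum_diff[of "- oct_mult x (oct_mult x y)" 0] by simp
  then show "oct_mult x y \<bullet> oct_mult x y = 1"
    using assms(5) inner_oct_mult_left[of x y "oct_mult x y"] by (simp add: cx oct_mult.minus_left)
  show "oct_mult (p *\<^sub>R x + q *\<^sub>R y) (p *\<^sub>R y - q *\<^sub>R x) = (p * p + q * q) *\<^sub>R oct_mult x y"
    using oct_square[of x] oct_square[of y] assms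
    by (simp add: oct_mult.add_left oct_mult.diff_right oct_mult_scaleR_left oct_mult_scaleR_right yx
        algebra_simps)
qed

locale torus_in_G2 =
  fixes T :: "(oct \<Rightarrow>\<^sub>L oct) set"
  assumes torus: "torus T" and T_G2: "T \<subseteq> G2"
begin

lemma in_G2: "t \<in> T \<Longrightarrow> t \<in> G2"
  using T_G2 by blast

lemma op_inv_in: "t \<in> T \<Longrightarrow> op_inv t \<in> T"
  using torus by (auto simp: torus_def linear_group_def)

lemma bij: "t \<in> T \<Longrightarrow> bij (blinfun_apply t)"
  using in_G2 G2_bij by blast

lemma commute:
  assumes "s \<in> T" "t \<in> T"
  shows "blinfun_apply s (blinfun_apply t x) = t (s x)"
proof -
  have "s o\<^sub>L t = t o\<^sub>L s"
    using torus assms unfolding torus_def by blast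
  then have "(s o\<^sub>L t) x = (t o\<^sub>L s) x" by (rule arg_cong)
  then show ?thesis by simp
qed

text \<open>Either every element of \<open>T\<close> equals its inverse on a minimal invariant
  subspace \<open>W\<close>, and connectedness excludes the sign -1. Or the skew part
  \<open>K\<close> of a single \<open>t0\<close> is nonzero there and singles out a plane rotated by
  all of \<open>T\<close>.\<close>

lemma fixed_imaginary_unit:
  obtains e where "e \<bullet> e = 1" "e \<bullet> oct_one = 0" "\<And>t. t \<in> T \<Longrightarrow> blinfun_apply t e = e"
proof -
  define V where "V = {x. x \<bullet> oct_one = 0}"
  have V: "subspace V" unfolding V_def by (auto simp: subspace_def inner_add_left)
  have "oct_i \<in> V" "oct_i \<noteq> 0" by (simp_all add: V_def inner_oct oct_one_def prod_eq_iff inner_complex_def)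
  then have V0: "V \<noteq> {0}" by blast
  have TV: "t x \<in> V" if "t \<in> T" "x \<in> V" for t x
    using that G2_inner_op_inv(2)[OF in_G2[OF that(1)], of oct_one x] G2_one[OF in_G2[OF op_inv_in[OF that(1)]]]
    by (simp add: V_def inner_commute)
  obtain W where W: "subspace W" "W \<subseteq> V" "W \<noteq> {0}" "\<And>t x. t \<in> T \<Longrightarrow> x \<in> W \<Longrightarrow> blinfun_apply t x \<in> W"
    and schur': "\<forall>A. linear A \<longrightarrow> (\<forall>x\<in>W. A x \<in> W) \<longrightarrow> (\<forall>t\<in>T. \<forall>x\<in>W. A (t x) = t (A x)) \<longrightarrow>
      (\<forall>x\<in>W. \<forall>y\<in>W. A x \<bullet> y = x \<bullet> A y) \<longrightarrow> (\<exists>c. \<forall>x\<in>W. A x = c *\<^sub>R x)"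
  proof -
    have "\<forall>t\<in>T. linear (blinfun_apply t)" "\<forall>t\<in>T. \<forall>x\<in>V. t x \<in> V"
      using linear_blinfun_apply TV by blast+
    from invariant_subspace_schur[of V T blinfun_apply, OF V V0 this] show ?thesis
      by (elim exE conjE) (rule that; blast)
  qed
  note schur = schur'[rule_format]
  note adj = G2_inner_op_inv[OF in_G2]
  \<comment> \<open>\<open>op_inv t\<close> is the adjoint of the isometry \<open>t\<close>, so the
    sum is self-adjoint; it commutes with \<open>T\<close> since \<open>T\<close> is
    abelian.\<close>
  have sum: "\<exists>c. \<forall>x\<in>W. blinfun_apply t x + op_inv t x = c *\<^sub>R x" if t: "t \<in> T" for t
  proof (rule schur)
    show "linear (\<lambda>x. blinfun_apply t x + op_inv t x)"
      by (intro linear_compose_add linear_blinfun_apply)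
    show "t x + op_inv t x \<in> W" if "x \<in> W" for x
      using W(1) W(4) t op_inv_in[OF t] that by (simp add: subspace_add)
    show "t (s x) + op_inv t (s x) = s (t x + op_inv t x)" if "s \<in> T" for s x
      using commute[OF that t] commute[OF that op_inv_in[OF t]] by (simp add: blinfun.add_right)
    show "(t x + op_inv t x) \<bullet> y = x \<bullet> (t y + op_inv t y)" for x y
      by (simp add: inner_add_left inner_add_right adj[OF t])
  qed
  show ?thesis
  proof (cases "\<forall>t\<in>T. \<forall>x\<in>W. blinfun_apply t x = op_inv t x")
    case True
    obtain x where x: "x \<in> W" "x \<bullet> x = 1"
    proof -
      obtain y where "y \<in> W" "y \<noteq> 0" using W subspace_0 by blast
      then show ?thesis
        using that[of "y /\<^sub>R norm y"] W(1)
        by (simp add: subspace_scale dot_square_norm power2_eq_square)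
    qed
    have pm: "blinfun_apply t x = x \<or> blinfun_apply t x = - x" if t: "t \<in> T" for t
    proof -
      obtain c where "t x + op_inv t x = c *\<^sub>R x" using sum[OF t] x by blast
      then have "2 *\<^sub>R t x = c *\<^sub>R x" using True t x by (simp add: scaleR_2)
      then have tx: "t x = (c / 2) *\<^sub>R x"
        by (metis (no_types) divide_inverse_commute scaleR_one scaleR_scaleR left_inverse zero_neq_numeral)
      then have "(c / 2) * (c / 2) = 1"
        using G2_inner[OF in_G2[OF t], of x x] x by simp
      then have "c / 2 = 1 \<or> c / 2 = -1"
        by (simp only: square_eq_1_iff)
      then show ?thesis using tx by auto
    qed
    \<comment> \<open>The sign by which \<open>t\<close> acts on \<open>x\<close> depends
      continuously on \<open>t\<close> and is 1 at the identity.\<close>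
    have "connected ((\<lambda>t. blinfun_apply t x \<bullet> x) ` T)"
      using torus unfolding torus_def
      by (intro connected_continuous_image continuous_intros) auto
    moreover have "(\<lambda>t. blinfun_apply t x \<bullet> x) ` T \<subseteq> {1, -1}"
      using pm x by fastforce
    moreover have "1 \<in> (\<lambda>t. blinfun_apply t x \<bullet> x) ` T"
      using torus x unfolding torus_def linear_group_def by (force intro!: image_eqI[of _ _ id_blinfun])
    ultimately have one: "(\<lambda>t. blinfun_apply t x \<bullet> x) ` T = {1}"
      by (rule connected_subset_pm_one)
    have "t x = x" if "t \<in> T" for t
    proof -
      have "t x \<bullet> x = 1" using one that by blast
      then show ?thesis using pm[OF that] x by auto
    qed
    then show ?thesis using that[of x] x W(2) by (auto simp: V_def)
  next
    case False
    then obtain t0 x0 where t0: "t0 \<in> T" and x0: "x0 \<in> W" "t0 x0 \<noteq> op_inv t0 x0" by blast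
    define K where "K = (\<lambda>x. blinfun_apply t0 x - op_inv t0 x)"
    have K: "linear K" unfolding K_def by (intro linear_compose_sub linear_blinfun_apply)
    have KW: "K x \<in> W" if "x \<in> W" for x
      unfolding K_def using W(1) W(4) t0 op_inv_in[OF t0] that by (simp add: subspace_diff)
    have KT: "K (s x) = s (K x)" if "s \<in> T" for s x
      using commute[OF that t0] commute[OF that op_inv_in[OF t0]] by (simp add: K_def blinfun.diff_right)
    have Kskew: "K x \<bullet> y = - (x \<bullet> K y)" for x y
      by (simp add: K_def inner_diff_left inner_diff_right adj[OF t0])
    \<comment> \<open>A product of two commuting skew operators is self-adjoint. Taking
      \<open>t = t0\<close> also makes the square of \<open>K\<close> a scalar
      \<open>k'\<close>.\<close>
    have KD: "\<exists>c. \<forall>x\<in>W. K (blinfun_apply t x - op_inv t x) = c *\<^sub>R x" if t: "t \<in> T" for t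
    proof (rule schur)
      show "linear (\<lambda>x. K (blinfun_apply t x - op_inv t x))"
        using linear_compose[OF linear_compose_sub[OF linear_blinfun_apply linear_blinfun_apply] K]
        by (simp add: comp_def)
      show "K (t x - op_inv t x) \<in> W" if "x \<in> W" for x
        using W(1) W(4) t op_inv_in[OF t] that by (simp add: subspace_diff KW)
      show "K (t (s x) - op_inv t (s x)) = s (K (t x - op_inv t x))" if "s \<in> T" for s x
        by (simp add: commute[OF t that] commute[OF op_inv_in[OF t] that] KT[OF that]
            flip: blinfun.diff_right)
      show "K (t x - op_inv t x) \<bullet> y = x \<bullet> K (t y - op_inv t y)" for x y
        by (simp add: Kskew inner_diff_left inner_diff_right adj[OF t] linear_diff[OF K]
            KT[OF t] KT[OF op_inv_in[OF t]])
    qed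
    obtain k' where k': "\<And>x. x \<in> W \<Longrightarrow> K (K x) = k' *\<^sub>R x"
      using KD[OF t0] unfolding K_def by blast
    have Kx0: "K x0 \<noteq> 0" using x0 by (simp add: K_def)
    have x00: "x0 \<noteq> 0" using x0 by auto
    have "- (k' * (x0 \<bullet> x0)) = K x0 \<bullet> K x0"
      using Kskew[of "x0" "K x0"] k'[OF x0(1)] by simp
    then have "k' * (x0 \<bullet> x0) < 0" using Kx0 by (metis inner_gt_zero_iff neg_0_less_iff_less)
    then have k'neg: "k' < 0" by (metis inner_ge_zero mult_nonneg_nonneg not_less)
    \<comment> \<open>The square of a nonzero skew operator is a negative scalar here;
      \<open>K\<close> divided by \<open>k\<close> is the quarter turn taking \<open>x\<close> to
      \<open>y\<close> and \<open>y\<close> to \<open>- x\<close>.\<close>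
    define k where "k = sqrt (- k')"
    have k: "k > 0" "k * k = - k'" using k'neg by (simp_all add: k_def)
    define x y where "x = x0 /\<^sub>R norm x0" and "y = K x /\<^sub>R k"
    have xW: "x \<in> W" using W(1) x0 by (simp add: x_def subspace_scale)
    have xx: "x \<bullet> x = 1" using x00 by (simp add: x_def dot_square_norm power2_eq_square)
    have Kx: "K x = k *\<^sub>R y" using k by (simp add: y_def)
    have Ky: "K y = - k *\<^sub>R x"
    proof -
      have "k' = - (k * k)" using k by simp
      then show ?thesis using k'[OF xW] k(1) by (simp add: y_def linear_scale[OF K])
    qed
    have yW: "y \<in> W" using W(1) KW[OF xW] by (simp add: y_def subspace_scale)
    have xy: "x \<bullet> y = 0"
      using Kskew[of x x] k by (simp add: Kx inner_commute)
    have yy: "y \<bullet> y = 1"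
      using Kskew[of x y] k xx by (simp add: Kx Ky)
    have ximag: "x \<bullet> oct_one = 0" and yimag: "y \<bullet> oct_one = 0"
      using xW yW W(2) by (auto simp: V_def)
    define e where "e = oct_mult x y"
    have "t e = e" if t: "t \<in> T" for t
    proof -
      obtain c where c: "t x + op_inv t x = c *\<^sub>R x" using sum[OF t] xW by blast
      obtain d where d: "K (t x - op_inv t x) = d *\<^sub>R x" using KD[OF t] xW by blast
      \<comment> \<open>A second application of \<open>K\<close> can be undone by dividing by
        \<open>k'\<close>; this places the skew part of \<open>t x\<close> on the line through
        \<open>y\<close>.\<close>
      have "K (K (t x - op_inv t x)) = k' *\<^sub>R (t x - op_inv t x)"
        using W(1) W(4) t op_inv_in[OF t] xW by (intro k') (simp add: subspace_diff)
      then have "(1 / k') *\<^sub>R (k' *\<^sub>R (t x - op_inv t x)) = (1 / k') *\<^sub>R (d *\<^sub>R (k *\<^sub>R y))"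
        by (simp only: d linear_scale[OF K] Kx)
      then have D: "t x - op_inv t x = (d * k / k') *\<^sub>R y"
        using k'neg by simp
      have "t x = (1 / 2) *\<^sub>R ((t x + op_inv t x) + (t x - op_inv t x))"
        by (rule scaleR_half_sum_diff)
      then have "t x = (c / 2) *\<^sub>R x + (d * k / k' / 2) *\<^sub>R y"
        unfolding c D by (simp add: scaleR_add_right)
      then obtain p q where tx: "t x = p *\<^sub>R x + q *\<^sub>R y" by blast
      have "k *\<^sub>R t y = K (t x)"
        using KT[OF t, of x] by (simp add: Kx blinfun.scaleR_right)
      also have "\<dots> = k *\<^sub>R (p *\<^sub>R y - q *\<^sub>R x)"
        by (simp add: tx linear_add[OF K] linear_scale[OF K] Kx Ky algebra_simps)
      finally have ty: "t y = p *\<^sub>R y - q *\<^sub>R x" using k by simp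
      have pq: "p * p + q * q = 1"
        using G2_inner[OF in_G2[OF t], of x x] by (simp add: tx inner_simps xx yy xy inner_commute)
      have "t e = oct_mult (p *\<^sub>R x + q *\<^sub>R y) (p *\<^sub>R y - q *\<^sub>R x)"
        unfolding e_def by (simp add: G2_mult[OF in_G2[OF t]] tx ty)
      also have "\<dots> = (p * p + q * q) *\<^sub>R e"
        unfolding e_def by (rule oct_mult_orthonormal(3)[OF ximag yimag xy xx yy])
      finally show ?thesis by (simp add: pq)
    qed
    moreover have "e \<bullet> oct_one = 0" "e \<bullet> e = 1"
      unfolding e_def using oct_mult_orthonormal[OF ximag yimag xy xx yy] by blast+
    ultimately show ?thesis using that[of e] by blast
  qed
qed

end

section \<open>Maximal tori\<close>

context torus_in_G2
begin

text \<open>Multiplication by \<open>e\<close> is a skew complex structure \<open>J\<close>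
  commuting with \<open>T\<close>. Adding \<open>J\<close> to the family makes a minimal invariant
  subspace a complex one, and \<open>J\<close> composed with \<open>t - op_inv t\<close> is
  self-adjoint and commutes with the whole family. Both parts of \<open>t\<close> are then
  combinations of the identity and \<open>J\<close>, that is, a complex scalar.\<close>

lemma eigenvector:
  assumes e: "e \<bullet> e = 1" "e \<bullet> oct_one = 0" "\<And>t. t \<in> T \<Longrightarrow> blinfun_apply t e = e"
    and V: "subspace V" "V \<noteq> {0}" "\<And>t x. t \<in> T \<Longrightarrow> x \<in> V \<Longrightarrow> blinfun_apply t x \<in> V"
      "\<And>x. x \<in> V \<Longrightarrow> oct_mult e x \<in> V"
  obtains x where "x \<in> V" "x \<bullet> x = 1"
    "\<And>t. t \<in> T \<Longrightarrow> \<exists>z. blinfun_apply t x = oct_mult (oct_of_complex e z) x"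
proof -
  define J where "J = oct_mult e"
  have J: "linear J" unfolding J_def by (rule bounded_linear.linear[OF oct_mult.bounded_linear_right])
  have Jskew: "J x \<bullet> y = - (x \<bullet> J y)" for x y
    using inner_oct_mult_left[of e x y] e by (simp add: J_def oct_cnj_eq oct_mult.minus_left)
  have JJ: "J (J x) = - x" for x
  proof -
    have "(1 / 2) *\<^sub>R (- J (J x) - J (J x)) = x"
      using oct_left_polar[of e e x] e by (simp add: J_def oct_cnj_eq oct_mult.minus_left)
    then have "- J (J x) = x"
      using scaleR_half_sum_diff[of "- J (J x)" 0] by simp
    then show ?thesis by (metis minus_minus)
  qed
  have Jt: "t (J x) = J (t x)" if "t \<in> T" for t x
    using e that by (simp add: J_def G2_mult in_G2)
  let ?F = "insert J (blinfun_apply ` T)"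
  have F: "\<forall>f\<in>?F. linear f" "\<forall>f\<in>?F. \<forall>x\<in>V. f x \<in> V"
    using J V(3,4) by (auto simp: linear_blinfun_apply J_def)
  obtain W where W: "subspace W" "W \<subseteq> V" "W \<noteq> {0}" "\<forall>f\<in>?F. \<forall>x\<in>W. f x \<in> W"
    and schur: "\<forall>A. linear A \<longrightarrow> (\<forall>x\<in>W. A x \<in> W) \<longrightarrow> (\<forall>f\<in>?F. \<forall>x\<in>W. A (f x) = f (A x)) \<longrightarrow>
      (\<forall>x\<in>W. \<forall>y\<in>W. A x \<bullet> y = x \<bullet> A y) \<longrightarrow> (\<exists>c. \<forall>x\<in>W. A x = c *\<^sub>R x)"
    using invariant_subspace_schur[of V ?F "\<lambda>f. f", OF V(1,2) F]
    by (elim exE conjE) (rule that; assumption)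
  have TW: "t x \<in> W" if "t \<in> T" "x \<in> W" for t x using W(4) that by blast
  have JW: "J x \<in> W" if "x \<in> W" for x using W(4) that by blast
  note adj = G2_inner_op_inv[OF in_G2]
  have sum: "\<exists>c. \<forall>x\<in>W. blinfun_apply t x + op_inv t x = c *\<^sub>R x" if t: "t \<in> T" for t
  proof (rule schur[rule_format])
    show "linear (\<lambda>x. blinfun_apply t x + op_inv t x)"
      by (intro linear_compose_add linear_blinfun_apply)
    show "t x + op_inv t x \<in> W" if "x \<in> W" for x
      using W(1) TW t op_inv_in[OF t] that by (simp add: subspace_add)
    show "t (f x) + op_inv t (f x) = f (t x + op_inv t x)" if "f \<in> ?F" for f x
      using that
    proof
      assume "f = J"
      then show ?thesis
        using Jt[OF t] Jt[OF op_inv_in[OF t]] by (simp add: linear_add[OF J])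
    next
      assume "f \<in> blinfun_apply ` T"
      then obtain s where "s \<in> T" "f = blinfun_apply s" by blast
      then show ?thesis
        using commute[OF t, of s] commute[OF op_inv_in[OF t], of s] by (simp add: blinfun.add_right)
    qed
    show "(t x + op_inv t x) \<bullet> y = x \<bullet> (t y + op_inv t y)" for x y
      by (simp add: inner_add_left inner_add_right adj[OF t])
  qed
  have diff: "\<exists>c. \<forall>x\<in>W. J (blinfun_apply t x - op_inv t x) = c *\<^sub>R x" if t: "t \<in> T" for t
  proof (rule schur[rule_format])
    show "linear (\<lambda>x. J (blinfun_apply t x - op_inv t x))"
      using linear_compose[OF linear_compose_sub[OF linear_blinfun_apply linear_blinfun_apply] J]
      by (simp add: comp_def)
    show "J (t x - op_inv t x) \<in> W" if "x \<in> W" for x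
      using W(1) TW t op_inv_in[OF t] that by (simp add: subspace_diff JW)
    show "J (t (f x) - op_inv t (f x)) = f (J (t x - op_inv t x))" if "f \<in> ?F" for f x
      using that
    proof
      assume "f = J"
      then show ?thesis
        using Jt[OF t] Jt[OF op_inv_in[OF t]] by (simp add: linear_diff[OF J])
    next
      assume "f \<in> blinfun_apply ` T"
      then obtain s where s: "s \<in> T" "f = blinfun_apply s" by blast
      show ?thesis
        using commute[OF t s(1)] commute[OF op_inv_in[OF t] s(1)] Jt[OF s(1)]
        by (simp add: s(2) flip: blinfun.diff_right)
    qed
    show "J (t x - op_inv t x) \<bullet> y = x \<bullet> J (t y - op_inv t y)" for x y
      by (simp add: Jskew inner_diff_left inner_diff_right adj[OF t] linear_diff[OF J]
          Jt[OF t] Jt[OF op_inv_in[OF t]])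
  qed
  obtain x where x: "x \<in> W" "x \<bullet> x = 1"
  proof -
    obtain y where "y \<in> W" "y \<noteq> 0" using W subspace_0 by blast
    then show ?thesis
      using that[of "y /\<^sub>R norm y"] W(1)
      by (simp add: subspace_scale dot_square_norm power2_eq_square)
  qed
  have "\<exists>z. t x = oct_mult (oct_of_complex e z) x" if t: "t \<in> T" for t
  proof -
    obtain c where c: "t x + op_inv t x = c *\<^sub>R x" using sum[OF t] x by blast
    obtain d where d: "J (t x - op_inv t x) = d *\<^sub>R x" using diff[OF t] x by blast
    have "- (t x - op_inv t x) = d *\<^sub>R J x"
      using arg_cong[OF d, of J] by (simp only: JJ linear_scale[OF J])
    then have D: "t x - op_inv t x = (- d) *\<^sub>R J x"
      by (metis minus_minus scaleR_minus_left)
    have "t x = (1 / 2) *\<^sub>R ((t x + op_inv t x) + (t x - op_inv t x))"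
      by (rule scaleR_half_sum_diff)
    then have "t x = (c / 2) *\<^sub>R x + (- d / 2) *\<^sub>R J x"
      unfolding c D by (simp add: scaleR_add_right scaleR_diff_right)
    then have "t x = oct_mult (oct_of_complex e (Complex (c / 2) (- d / 2))) x"
      by (simp add: oct_of_complex_def J_def oct_mult.diff_left oct_mult_scaleR_left)
    then show ?thesis by blast
  qed
  then show ?thesis using that[of x] x W(2) by blast
qed

lemma adapted_triple:
  obtains e e1 e2 where "oct_triple e e1 e2" "\<And>t. t \<in> T \<Longrightarrow> blinfun_apply t e = e"
    "\<And>t. t \<in> T \<Longrightarrow> \<exists>z. blinfun_apply t e1 = oct_mult (oct_of_complex e z) e1"
    "\<And>t. t \<in> T \<Longrightarrow> \<exists>z. blinfun_apply t e2 = oct_mult (oct_of_complex e z) e2"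
proof -
  obtain e where e: "e \<bullet> e = 1" "e \<bullet> oct_one = 0" "\<And>t. t \<in> T \<Longrightarrow> blinfun_apply t e = e"
    using fixed_imaginary_unit by blast
  have dim8: "DIM(oct) = 8" by simp
  \<comment> \<open>Four linear conditions in dimension 8 leave a nonzero solution; four are what
    the choice of \<open>e2\<close> requires.\<close>
  have nonzero: "{x. \<forall>s\<in>S. x \<bullet> s = 0} \<noteq> {0}" if "finite S" "card S \<le> 4" for S :: "oct set"
  proof -
    have "dim S < DIM(oct)"
      using dim_le_card'[OF that(1)] that(2) dim8 by linarith
    then obtain x where "x \<noteq> 0" "\<And>y. y \<in> span S \<Longrightarrow> orthogonal x y"
      using orthogonal_to_subspace_exists by blast
    then have "x \<in> {x. \<forall>s\<in>S. x \<bullet> s = 0}"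
      using span_base unfolding orthogonal_def by blast
    then show ?thesis using \<open>x \<noteq> 0\<close> by blast
  qed
  have subsp: "subspace {x. \<forall>s\<in>S. x \<bullet> s = 0}" for S :: "oct set"
    by (auto simp: subspace_def inner_add_left)
  have cnj_e: "oct_cnj e = - e" using e by (simp add: oct_cnj_eq)
  have ee: "oct_mult e e = - oct_one" using e by (simp add: oct_square)
  have J: "oct_mult e x \<bullet> y = - (x \<bullet> oct_mult e y)" for x y
    using inner_oct_mult_left[of e x y] by (simp add: cnj_e oct_mult.minus_left)
  have eex: "oct_mult e (oct_mult e x) = - x" for x
  proof -
    have "(1 / 2) *\<^sub>R (- oct_mult e (oct_mult e x) - oct_mult e (oct_mult e x)) = x"
      using oct_left_polar[of e e x] e by (simp add: cnj_e oct_mult.minus_left)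
    then have "- oct_mult e (oct_mult e x) = x"
      using scaleR_half_sum_diff[of "- oct_mult e (oct_mult e x)" 0] by simp
    then show ?thesis by (metis minus_minus)
  qed
  note adj = G2_inner_op_inv[OF in_G2]
  have t1: "blinfun_apply t x \<bullet> oct_one = x \<bullet> oct_one" "blinfun_apply t x \<bullet> e = x \<bullet> e"
    if "t \<in> T" for t x
    using adj(1)[OF that] G2_one[OF in_G2[OF op_inv_in[OF that]]] e(3)[OF op_inv_in[OF that]] by simp_all
  define S1 where "S1 = {oct_one, e}"
  obtain e1 where e1: "e1 \<in> {x. \<forall>s\<in>S1. x \<bullet> s = 0}" "e1 \<bullet> e1 = 1"
    "\<And>t. t \<in> T \<Longrightarrow> \<exists>z. blinfun_apply t e1 = oct_mult (oct_of_complex e z) e1"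
  proof (rule eigenvector[OF e subsp[of S1]])
    show "{x. \<forall>s\<in>S1. x \<bullet> s = 0} \<noteq> {0}" by (rule nonzero) (auto simp: S1_def card_insert_if)
    show "t x \<in> {x. \<forall>s\<in>S1. x \<bullet> s = 0}" if "t \<in> T" "x \<in> {x. \<forall>s\<in>S1. x \<bullet> s = 0}" for t x
      using that by (simp add: S1_def t1)
    show "oct_mult e x \<in> {x. \<forall>s\<in>S1. x \<bullet> s = 0}" if "x \<in> {x. \<forall>s\<in>S1. x \<bullet> s = 0}" for x
      using that by (simp add: S1_def J ee)
  qed (assumption, rule that)
  define S2 where "S2 = {oct_one, e, e1, oct_mult e e1}"
  obtain e2 where e2: "e2 \<in> {x. \<forall>s\<in>S2. x \<bullet> s = 0}" "e2 \<bullet> e2 = 1"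
    "\<And>t. t \<in> T \<Longrightarrow> \<exists>z. blinfun_apply t e2 = oct_mult (oct_of_complex e z) e2"
  proof (rule eigenvector[OF e subsp[of S2]])
    show "{x. \<forall>s\<in>S2. x \<bullet> s = 0} \<noteq> {0}" by (rule nonzero) (auto simp: S2_def card_insert_if)
    show "t x \<in> {x. \<forall>s\<in>S2. x \<bullet> s = 0}" if t: "t \<in> T" and x: "x \<in> {x. \<forall>s\<in>S2. x \<bullet> s = 0}" for t x
    proof -
      \<comment> \<open>Invariance of the complement is tested through the adjoint
        \<open>op_inv t\<close>, which preserves the complex line spanned by \<open>e1\<close> and
        \<open>oct_mult e e1\<close>.\<close>
      obtain z where z: "op_inv t e1 = oct_mult (oct_of_complex e z) e1"
        using e1(3)[OF op_inv_in[OF t]] by blast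
      then have z1: "op_inv t e1 = Re z *\<^sub>R e1 + Im z *\<^sub>R oct_mult e e1"
        by (simp add: oct_of_complex_def oct_mult_add_left oct_mult_scaleR_left)
      have "op_inv t (oct_mult e e1) = oct_mult e (op_inv t e1)"
        using G2_mult[OF in_G2[OF op_inv_in[OF t]], of e e1] e(3)[OF op_inv_in[OF t]] by simp
      then have z2: "op_inv t (oct_mult e e1) = Re z *\<^sub>R oct_mult e e1 - Im z *\<^sub>R e1"
        by (simp add: z1 oct_mult_add_right oct_mult_scaleR_right eex)
      show ?thesis
        using x t1[OF t] adj(1)[OF t, of x e1] adj(1)[OF t, of x "oct_mult e e1"]
        by (simp add: S2_def z1 z2 inner_add_right inner_diff_right)
    qed
    show "oct_mult e x \<in> {x. \<forall>s\<in>S2. x \<bullet> s = 0}" if "x \<in> {x. \<forall>s\<in>S2. x \<bullet> s = 0}" for x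
      using that by (simp add: S2_def J ee eex)
  qed (assumption, rule that)
  have "oct_triple e e1 e2"
    using e(1,2) e1(1,2) e2(1,2) by unfold_locales (simp_all add: S1_def S2_def)
  then show ?thesis using that e(3) e1(3) e2(3) by blast
qed

end

section \<open>The diagonal torus\<close>

definition oct_torus_elt :: "complex \<Rightarrow> complex \<Rightarrow> (oct \<Rightarrow>\<^sub>L oct)" where
  "oct_torus_elt z w = Blinfun (\<lambda>x. ((fst (fst x), z * snd (fst x)), (w * fst (snd x), z * w * snd (snd x))))"

definition oct_torus :: "(oct \<Rightarrow>\<^sub>L oct) set" where
  "oct_torus = (\<lambda>(z, w). oct_torus_elt z w) ` (sphere 0 1 \<times> sphere 0 1)"

lemma oct_torus_elt_apply:
  "blinfun_apply (oct_torus_elt z w) x =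
     ((fst (fst x), z * snd (fst x)), (w * fst (snd x), z * w * snd (snd x)))"
proof -
  have "linear (\<lambda>x::oct. ((fst (fst x), z * snd (fst x)), (w * fst (snd x), z * w * snd (snd x))))"
    by (rule linearI) (simp_all add: algebra_simps)
  then show ?thesis
    unfolding oct_torus_elt_def by (simp add: bounded_linear_Blinfun_apply linear_conv_bounded_linear)
qed

lemma cnj_mult_unit: "norm z = 1 \<Longrightarrow> cnj z * z = 1" "norm z = 1 \<Longrightarrow> z * cnj z = 1"
  by (simp_all add: complex_norm_square[symmetric] mult.commute flip: of_real_power)

text \<open>In coordinates \<open>((a, b), (c, d))\<close>, left multiplication by
  \<open>oct_i\<close> is conjugate-linear in sign on \<open>d\<close>, so \<open>b\<close>,
  \<open>c\<close> and \<open>cnj d\<close> are the complex coordinates on the complement of the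
  unit and \<open>oct_i\<close>. In them the map is diagonal with entries \<open>z\<close>,
  \<open>w\<close>, \<open>cnj (z * w)\<close>, an element of the standard torus of SU(3).\<close>

lemma oct_torus_elt_in_G2:
  assumes "norm z = 1" "norm w = 1"
  shows "oct_torus_elt z w \<in> G2"
proof (intro oct_alg_hom_in_G2)
  note unit = cnj_mult_unit(1)[OF assms(1)] cnj_mult_unit(1)[OF assms(2)]
  have "oct_torus_elt z w (oct_mult x y) = oct_mult (oct_torus_elt z w x) (oct_torus_elt z w y)" for x y
    by (rule oct_eqI; simp add: oct_torus_elt_apply oct_simps; (use unit in algebra | simp add: algebra_simps))
  then show "oct_alg_hom (oct_torus_elt z w)"
    unfolding oct_alg_hom_def by (simp add: linear_blinfun_apply oct_torus_elt_apply oct_one_def del: split_paired_All)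
qed

lemma op_inv_eqI:
  fixes g h :: "'v::euclidean_space \<Rightarrow>\<^sub>L 'v"
  assumes "h o\<^sub>L g = id_blinfun" "g o\<^sub>L h = id_blinfun"
  shows "op_inv g = h"
proof (rule op_inv_unique(2))
  show "h (g x) = x" "g (h x) = x" for x
    using arg_cong[OF assms(1), of "\<lambda>f. blinfun_apply f x"]
      arg_cong[OF assms(2), of "\<lambda>f. blinfun_apply f x"] by simp_all
qed

lemma oct_torus_elt_compose: "oct_torus_elt z w o\<^sub>L oct_torus_elt z' w' = oct_torus_elt (z * z') (w * w')"
  by (rule blinfun_eqI) (simp add: oct_torus_elt_apply mult_ac)

lemma oct_torus_elt_one: "oct_torus_elt 1 1 = id_blinfun"
  by (rule blinfun_eqI) (simp add: oct_torus_elt_apply)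

lemma op_inv_oct_torus_elt:
  assumes "norm z = 1" "norm w = 1"
  shows "op_inv (oct_torus_elt z w) = oct_torus_elt (cnj z) (cnj w)"
proof -
  have "oct_torus_elt (cnj z) (cnj w) o\<^sub>L oct_torus_elt z w = id_blinfun"
    "oct_torus_elt z w o\<^sub>L oct_torus_elt (cnj z) (cnj w) = id_blinfun"
    by (simp_all add: oct_torus_elt_compose cnj_mult_unit assms oct_torus_elt_one)
  then show ?thesis
    by (rule op_inv_eqI)
qed

lemma continuous_on_oct_torus_elt:
  fixes f g :: "'a::t2_space \<Rightarrow> complex"
  assumes "continuous_on S f" "continuous_on S g"
  shows "continuous_on S (\<lambda>x. oct_torus_elt (f x) (g x))"
proof (rule continuous_on_blinfun_componentwise)
  show "continuous_on S (\<lambda>x. oct_torus_elt (f x) (g x) i)" for i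
    unfolding oct_torus_elt_apply by (intro continuous_intros assms)
qed

lemma in_oct_torus: "t \<in> oct_torus \<longleftrightarrow> (\<exists>z w. norm z = 1 \<and> norm w = 1 \<and> t = oct_torus_elt z w)"
  by (auto simp: oct_torus_def image_iff Bex_def)

lemma oct_torus_subset_G2: "oct_torus \<subseteq> G2"
  using oct_torus_elt_in_G2 by (auto simp: in_oct_torus)

lemma torus_oct_torus: "torus oct_torus"
proof -
  have cont: "continuous_on (sphere 0 1 \<times> sphere 0 1) (\<lambda>(z, w). oct_torus_elt z w)"
    unfolding case_prod_beta by (intro continuous_on_oct_torus_elt continuous_intros)
  have "compact oct_torus"
    unfolding oct_torus_def by (intro compact_continuous_image[OF cont] compact_Times compact_sphere)
  moreover have "connected oct_torus"
    unfolding oct_torus_def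
    by (intro connected_continuous_image[OF cont] connected_Times connected_sphere) simp_all
  moreover have "linear_group oct_torus"
    unfolding linear_group_def
  proof (intro conjI ballI)
    show "bij (blinfun_apply g)" if "g \<in> oct_torus" for g
      using that oct_torus_subset_G2 G2_bij by blast
    show "id_blinfun \<in> oct_torus"
      unfolding in_oct_torus by (metis oct_torus_elt_one norm_one)
    show "g o\<^sub>L h \<in> oct_torus" if "g \<in> oct_torus" "h \<in> oct_torus" for g h
      using that unfolding in_oct_torus by (metis oct_torus_elt_compose norm_mult mult_1)
    show "op_inv g \<in> oct_torus" if "g \<in> oct_torus" for g
      using that unfolding in_oct_torus by (metis op_inv_oct_torus_elt complex_mod_cnj)
  qed
  moreover have "s o\<^sub>L t = t o\<^sub>L s" if "s \<in> oct_torus" "t \<in> oct_torus" for s t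
    using that by (auto simp: in_oct_torus oct_torus_elt_compose mult.commute)
  ultimately show ?thesis unfolding torus_def by blast
qed

section \<open>Conjugation of operators and tori\<close>

definition op_conj :: "('v::euclidean_space \<Rightarrow>\<^sub>L 'v) \<Rightarrow> ('v \<Rightarrow>\<^sub>L 'v) \<Rightarrow> ('v \<Rightarrow>\<^sub>L 'v)" where
  "op_conj g t = g o\<^sub>L t o\<^sub>L op_inv g"

lemma op_conj_apply: "blinfun_apply (op_conj g t) x = g (t (op_inv g x))"
  by (simp add: op_conj_def)

lemma op_inv_op_inv:
  fixes g :: "'v::euclidean_space \<Rightarrow>\<^sub>L 'v"
  assumes "bij (blinfun_apply g)"
  shows "bij (blinfun_apply (op_inv g))" "op_inv (op_inv g) = g"
  using op_inv_unique[of g "op_inv g"] op_inv_cancel(1,2)[OF assms] by blast+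

lemma op_conj_cancel:
  fixes g :: "'v::euclidean_space \<Rightarrow>\<^sub>L 'v"
  assumes "bij (blinfun_apply g)"
  shows "op_conj (op_inv g) (op_conj g t) = t" "op_conj g (op_conj (op_inv g) t) = t"
  using assms by (auto intro!: blinfun_eqI simp: op_conj_apply op_inv_op_inv)

lemma op_conj_compose:
  fixes g :: "'v::euclidean_space \<Rightarrow>\<^sub>L 'v"
  assumes "bij (blinfun_apply g)"
  shows "op_conj g (s o\<^sub>L t) = op_conj g s o\<^sub>L op_conj g t"
  using assms by (auto intro!: blinfun_eqI simp: op_conj_apply)

lemma op_conj_id:
  fixes g :: "'v::euclidean_space \<Rightarrow>\<^sub>L 'v"
  assumes "bij (blinfun_apply g)"
  shows "op_conj g id_blinfun = id_blinfun"
  using assms by (auto intro!: blinfun_eqI simp: op_conj_apply)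

lemma op_inv_op_conj:
  fixes g :: "'v::euclidean_space \<Rightarrow>\<^sub>L 'v"
  assumes "bij (blinfun_apply g)" "bij (blinfun_apply t)"
  shows "bij (blinfun_apply (op_conj g t))" "op_inv (op_conj g t) = op_conj g (op_inv t)"
  using op_inv_unique[of "op_conj g (op_inv t)" "op_conj g t"] assms by (auto simp: op_conj_apply)

lemma continuous_on_op_conj: "continuous_on S (op_conj g)"
  unfolding op_conj_def
  by (intro bounded_bilinear.continuous_on[OF bounded_bilinear_blinfun_compose] continuous_intros)

lemma linear_group_op_conj:
  fixes g :: "'v::euclidean_space \<Rightarrow>\<^sub>L 'v"
  assumes g: "bij (blinfun_apply g)" and T: "linear_group T"
  shows "linear_group (op_conj g ` T)"
  unfolding linear_group_def
proof (intro conjI ballI)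
  show "bij (blinfun_apply s)" if "s \<in> op_conj g ` T" for s
    using that T op_inv_op_conj(1)[OF g] unfolding linear_group_def by blast
  show "id_blinfun \<in> op_conj g ` T"
    using T op_conj_id[OF g] unfolding linear_group_def by (metis imageI)
  show "s o\<^sub>L t \<in> op_conj g ` T" if "s \<in> op_conj g ` T" "t \<in> op_conj g ` T" for s t
    using that T op_conj_compose[OF g] unfolding linear_group_def
    by (smt (verit) image_iff)
  show "op_inv s \<in> op_conj g ` T" if "s \<in> op_conj g ` T" for s
    using that T op_inv_op_conj(2)[OF g] unfolding linear_group_def by blast
qed

lemma torus_op_conj:
  fixes g :: "'v::euclidean_space \<Rightarrow>\<^sub>L 'v"
  assumes g: "bij (blinfun_apply g)" and T: "torus T"
  shows "torus (op_conj g ` T)"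
proof -
  have "linear_group (op_conj g ` T)"
    using linear_group_op_conj[OF g] T by (simp add: torus_def)
  moreover have "compact (op_conj g ` T)" "connected (op_conj g ` T)"
    using T continuous_on_op_conj unfolding torus_def
    by (blast intro: compact_continuous_image connected_continuous_image)+
  moreover have "\<forall>s\<in>op_conj g ` T. \<forall>t\<in>op_conj g ` T. s o\<^sub>L t = t o\<^sub>L s"
    using T unfolding torus_def by (auto simp flip: op_conj_compose[OF g])
  ultimately show ?thesis unfolding torus_def by blast
qed

lemma op_conj_in_G2: "g \<in> G2 \<Longrightarrow> t \<in> G2 \<Longrightarrow> op_conj g t \<in> G2"
  using linear_group_G2 unfolding op_conj_def linear_group_def by blast

lemma norm_oct_of_complex_mult:
  assumes "e \<bullet> e = 1" "e \<bullet> oct_one = 0" 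
  shows "oct_mult (oct_of_complex e z) x \<bullet> oct_mult (oct_of_complex e z) x = (norm z)\<^sup>2 * (x \<bullet> x)"
proof -
  have ce: "oct_cnj e = - e" using assms by (simp add: oct_cnj_eq)
  have "oct_mult e x \<bullet> x = 0"
    using inner_oct_mult_left[of e x x] by (simp add: ce oct_mult.minus_left inner_commute)
  moreover have "oct_mult e x \<bullet> oct_mult e x = x \<bullet> x"
    using oct_left_polar[of e e x] assms inner_oct_mult_left[of e x "oct_mult e x"]
      scaleR_half_sum_diff[of "oct_mult (oct_cnj e) (oct_mult e x)" 0] by simp
  ultimately show ?thesis
    unfolding cmod_power2
    by (simp add: oct_of_complex_def oct_mult_add_left oct_mult_scaleR_left inner_simps inner_commute
        power2_eq_square algebra_simps)
qed

text \<open>The homomorphism \<open>g\<close> of an adapted triple intertwines each \<open>t\<close>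
  with a diagonal element, because both composites agree on i, j and l. This puts \<open>T\<close>
  inside the conjugate of \<open>oct_torus\<close>, itself a torus in \<open>G2\<close>, and
  maximality of \<open>T\<close> gives equality.\<close>

theorem maximal_torus_G2_conjugate:
  assumes "maximal_torus G2 T"
  obtains g where "g \<in> G2" "T = op_conj g ` oct_torus"
proof -
  interpret torus_in_G2 T
    using assms by unfold_locales (auto simp: maximal_torus_def)
  obtain e e1 e2 where tri: "oct_triple e e1 e2" and te: "\<And>t. t \<in> T \<Longrightarrow> blinfun_apply t e = e"
    "\<And>t. t \<in> T \<Longrightarrow> \<exists>z. blinfun_apply t e1 = oct_mult (oct_of_complex e z) e1"
    "\<And>t. t \<in> T \<Longrightarrow> \<exists>z. blinfun_apply t e2 = oct_mult (oct_of_complex e z) e2"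
    using adapted_triple by blast
  interpret oct_triple e e1 e2 by (rule tri)
  have hom: "oct_alg_hom (oct_of_triple e e1 e2)" by (rule oct_alg_hom_triple)
  define g where "g = Blinfun (oct_of_triple e e1 e2)"
  have g: "blinfun_apply g = oct_of_triple e e1 e2"
    using hom unfolding g_def oct_alg_hom_def
    by (simp add: bounded_linear_Blinfun_apply linear_conv_bounded_linear)
  have gG: "g \<in> G2" using hom by (intro oct_alg_hom_in_G2) (simp add: g)
  have b: "bij (blinfun_apply g)" using gG by (rule G2_bij)
  have "t \<in> op_conj g ` oct_torus" if t: "t \<in> T" for t
  proof -
    obtain z w where z: "t e1 = oct_mult (oct_of_complex e z) e1" and w: "t e2 = oct_mult (oct_of_complex e w) e2"
      using te(2,3)[OF t] by blast
    have nz: "norm z = 1"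
      using norm_oct_of_complex_mult[of e z e1] norms imag G2_inner[OF in_G2[OF t], of e1 e1] z by (simp add: abs_square_eq_1)
    have nw: "norm w = 1"
      using norm_oct_of_complex_mult[of e w e2] norms imag G2_inner[OF in_G2[OF t], of e2 e2] w by (simp add: abs_square_eq_1)
    have "blinfun_apply (t o\<^sub>L g) = blinfun_apply (g o\<^sub>L oct_torus_elt z w)"
    proof (rule oct_alg_hom_eqI)
      show "oct_alg_hom (t o\<^sub>L g)" "oct_alg_hom (g o\<^sub>L oct_torus_elt z w)"
        using linear_group_G2 gG in_G2[OF t] oct_torus_elt_in_G2[OF nz nw]
        unfolding linear_group_def by (blast intro: G2_oct_alg_hom)+
      have one: "oct_of_complex e 1 = oct_one" "oct_of_complex e 0 = 0" "oct_of_complex e \<i> = e"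
        by (simp_all add: oct_of_complex_def)
      show "(t o\<^sub>L g) oct_i = (g o\<^sub>L oct_torus_elt z w) oct_i"
        by (simp add: g oct_torus_elt_apply oct_of_triple_def oct_of_quat_def one te t oct_mult.zero_left)
      show "(t o\<^sub>L g) oct_j = (g o\<^sub>L oct_torus_elt z w) oct_j"
        by (simp add: g oct_torus_elt_apply oct_of_triple_def oct_of_quat_def one z oct_mult.zero_left)
      show "(t o\<^sub>L g) oct_l = (g o\<^sub>L oct_torus_elt z w) oct_l"
        by (simp add: g oct_torus_elt_apply oct_of_triple_def oct_of_quat_def one w oct_mult.zero_left)
    qed
    then have "(t o\<^sub>L g) (op_inv g x) = (g o\<^sub>L oct_torus_elt z w) (op_inv g x)" for x
      by (rule fun_cong)
    then have "t = op_conj g (oct_torus_elt z w)"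
      by (intro blinfun_eqI) (simp add: op_conj_apply b)
    moreover have "oct_torus_elt z w \<in> oct_torus"
      using nz nw unfolding in_oct_torus by blast
    ultimately show ?thesis by blast
  qed
  then have "T \<subseteq> op_conj g ` oct_torus" by blast
  moreover have "torus (op_conj g ` oct_torus)"
    by (rule torus_op_conj[OF b torus_oct_torus])
  moreover have "op_conj g ` oct_torus \<subseteq> G2"
    using op_conj_in_G2[OF gG] oct_torus_subset_G2 by blast
  ultimately have "op_conj g ` oct_torus = T"
    using assms unfolding maximal_torus_def by blast
  then show ?thesis using that gG by blast
qed

section \<open>Weights\<close>

lemma additive_bounded_zero:
  fixes M :: "real \<Rightarrow> complex"
  assumes add: "\<And>x y. M (x + y) = M x + M y" and bound: "\<And>x. norm (M x) \<le> B"
  shows "M x = 0"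
proof (rule ccontr)
  assume "M x \<noteq> 0"
  have mult: "M (real n * x) = of_nat n * M x" for n
  proof (induction n)
    case 0
    show ?case using add[of 0 0] by simp
  next
    case (Suc n)
    then show ?case using add[of x "real n * x"] by (simp add: algebra_simps)
  qed
  obtain n where "B / norm (M x) < real n"
    using reals_Archimedean2 by blast
  then have "B < norm (M (real n * x))"
    using \<open>M x \<noteq> 0\<close> by (simp add: mult norm_mult divide_simps)
  then show False using bound[of "real n * x"] by simp
qed

text \<open>Subtracting the candidate leaves an additive map \<open>M\<close> that vanishes at the
  integers. It has period 1, is bounded by compactness of the unit interval, and a bounded additive
  map is zero.\<close>

lemma continuous_additive_linear:
  fixes L :: "real \<Rightarrow> complex"
  assumes add: "\<And>x y. L (x + y) = L x + L y" and cont: "continuous_on UNIV L"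
  shows "L x = of_real x * L 1"
proof -
  define M where "M = (\<lambda>x. L x - of_real x * L 1)"
  have addM: "M (x + y) = M x + M y" for x y
    by (simp add: M_def add algebra_simps)
  have M0: "M 0 = 0" and M1: "M 1 = 0"
    using add[of 0 0] by (simp_all add: M_def)
  have Mneg: "M (- x) = - M x" for x
    using addM[of x "- x"] M0 by (simp add: add_eq_0_iff)
  have Mnat: "M (real n) = 0" for n
    by (induction n) (simp_all add: M0 M1 addM)
  have Mint: "M (of_int n) = 0" for n
    using Mnat[of "nat n"] Mnat[of "nat (- n)"] Mneg[of "of_int n"] by (cases "n \<ge> 0") simp_all
  have "continuous_on {0..1} M"
    unfolding M_def by (intro continuous_intros continuous_on_subset[OF cont]) auto
  then have "bounded (M ` {0..1})"
    by (intro compact_imp_bounded compact_continuous_image) auto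
  then obtain B where B: "\<And>x. x \<in> {0..1} \<Longrightarrow> norm (M x) \<le> B"
    unfolding bounded_iff by blast
  have "norm (M x) \<le> B" for x
  proof -
    have "M x = M (frac x)"
      using addM[of "of_int \<lfloor>x\<rfloor>" "frac x"] Mint by (simp add: frac_def)
    then show ?thesis using B[of "frac x"] frac_lt_1[of x] by (simp add: less_imp_le)
  qed
  then have "M x = 0" by (rule additive_bounded_zero[OF addM])
  then show ?thesis by (simp add: M_def)
qed

text \<open>On the contractible line \<open>f\<close> has a continuous logarithm. Its defect from
  additivity is continuous with exponential 1; such values lie at least \<open>2 * pi\<close> apart,
  so the defect is constant, and it is zero at the origin. The period then makes the slope an
  integer multiple of the imaginary unit.\<close>

lemma continuous_hom_circle:
  fixes f :: "real \<Rightarrow> complex"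
  assumes cont: "continuous_on UNIV f" and hom: "\<And>x y. f (x + y) = f x * f y"
    and nz: "\<And>x. f x \<noteq> 0" and per: "f (2 * pi) = 1"
  shows "\<exists>n::int. \<forall>x. f x = cis x powi n"
proof -
  obtain g where g: "continuous_on UNIV g" "\<And>x. f x = exp (g x)"
    using continuous_logarithm_on_contractible[OF cont, of thesis] nz
    by (auto simp: convex_imp_contractible)
  have f0: "f 0 = 1" using hom[of 0 0] nz[of 0] by simp
  define L where "L = (\<lambda>x. g x - g 0)"
  have contL: "continuous_on UNIV L" unfolding L_def by (intro continuous_intros g)
  have fL: "f x = exp (L x)" for x
    using f0 by (simp add: L_def exp_diff flip: g(2))
  have "L (x + y) = L x + L y" for x y
  proof -
    define D where "D = (\<lambda>x. L (x + y) - L x - L y)"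
    have eD: "exp (D x) = 1" for x
      using hom[of x y] nz by (simp add: D_def exp_diff flip: fL)
    have "D constant_on UNIV"
    proof (rule continuous_discrete_range_constant)
      show "continuous_on UNIV D"
        unfolding D_def by (intro continuous_intros continuous_on_compose2[OF contL]) auto
      show "\<exists>e>0. \<forall>u. u \<in> UNIV \<and> D u \<noteq> D x \<longrightarrow> e \<le> norm (D u - D x)" for x
      proof (intro exI[of _ "2 * pi"] conjI allI impI)
        fix u assume "u \<in> UNIV \<and> D u \<noteq> D x"
        then have "\<not> \<bar>Im (D u) - Im (D x)\<bar> < 2 * pi"
          using exp_complex_eqI[of "D u" "D x"] eD by auto
        then show "2 * pi \<le> norm (D u - D x)"
          using abs_Im_le_cmod[of "D u - D x"] by simp
      qed simp
    qed simp
    then have "D x = D 0" unfolding constant_on_def by (metis UNIV_I)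
    then show ?thesis by (simp add: D_def L_def algebra_simps)
  qed
  then have lin: "L x = of_real x * L 1" for x
    using continuous_additive_linear contL by blast
  have "exp (of_real (2 * pi) * L 1) = 1"
    using per fL[of "2 * pi"] lin[of "2 * pi"] by simp
  then obtain n :: int where n: "Re (L 1) = 0" "2 * pi * Im (L 1) = of_int (2 * n) * pi"
    unfolding exp_eq_1 by auto
  then have "L 1 = \<i> * of_int n"
    by (simp add: complex_eq_iff)
  then have "f x = cis (of_int n * x)" for x
    using fL[of x] lin[of x] by (simp add: cis_conv_exp mult_ac)
  then have "f x = cis x powi n" for x
    by (simp add: cis_power_int)
  then show ?thesis by blast
qed

text \<open>A character takes an operator, so \<open>z\<close> and \<open>w\<close> are read off
  from the images of \<open>oct_j\<close> and \<open>oct_l\<close>.\<close>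

definition oct_torus_weight :: "int \<times> int \<Rightarrow> oct character" where
  "oct_torus_weight k = (\<lambda>t\<in>oct_torus.
     snd (fst (blinfun_apply t oct_j)) powi fst k * fst (snd (blinfun_apply t oct_l)) powi snd k)"

lemma oct_torus_weight_elt:
  assumes "norm z = 1" "norm w = 1"
  shows "oct_torus_weight k (oct_torus_elt z w) = z powi fst k * w powi snd k"
proof -
  have "oct_torus_elt z w \<in> oct_torus" using assms unfolding in_oct_torus by blast
  then show ?thesis by (simp add: oct_torus_weight_def oct_torus_elt_apply)
qed

lemma weight_eqI:
  assumes "\<mu> \<in> extensional oct_torus" "\<nu> \<in> extensional oct_torus"
    and "\<And>z w. norm z = 1 \<Longrightarrow> norm w = 1 \<Longrightarrow> \<mu> (oct_torus_elt z w) = \<nu> (oct_torus_elt z w)"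
  shows "\<mu> = \<nu>"
  using assms by (intro extensionalityI[of \<mu> oct_torus \<nu>]) (auto simp: in_oct_torus)

lemma weights_extensional: "\<mu> \<in> weights T \<Longrightarrow> \<mu> \<in> extensional T"
  by (auto simp: weights_def PiE_def)

lemma oct_torus_weight_extensional: "oct_torus_weight k \<in> extensional oct_torus"
  by (simp add: oct_torus_weight_def)

lemma oct_torus_weight_in: "oct_torus_weight k \<in> weights oct_torus"
  unfolding weights_def
proof (intro CollectI conjI ballI PiE_I)
  fix t assume "t \<in> oct_torus"
  then obtain z w where "norm z = 1" "norm w = 1" "t = oct_torus_elt z w"
    unfolding in_oct_torus by blast
  then show "oct_torus_weight k t \<in> sphere 0 1"
    by (simp add: oct_torus_weight_elt norm_mult norm_power_int)
next
  show "oct_torus_weight k t = undefined" if "t \<notin> oct_torus" for t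
    using that by (simp add: oct_torus_weight_def)
next
  have nz: "snd (fst (blinfun_apply t oct_j)) \<noteq> 0" "fst (snd (blinfun_apply t oct_l)) \<noteq> 0"
    if "t \<in> oct_torus" for t
    using that by (auto simp: in_oct_torus oct_torus_elt_apply)
  have "continuous_on oct_torus (\<lambda>t.
     snd (fst (blinfun_apply t oct_j)) powi fst k * fst (snd (blinfun_apply t oct_l)) powi snd k)"
    by (intro continuous_intros) (use nz in auto)
  then show "continuous_on oct_torus (oct_torus_weight k)"
    by (rule continuous_on_eq) (simp add: oct_torus_weight_def)
next
  fix s t assume "s \<in> oct_torus" "t \<in> oct_torus"
  then obtain z w z' w' where "norm z = 1" "norm w = 1" "s = oct_torus_elt z w"
    "norm z' = 1" "norm w' = 1" "t = oct_torus_elt z' w'"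
    unfolding in_oct_torus by blast
  then show "oct_torus_weight k (s o\<^sub>L t) = oct_torus_weight k s * oct_torus_weight k t"
    by (simp add: oct_torus_weight_elt oct_torus_elt_compose norm_mult power_int_mult_distrib mult_ac)
qed

text \<open>A character is the product of its restrictions to the two circle factors, each of which
  is an integral power.\<close>

lemma weights_oct_torus: "weights oct_torus = range oct_torus_weight"
proof
  show "range oct_torus_weight \<subseteq> weights oct_torus"
    using oct_torus_weight_in by blast
  show "weights oct_torus \<subseteq> range oct_torus_weight"
  proof
    fix \<mu> assume \<mu>: "\<mu> \<in> weights oct_torus"
    have cont: "continuous_on oct_torus \<mu>"
      and hom: "\<And>s t. s \<in> oct_torus \<Longrightarrow> t \<in> oct_torus \<Longrightarrow> \<mu> (s o\<^sub>L t) = \<mu> s * \<mu> t"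
      and sph: "\<And>t. t \<in> oct_torus \<Longrightarrow> norm (\<mu> t) = 1"
      using \<mu> by (auto simp: weights_def PiE_def Pi_def)
    have elt: "oct_torus_elt z w \<in> oct_torus" if "norm z = 1" "norm w = 1" for z w
      using that unfolding in_oct_torus by blast
    have "id_blinfun \<in> oct_torus" using elt[of 1 1] by (simp add: oct_torus_elt_one)
    moreover have "id_blinfun o\<^sub>L id_blinfun = (id_blinfun :: oct \<Rightarrow>\<^sub>L oct)"
      by (rule blinfun_eqI) simp
    ultimately have id: "\<mu> id_blinfun = 1"
      using hom[of id_blinfun id_blinfun] sph[of id_blinfun] by force
    have nz: "\<mu> (oct_torus_elt z w) \<noteq> 0" if "norm z = 1" "norm w = 1" for z w
      using sph[OF elt[OF that]] by auto
    have "\<exists>k::int. \<forall>x. \<mu> (oct_torus_elt (cis x) 1) = cis x powi k"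
    proof (rule continuous_hom_circle)
      show "continuous_on UNIV (\<lambda>x. \<mu> (oct_torus_elt (cis x) 1))"
        by (intro continuous_on_compose2[OF cont] continuous_on_oct_torus_elt continuous_intros)
           (auto simp: elt)
    qed (use nz elt id in \<open>auto simp: oct_torus_elt_one oct_torus_elt_compose cis_mult simp flip: hom\<close>)
    then obtain k :: int where k: "\<And>x. \<mu> (oct_torus_elt (cis x) 1) = cis x powi k" by blast
    have "\<exists>l::int. \<forall>x. \<mu> (oct_torus_elt 1 (cis x)) = cis x powi l"
    proof (rule continuous_hom_circle)
      show "continuous_on UNIV (\<lambda>x. \<mu> (oct_torus_elt 1 (cis x)))"
        by (intro continuous_on_compose2[OF cont] continuous_on_oct_torus_elt continuous_intros)
           (auto simp: elt)
    qed (use nz elt id in \<open>auto simp: oct_torus_elt_one oct_torus_elt_compose cis_mult simp flip: hom\<close>)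
    then obtain l :: int where l: "\<And>x. \<mu> (oct_torus_elt 1 (cis x)) = cis x powi l" by blast
    have "\<mu> = oct_torus_weight (k, l)"
    proof (rule weight_eqI[OF weights_extensional[OF \<mu>] oct_torus_weight_extensional])
      fix z w :: complex assume n: "norm z = 1" "norm w = 1"
      have "u = cis (Arg u)" if "norm u = 1" for u
        using that cis_Arg[of u] by (cases "u = 0") (simp_all add: sgn_div_norm)
      with n obtain x y where xy: "z = cis x" "w = cis y" by blast
      show "\<mu> (oct_torus_elt z w) = oct_torus_weight (k, l) (oct_torus_elt z w)"
        unfolding xy using hom[of "oct_torus_elt (cis x) 1" "oct_torus_elt 1 (cis y)"]
        by (simp add: oct_torus_weight_elt oct_torus_elt_compose elt k l)
    qed
    then show "\<mu> \<in> range oct_torus_weight" by blast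
  qed
qed

lemma power_int_unit_eq:
  assumes "\<And>z :: complex. norm z = 1 \<Longrightarrow> z powi k = 1"
  shows "k = 0"
proof (rule ccontr)
  assume "k \<noteq> 0"
  \<comment> \<open>The test point is chosen so that the power is -1.\<close>
  have "cis (pi / of_int k) powi k = cis pi"
    using \<open>k \<noteq> 0\<close> by (simp add: cis_power_int)
  then show False using assms[of "cis (pi / of_int k)"] by (simp add: complex_eq_iff)
qed

lemma inj_oct_torus_weight: "inj oct_torus_weight"
proof (rule injI)
  fix a b assume eq: "oct_torus_weight a = oct_torus_weight b"
  have *: "z powi fst a * w powi snd a = z powi fst b * w powi snd b" if "norm z = 1" "norm w = 1" for z w :: complex
    using fun_cong[OF eq, of "oct_torus_elt z w"] that by (simp add: oct_torus_weight_elt)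
  have "fst a - fst b = 0"
  proof (rule power_int_unit_eq)
    fix z :: complex assume n: "norm z = 1"
    then have "z \<noteq> 0" by auto
    then show "z powi (fst a - fst b) = 1" using *[of z 1] n by (simp add: power_int_diff)
  qed
  moreover have "snd a - snd b = 0"
  proof (rule power_int_unit_eq)
    fix z :: complex assume n: "norm z = 1"
    then have "z \<noteq> 0" by auto
    then show "z powi (snd a - snd b) = 1" using *[of 1 z] n by (simp add: power_int_diff)
  qed
  ultimately show "a = b" by (simp add: prod_eq_iff)
qed

lemma weight_add_oct_torus:
  "weight_add oct_torus (oct_torus_weight a) (oct_torus_weight b) = oct_torus_weight (a + b)"
proof (rule weight_eqI)
  fix z w :: complex assume n: "norm z = 1" "norm w = 1"
  then have "z \<noteq> 0" "w \<noteq> 0" "oct_torus_elt z w \<in> oct_torus"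
    unfolding in_oct_torus by auto
  with n show "weight_add oct_torus (oct_torus_weight a) (oct_torus_weight b) (oct_torus_elt z w) =
      oct_torus_weight (a + b) (oct_torus_elt z w)"
    by (simp add: weight_add_def oct_torus_weight_elt power_int_add mult_ac)
qed (simp_all add: weight_add_def oct_torus_weight_extensional)

text \<open>The isomorphism of weights induced by conjugation by \<open>g\<close> is \<^const>\<open>weyl_act\<close> with the conjugate torus.\<close>

lemma weyl_act_op_conj:
  fixes g :: "'v::euclidean_space \<Rightarrow>\<^sub>L 'v"
  assumes g: "bij (blinfun_apply g)" and "t \<in> T"
  shows "weyl_act (op_conj g ` T) g \<mu> (op_conj g t) = \<mu> t"
proof -
  have "op_inv g o\<^sub>L op_conj g t o\<^sub>L g = t"
    using g by (intro blinfun_eqI) (simp add: op_conj_apply)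
  then show ?thesis using assms by (simp add: weyl_act_def)
qed

lemma weyl_act_in_weights:
  fixes g :: "'v::euclidean_space \<Rightarrow>\<^sub>L 'v"
  assumes g: "bij (blinfun_apply g)" and T: "linear_group T" and \<mu>: "\<mu> \<in> weights T"
  shows "weyl_act (op_conj g ` T) g \<mu> \<in> weights (op_conj g ` T)"
  unfolding weights_def
proof (intro CollectI conjI ballI PiE_I)
  note act = weyl_act_op_conj[OF g]
  fix s assume "s \<in> op_conj g ` T"
  then obtain t where t: "t \<in> T" "s = op_conj g t" by blast
  then show "weyl_act (op_conj g ` T) g \<mu> s \<in> sphere 0 1"
    using \<mu> by (auto simp: act weights_def PiE_def Pi_def)
  fix s' assume "s' \<in> op_conj g ` T"
  then obtain t' where t': "t' \<in> T" "s' = op_conj g t'" by blast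
  show "weyl_act (op_conj g ` T) g \<mu> (s o\<^sub>L s') =
      weyl_act (op_conj g ` T) g \<mu> s * weyl_act (op_conj g ` T) g \<mu> s'"
  proof -
    have "t o\<^sub>L t' \<in> T" using T t t' unfolding linear_group_def by blast
    moreover have "\<mu> (t o\<^sub>L t') = \<mu> t * \<mu> t'" using \<mu> t t' unfolding weights_def by blast
    ultimately show ?thesis
      using act[of "t o\<^sub>L t'" T \<mu>] act[of t T \<mu>] act[of t' T \<mu>] t t'
      by (simp add: op_conj_compose[OF g])
  qed
next
  show "weyl_act (op_conj g ` T) g \<mu> s = undefined" if "s \<notin> op_conj g ` T" for s
    using that by (simp add: weyl_act_def)
next
  have "continuous_on (op_conj g ` T) (\<lambda>s. \<mu> (op_conj (op_inv g) s))"
  proof (rule continuous_on_compose2[of T \<mu>])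
    show "continuous_on T \<mu>" using \<mu> by (simp add: weights_def)
    show "op_conj (op_inv g) ` op_conj g ` T \<subseteq> T" using g by (auto simp: op_conj_cancel)
  qed (rule continuous_on_op_conj)
  then show "continuous_on (op_conj g ` T) (weyl_act (op_conj g ` T) g \<mu>)"
    by (rule continuous_on_eq) (auto simp: weyl_act_op_conj[OF g] op_conj_cancel[OF g])
qed

lemma weyl_act_weight_add:
  fixes g :: "'v::euclidean_space \<Rightarrow>\<^sub>L 'v"
  assumes g: "bij (blinfun_apply g)"
  shows "weyl_act (op_conj g ` T) g (weight_add T \<mu> \<nu>) =
    weight_add (op_conj g ` T) (weyl_act (op_conj g ` T) g \<mu>) (weyl_act (op_conj g ` T) g \<nu>)"
proof
  fix s
  show "weyl_act (op_conj g ` T) g (weight_add T \<mu> \<nu>) s =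
    weight_add (op_conj g ` T) (weyl_act (op_conj g ` T) g \<mu>) (weyl_act (op_conj g ` T) g \<nu>) s"
  proof (cases "s \<in> op_conj g ` T")
    case True
    then obtain t where "t \<in> T" "s = op_conj g t" by blast
    then show ?thesis by (simp add: weyl_act_op_conj[OF g] weight_add_def)
  next
    case False
    then show ?thesis by (simp add: weyl_act_def weight_add_def)
  qed
qed

lemma op_conj_op_inv_image:
  fixes g :: "'v::euclidean_space \<Rightarrow>\<^sub>L 'v"
  assumes "bij (blinfun_apply g)"
  shows "op_conj (op_inv g) ` op_conj g ` T = T" "op_conj g ` op_conj (op_inv g) ` T = T"
  using op_conj_cancel[OF assms] by (auto simp: image_image)

lemma weyl_act_inverse:
  fixes g :: "'v::euclidean_space \<Rightarrow>\<^sub>L 'v"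
  assumes g: "bij (blinfun_apply g)" and \<mu>: "\<mu> \<in> extensional T"
  shows "weyl_act T (op_inv g) (weyl_act (op_conj g ` T) g \<mu>) = \<mu>"
proof (rule extensionalityI[of _ T])
  fix t assume t: "t \<in> T"
  have "op_conj (op_inv g) (op_conj g t) = t"
    using op_conj_cancel[OF g] by simp
  moreover have "weyl_act (op_conj (op_inv g) ` op_conj g ` T) (op_inv g) (weyl_act (op_conj g ` T) g \<mu>)
      (op_conj (op_inv g) (op_conj g t)) = weyl_act (op_conj g ` T) g \<mu> (op_conj g t)"
    using t by (intro weyl_act_op_conj op_inv_op_inv g) auto
  ultimately show "weyl_act T (op_inv g) (weyl_act (op_conj g ` T) g \<mu>) t = \<mu> t"
    using t g by (simp add: op_conj_op_inv_image weyl_act_op_conj)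
qed (use \<mu> in \<open>auto simp: weyl_act_def\<close>)

section \<open>Transport of the Lie algebra, roots and normalizer\<close>

lemma lie_algebra_op_conj:
  fixes g :: "'v::euclidean_space \<Rightarrow>\<^sub>L 'v"
  assumes G: "linear_group G" and g: "g \<in> G" and X: "X \<in> lie_algebra G"
  shows "op_conj g X \<in> lie_algebra G"
proof -
  obtain \<gamma> where \<gamma>: "\<And>s::real. \<gamma> s \<in> G" "\<gamma> 0 = id_blinfun" "(\<gamma> has_vector_derivative X) (at 0)"
    using X unfolding lie_algebra_def by blast
  have b: "bij (blinfun_apply g)" using G g by (auto simp: linear_group_def)
  have "op_conj g (\<gamma> s) \<in> G" for s
    using G g \<gamma>(1)[of s] unfolding linear_group_def op_conj_def by blast
  moreover have "op_conj g (\<gamma> 0) = id_blinfun"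
    by (simp add: \<gamma> op_conj_id[OF b])
  moreover have "((\<lambda>s. op_conj g (\<gamma> s)) has_vector_derivative op_conj g X) (at 0)"
  proof (rule bounded_linear.has_vector_derivative[OF _ \<gamma>(3)])
    show "bounded_linear (op_conj g)"
      unfolding op_conj_def
      by (rule bounded_linear_compose[OF bounded_bilinear.bounded_linear_left[OF bounded_bilinear_blinfun_compose]
            bounded_bilinear.bounded_linear_right[OF bounded_bilinear_blinfun_compose]])
  qed
  ultimately show ?thesis
    unfolding lie_algebra_def by (intro CollectI exI[of _ "\<lambda>s. op_conj g (\<gamma> s)"]) blast
qed

lemma roots_op_conj:
  fixes g :: "'v::euclidean_space \<Rightarrow>\<^sub>L 'v"
  assumes G: "linear_group G" and g: "g \<in> G" and T: "linear_group T" and \<mu>: "\<mu> \<in> roots G T"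
  shows "weyl_act (op_conj g ` T) g \<mu> \<in> roots G (op_conj g ` T)"
proof -
  have b: "bij (blinfun_apply g)" using G g by (auto simp: linear_group_def)
  have bT: "bij (blinfun_apply t)" if "t \<in> T" for t using T that by (auto simp: linear_group_def)
  obtain X Y where X: "X \<in> lie_algebra G" "Y \<in> lie_algebra G" "X \<noteq> 0 \<or> Y \<noteq> 0"
    and eq: "\<And>t. t \<in> T \<Longrightarrow> t o\<^sub>L X o\<^sub>L op_inv t = Re (\<mu> t) *\<^sub>R X - Im (\<mu> t) *\<^sub>R Y"
      "\<And>t. t \<in> T \<Longrightarrow> t o\<^sub>L Y o\<^sub>L op_inv t = Im (\<mu> t) *\<^sub>R X + Re (\<mu> t) *\<^sub>R Y"
    using \<mu> unfolding roots_def by blast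
  note act = weyl_act_op_conj[OF b]
  have zero: "op_conj g Z = 0 \<Longrightarrow> Z = 0" for Z
  proof -
    assume "op_conj g Z = 0"
    then have "op_conj (op_inv g) (op_conj g Z) = 0"
      by (intro blinfun_eqI) (simp add: op_conj_apply)
    then show ?thesis by (simp add: op_conj_cancel[OF b])
  qed
  have conj: "op_conj g t o\<^sub>L op_conj g Z o\<^sub>L op_inv (op_conj g t) = op_conj g (t o\<^sub>L Z o\<^sub>L op_inv t)"
    if "t \<in> T" for t Z
    by (simp add: op_inv_op_conj[OF b bT[OF that]] op_conj_compose[OF b])
  have lin: "op_conj g (r *\<^sub>R Z - q *\<^sub>R W) = r *\<^sub>R op_conj g Z - q *\<^sub>R op_conj g W"
    "op_conj g (r *\<^sub>R Z + q *\<^sub>R W) = r *\<^sub>R op_conj g Z + q *\<^sub>R op_conj g W" for r q Z W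
    by (auto intro!: blinfun_eqI simp: op_conj_apply blinfun.bilinear_simps)
  show ?thesis
    unfolding roots_def
  proof (intro CollectI conjI)
    show "weyl_act (op_conj g ` T) g \<mu> \<in> weights (op_conj g ` T)"
      using \<mu> by (intro weyl_act_in_weights b T) (simp add: roots_def)
    show "\<exists>s\<in>op_conj g ` T. weyl_act (op_conj g ` T) g \<mu> s \<noteq> 1"
      using \<mu> act by (auto simp: roots_def)
    have "op_conj g X \<noteq> 0 \<or> op_conj g Y \<noteq> 0" using X(3) zero by blast
    moreover have "op_conj g X \<in> lie_algebra G" "op_conj g Y \<in> lie_algebra G"
      using X G g by (auto intro: lie_algebra_op_conj)
    moreover have "s o\<^sub>L op_conj g X o\<^sub>L op_inv s =
          Re (weyl_act (op_conj g ` T) g \<mu> s) *\<^sub>R op_conj g X - Im (weyl_act (op_conj g ` T) g \<mu> s) *\<^sub>R op_conj g Y \<and>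
        s o\<^sub>L op_conj g Y o\<^sub>L op_inv s =
          Im (weyl_act (op_conj g ` T) g \<mu> s) *\<^sub>R op_conj g X + Re (weyl_act (op_conj g ` T) g \<mu> s) *\<^sub>R op_conj g Y"
      if s: "s \<in> op_conj g ` T" for s
    proof -
      obtain t where t: "t \<in> T" "s = op_conj g t" using s by blast
      show ?thesis unfolding t(2) conj[OF t(1)] act[OF t(1)] eq[OF t(1)] lin by simp
    qed
    ultimately show "\<exists>X\<in>lie_algebra G. \<exists>Y\<in>lie_algebra G. (X \<noteq> 0 \<or> Y \<noteq> 0) \<and>
        (\<forall>t\<in>op_conj g ` T.
          t o\<^sub>L X o\<^sub>L op_inv t = Re (weyl_act (op_conj g ` T) g \<mu> t) *\<^sub>R X - Im (weyl_act (op_conj g ` T) g \<mu> t) *\<^sub>R Y \<and>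
          t o\<^sub>L Y o\<^sub>L op_inv t = Im (weyl_act (op_conj g ` T) g \<mu> t) *\<^sub>R X + Re (weyl_act (op_conj g ` T) g \<mu> t) *\<^sub>R Y)"
      by blast
  qed
qed

lemma bij_betw_weights_op_conj:
  fixes g :: "'v::euclidean_space \<Rightarrow>\<^sub>L 'v"
  assumes g: "bij (blinfun_apply g)" and T: "linear_group T"
  shows "bij_betw (weyl_act (op_conj g ` T) g) (weights T) (weights (op_conj g ` T))"
proof (rule bij_betw_byWitness[where f' = "weyl_act T (op_inv g)"])
  let ?T = "op_conj g ` T"
  note b = op_inv_op_inv[OF g] and T' = linear_group_op_conj[OF g T] and im = op_conj_op_inv_image[OF g]
  show "\<forall>\<mu>\<in>weights T. weyl_act T (op_inv g) (weyl_act ?T g \<mu>) = \<mu>"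
    using weyl_act_inverse[OF g] weights_extensional by blast
  show "\<forall>\<mu>\<in>weights ?T. weyl_act ?T g (weyl_act T (op_inv g) \<mu>) = \<mu>"
  proof
    fix \<mu> assume "\<mu> \<in> weights ?T"
    then show "weyl_act ?T g (weyl_act T (op_inv g) \<mu>) = \<mu>"
      using weyl_act_inverse[OF b(1), of \<mu> ?T] im b(2) weights_extensional[of \<mu> ?T] by simp
  qed
  show "weyl_act ?T g ` weights T \<subseteq> weights ?T"
    using weyl_act_in_weights[OF g T] by blast
  show "weyl_act T (op_inv g) ` weights ?T \<subseteq> weights T"
    using weyl_act_in_weights[OF b(1) T'] unfolding im by blast
qed

lemma roots_op_conj_image:
  fixes g :: "'v::euclidean_space \<Rightarrow>\<^sub>L 'v"
  assumes G: "linear_group G" and g: "g \<in> G" and T: "linear_group T"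
  shows "roots G (op_conj g ` T) = weyl_act (op_conj g ` T) g ` roots G T"
proof
  let ?T = "op_conj g ` T"
  have bg: "bij (blinfun_apply g)" and gi: "op_inv g \<in> G" using G g by (auto simp: linear_group_def)
  note b = op_inv_op_inv[OF bg] and T' = linear_group_op_conj[OF bg T] and im = op_conj_op_inv_image[OF bg]
  show "weyl_act ?T g ` roots G T \<subseteq> roots G ?T"
    using roots_op_conj[OF G g T] by blast
  show "roots G ?T \<subseteq> weyl_act ?T g ` roots G T"
  proof
    fix \<mu> assume \<mu>: "\<mu> \<in> roots G ?T"
    then have "weyl_act T (op_inv g) \<mu> \<in> roots G T"
      using roots_op_conj[OF G gi T'] im by auto
    moreover have "weyl_act ?T g (weyl_act T (op_inv g) \<mu>) = \<mu>"
      using weyl_act_inverse[OF b(1), of \<mu> ?T] \<mu> im b(2) weights_extensional[of \<mu> ?T] by (simp add: roots_def)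
    ultimately show "\<mu> \<in> weyl_act ?T g ` roots G T" by (metis imageI)
  qed
qed

lemma normalizer_iff: "n \<in> normalizer G T \<longleftrightarrow> n \<in> G \<and> op_conj n ` T = T"
  by (simp add: normalizer_def op_conj_def[abs_def])

text \<open>The Weyl actions before and after conjugation correspond, so one normalizing element
  found for the diagonal torus serves every maximal torus.\<close>

lemma normalizer_op_conj:
  fixes g :: "'v::euclidean_space \<Rightarrow>\<^sub>L 'v"
  assumes G: "linear_group G" and g: "g \<in> G" and n: "n \<in> normalizer G T"
  shows "op_conj g n \<in> normalizer G (op_conj g ` T)"
    "weyl_act (op_conj g ` T) (op_conj g n) (weyl_act (op_conj g ` T) g \<mu>) =
      weyl_act (op_conj g ` T) g (weyl_act T n \<mu>)"
proof -
  have bg: "bij (blinfun_apply g)" and bn: "bij (blinfun_apply n)"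
    using G g n by (auto simp: linear_group_def normalizer_def)
  have nG: "n \<in> G" and nT: "op_conj n ` T = T" using n by (auto simp: normalizer_iff)
  have c: "op_conj (op_conj g n) (op_conj g t) = op_conj g (op_conj n t)" for t
    using bg bn by (intro blinfun_eqI) (simp add: op_conj_apply op_inv_op_conj)
  have "op_conj (op_conj g n) ` op_conj g ` T = op_conj g ` T"
    using nT by (simp add: image_image c flip: image_image[of "op_conj g" "op_conj n"])
  moreover have "op_conj g n \<in> G"
    using G g nG unfolding op_conj_def linear_group_def by blast
  ultimately show norm: "op_conj g n \<in> normalizer G (op_conj g ` T)"
    by (simp add: normalizer_iff)
  show "weyl_act (op_conj g ` T) (op_conj g n) (weyl_act (op_conj g ` T) g \<mu>) =
      weyl_act (op_conj g ` T) g (weyl_act T n \<mu>)"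
  proof (rule extensionalityI[of _ "op_conj g ` T"])
    fix s assume "s \<in> op_conj g ` T"
    then obtain t where t: "t \<in> T" "s = op_conj g (op_conj n t)" using nT by (metis image_iff)
    have b': "bij (blinfun_apply (op_conj g n))" by (rule op_inv_op_conj[OF bg bn])
    have eq: "op_conj (op_conj g n) ` op_conj g ` T = op_conj g ` T"
      using norm by (simp add: normalizer_iff)
    have "weyl_act (op_conj g ` T) (op_conj g n) (weyl_act (op_conj g ` T) g \<mu>) s = \<mu> t"
      using weyl_act_op_conj[OF b', of "op_conj g t" "op_conj g ` T"] t
      by (simp add: eq c weyl_act_op_conj[OF bg])
    moreover have "op_conj n t \<in> T" using t nT by blast
    then have "weyl_act (op_conj g ` T) g (weyl_act T n \<mu>) s = \<mu> t"
      using weyl_act_op_conj[OF bg, of "op_conj n t" T] weyl_act_op_conj[OF bn, of t T] t nT by auto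
    ultimately show "weyl_act (op_conj g ` T) (op_conj g n) (weyl_act (op_conj g ` T) g \<mu>) s =
      weyl_act (op_conj g ` T) g (weyl_act T n \<mu>) s" by simp
  qed (simp_all add: weyl_act_def)
qed

section \<open>Roots\<close>

text \<open>The product rule, applied to the multiplicativity of a curve through the
  identity.\<close>

lemma lie_algebra_G2_derivation:
  assumes "X \<in> lie_algebra G2"
  shows "X (oct_mult x y) = oct_mult (X x) y + oct_mult x (X y)"
proof -
  obtain \<gamma> where \<gamma>: "\<And>s::real. \<gamma> s \<in> G2" "\<gamma> 0 = id_blinfun" "(\<gamma> has_vector_derivative X) (at 0)"
    using assms unfolding lie_algebra_def by blast
  have d: "((\<lambda>s. blinfun_apply (\<gamma> s) x) has_vector_derivative X x) (at 0)" for x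
    by (rule bounded_linear.has_vector_derivative[OF blinfun.bounded_linear_left \<gamma>(3)])
  have "((\<lambda>s. oct_mult (\<gamma> s x) (\<gamma> s y)) has_vector_derivative
      oct_mult (\<gamma> 0 x) (X y) + oct_mult (X x) (\<gamma> 0 y)) (at 0)"
    by (rule bounded_bilinear.has_vector_derivative[OF bounded_bilinear_oct_mult d d])
  moreover have "(\<lambda>s. oct_mult (\<gamma> s x) (\<gamma> s y)) = (\<lambda>s. \<gamma> s (oct_mult x y))"
    using \<gamma>(1) by (simp add: G2_mult)
  ultimately have "X (oct_mult x y) = oct_mult (\<gamma> 0 x) (X y) + oct_mult (X x) (\<gamma> 0 y)"
    using d[of "oct_mult x y"] vector_derivative_unique_at by fastforce
  then show ?thesis by (simp add: \<gamma>(2))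
qed

text \<open>A derivation kills the unit; if it also kills \<open>oct_i\<close>, it kills all complex
  scalars and is therefore linear over them.\<close>

lemma derivation_oct_complex:
  assumes X: "X \<in> lie_algebra G2" and i: "blinfun_apply X oct_i = 0"
  shows "blinfun_apply X (oct_mult (oct_of_complex oct_i c) x) = oct_mult (oct_of_complex oct_i c) (X x)"
proof -
  have "X oct_one = X oct_one + X oct_one"
    using lie_algebra_G2_derivation[OF X, of oct_one oct_one] by simp
  then have "X oct_one = 0" by simp
  then have "X (oct_of_complex oct_i c) = 0"
    unfolding oct_of_complex_def blinfun.add_right blinfun.scaleR_right i by simp
  then show ?thesis
    using lie_algebra_G2_derivation[OF X, of "oct_of_complex oct_i c" x] by (simp add: oct_mult.zero_left)
qed

lemma derivation_eq_zero:
  assumes X: "X \<in> lie_algebra G2"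
    and i: "blinfun_apply X oct_i = 0" and j: "blinfun_apply X oct_j = 0" and l: "blinfun_apply X oct_l = 0"
  shows "X = 0"
proof (rule blinfun_eqI)
  fix x
  have c: "X (oct_of_complex oct_i c) = 0" for c
  proof -
    have "X oct_one = X oct_one + X oct_one"
      using lie_algebra_G2_derivation[OF X, of oct_one oct_one] by simp
    then have "X oct_one = 0" by simp
    then show ?thesis
      using derivation_oct_complex[OF X i, of c oct_one] by (simp add: oct_mult.zero_right)
  qed
  have "X (oct_of_triple oct_i oct_j oct_l x) = 0"
    unfolding oct_of_triple_def oct_of_quat_def blinfun.add_right lie_algebra_G2_derivation[OF X] c j l
    by (simp add: oct_mult.zero_left oct_mult.zero_right)
  then show "X x = blinfun_apply 0 x"
    by (simp add: oct_of_triple_standard)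
qed

text \<open>For nonzero \<open>p\<close>, evaluation at \<open>pi / p\<close> gives the value -1, so
  \<open>a\<close> is an odd multiple of \<open>p\<close>; by symmetry nonzero frequencies divide
  each other. A zero frequency gives a constant cosine.\<close>

lemma cos_int_eq:
  assumes eq: "\<And>x::real. cos (of_int a * x) = cos (of_int p * x)"
  shows "\<bar>a\<bar> = \<bar>p :: int\<bar>"
proof -
  have dvd: "p \<noteq> 0 \<Longrightarrow> p dvd a" if eq: "\<And>x::real. cos (of_int a * x) = cos (of_int p * x)" for a p :: int
  proof -
    assume p: "p \<noteq> 0"
    have "cos (of_int a * (pi / of_int p)) = - 1"
      using eq[of "pi / of_int p"] p by simp
    then obtain n :: int where "of_int a * (pi / of_int p) = (2 * of_int n + 1) * pi"
      by (auto simp: cos_eq_minus1)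
    then have "pi * real_of_int a = pi * of_int ((2 * n + 1) * p)"
      using p by (simp add: field_simps)
    then have "real_of_int a = of_int ((2 * n + 1) * p)"
      using mult_left_cancel[OF pi_neq_zero] by blast
    then show ?thesis by (metis dvd_triv_right of_int_eq_iff)
  qed
  have zero: "p = 0" if eq: "\<And>x::real. cos (of_int p * x) = 1" for p :: int
  proof (rule ccontr)
    assume "p \<noteq> 0"
    then show False using eq[of "pi / of_int p"] by simp
  qed
  show ?thesis
  proof (cases "a = 0 \<or> p = 0")
    case True
    then show ?thesis using zero[of a] zero[of p] eq by auto
  next
    case False
    then have "p dvd a" "a dvd p"
      using dvd[of a p] dvd[of p a] eq by simp_all
    then show ?thesis using zdvd_antisym_abs by blast
  qed
qed

text \<open>Along the one-parameter subgroup with slopes \<open>s\<close> and \<open>t\<close> the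
  characters become cosines. The slopes (1, 0) and (0, 1) fix the absolute values of the exponents,
  and (1, 1) fixes their relative sign.\<close>

lemma Re_power_int_eq:
  assumes eq: "\<And>z w :: complex. norm z = 1 \<Longrightarrow> norm w = 1 \<Longrightarrow>
      Re (z powi a * w powi b) = Re (z powi p * w powi q)"
  shows "(a, b) = (p, q) \<or> (a, b) = (- p, - q)"
proof -
  have *: "\<bar>a * s + b * t\<bar> = \<bar>p * s + q * t\<bar>" for s t :: int
  proof (rule cos_int_eq)
    fix x :: real
    have "cis (of_int s * x) powi a * cis (of_int t * x) powi b = cis (of_int (a * s + b * t) * x)" for a b
      by (simp add: cis_power_int cis_mult algebra_simps)
    with eq[of "cis (of_int s * x)" "cis (of_int t * x)"]
    have "Re (cis (of_int (a * s + b * t) * x)) = Re (cis (of_int (p * s + q * t) * x))" by simp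
    then show "cos (of_int (a * s + b * t) * x) = cos (of_int (p * s + q * t) * x)"
      by (simp only: cis.sel)
  qed
  show ?thesis
    using *[of 1 0] *[of 0 1] *[of 1 1] by auto
qed

text \<open>The first row holds the short roots, which are the nonzero weights of the torus on the
  complexified imaginary octonions. The second holds the long ones, the differences of (1, 0), (0,
  1) and (-1, -1).\<close>

definition g2_roots :: "(int \<times> int) set" where
  "g2_roots = {(1, 0), (0, 1), (-1, -1), (-1, 0), (0, -1), (1, 1),
               (1, -1), (1, 2), (-2, -1), (-1, 1), (-1, -2), (2, 1)}"

lemma Re_component_eq:
  assumes "M * \<beta> + cnj M * \<beta> = of_real (2 * r) * (\<beta> :: complex)" "\<beta> \<noteq> 0"
  shows "Re M = r"
proof -
  have "(M + cnj M) * \<beta> = of_real (2 * r) * \<beta>" using assms(1) by (simp add: algebra_simps)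
  then have "M + cnj M = of_real (2 * r)" using assms(2) by simp
  then show ?thesis by (simp add: complex_eq_iff)
qed

lemma inverse_unit:
  assumes "norm (z :: complex) = 1"
  shows "inverse z = cnj z"
  using cnj_mult_unit[OF assms] inverse_unique by metis

text \<open>A nonzero derivation moves \<open>oct_i\<close>, \<open>oct_j\<close> or
  \<open>oct_l\<close>. The torus multiplies each complex coordinate of the image by an explicit
  character, so any nonzero coordinate determines the root up to sign.\<close>

lemma roots_oct_torus_subset: "roots G2 oct_torus \<subseteq> oct_torus_weight ` g2_roots"
proof
  fix \<mu> assume \<mu>: "\<mu> \<in> roots G2 oct_torus"
  then obtain k where k: "\<mu> = oct_torus_weight k"
    using weights_oct_torus unfolding roots_def by auto
  obtain a b where ab: "k = (a, b)" by (cases k)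
  have k0: "(a, b) \<noteq> (0, 0)"
    using \<mu> unfolding k ab roots_def by (auto simp: in_oct_torus oct_torus_weight_elt)
  define m where "m = (\<lambda>z w :: complex. z powi a * w powi b)"
  obtain X Y where XY: "X \<in> lie_algebra G2" "Y \<in> lie_algebra G2" "X \<noteq> 0 \<or> Y \<noteq> 0"
    and ad: "\<And>t. t \<in> oct_torus \<Longrightarrow> t o\<^sub>L X o\<^sub>L op_inv t = Re (\<mu> t) *\<^sub>R X - Im (\<mu> t) *\<^sub>R Y"
      "\<And>t. t \<in> oct_torus \<Longrightarrow> t o\<^sub>L Y o\<^sub>L op_inv t = Im (\<mu> t) *\<^sub>R X + Re (\<mu> t) *\<^sub>R Y"
    using \<mu> unfolding roots_def by blast
  let ?t = oct_torus_elt
  have ad': "?t z w (X (?t (cnj z) (cnj w) x)) = Re (m z w) *\<^sub>R X x - Im (m z w) *\<^sub>R Y x"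
      "?t z w (Y (?t (cnj z) (cnj w) x)) = Im (m z w) *\<^sub>R X x + Re (m z w) *\<^sub>R Y x"
    if n: "norm z = 1" "norm w = 1" for z w x
  proof -
    have "?t z w \<in> oct_torus" using n unfolding in_oct_torus by blast
    note * = ad[OF this, THEN arg_cong, of "\<lambda>f. blinfun_apply f x"]
    show "?t z w (X (?t (cnj z) (cnj w) x)) = Re (m z w) *\<^sub>R X x - Im (m z w) *\<^sub>R Y x"
      "?t z w (Y (?t (cnj z) (cnj w) x)) = Im (m z w) *\<^sub>R X x + Re (m z w) *\<^sub>R Y x"
      using * n by (simp_all add: op_inv_oct_torus_elt k ab oct_torus_weight_elt m_def blinfun.bilinear_simps)
  qed
  have m_cnj: "m (cnj z) (cnj w) = cnj (m z w)" for z w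
    by (simp add: m_def complex_cnj_power_int)
  \<comment> \<open>Adding the relations for \<open>t\<close> and its inverse cancels the imaginary
    parts, which mix \<open>X\<close> and \<open>Y\<close>. One nonzero vector \<open>Z\<close> then
    suffices, at the price of seeing only the real part of the character.\<close>
  obtain Z where Z: "Z \<in> lie_algebra G2" "Z \<noteq> 0"
    and adZ: "\<And>z w x. norm z = 1 \<Longrightarrow> norm w = 1 \<Longrightarrow>
      ?t z w (Z (?t (cnj z) (cnj w) x)) + ?t (cnj z) (cnj w) (Z (?t z w x)) = (2 * Re (m z w)) *\<^sub>R Z x"
  proof (cases "X = 0")
    case False
    show ?thesis
    proof (rule that[of X])
      fix z w x assume n: "norm (z :: complex) = 1" "norm (w :: complex) = 1"
      show "?t z w (X (?t (cnj z) (cnj w) x)) + ?t (cnj z) (cnj w) (X (?t z w x)) = (2 * Re (m z w)) *\<^sub>R X x"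
        using ad'(1)[of z w x] ad'(1)[of "cnj z" "cnj w" x] n
        by (simp add: m_cnj scaleR_add_left[symmetric])
    qed (use XY False in auto)
  next
    case True
    show ?thesis
    proof (rule that[of Y])
      fix z w x assume n: "norm (z :: complex) = 1" "norm (w :: complex) = 1"
      show "?t z w (Y (?t (cnj z) (cnj w) x)) + ?t (cnj z) (cnj w) (Y (?t z w x)) = (2 * Re (m z w)) *\<^sub>R Y x"
        using ad'(2)[of z w x] ad'(2)[of "cnj z" "cnj w" x] n
        by (simp add: m_cnj scaleR_add_left[symmetric])
    qed (use XY True in auto)
  qed
  \<comment> \<open>\<open>\<beta>\<close> stands for a coordinate of the image of a basis octonion
    under \<open>Z\<close>, and \<open>M z w\<close> for the factor that conjugation by the torus
    puts on it.\<close>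
  have root: "(a, b) = (p, q) \<or> (a, b) = (- p, - q)"
    if "\<beta> \<noteq> 0" and "\<And>z w. norm z = 1 \<Longrightarrow> norm w = 1 \<Longrightarrow>
      M z w * \<beta> + cnj (M z w) * \<beta> = of_real (2 * Re (m z w)) * \<beta>"
      and "\<And>z w. norm z = 1 \<Longrightarrow> norm w = 1 \<Longrightarrow> z powi p * w powi q = M z w" for p q \<beta> M
  proof (rule Re_power_int_eq)
    fix z w :: complex assume n: "norm z = 1" "norm w = 1"
    from Re_component_eq[OF that(2)[OF n] that(1)] that(3)[OF n]
    show "Re (z powi a * w powi b) = Re (z powi p * w powi q)" by (simp add: m_def)
  qed
  have comp: "\<beta> + \<delta> = (2 * r) *\<^sub>R \<zeta> \<Longrightarrow>
      fst (fst \<beta>) + fst (fst \<delta>) = of_real (2 * r) * fst (fst \<zeta>) \<and>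
      snd (fst \<beta>) + snd (fst \<delta>) = of_real (2 * r) * snd (fst \<zeta>) \<and>
      fst (snd \<beta>) + fst (snd \<delta>) = of_real (2 * r) * fst (snd \<zeta>) \<and>
      snd (snd \<beta>) + snd (snd \<delta>) = of_real (2 * r) * snd (snd \<zeta>)" for \<beta> \<delta> \<zeta> :: oct and r
    by (simp add: prod_eq_iff scaleR_conv_of_real)
  have unit_cancel: "z * (cnj z * c) = c" "cnj z * (z * c) = c" if "norm z = 1" for z c
    using cnj_mult_unit[OF that] by (simp_all flip: mult.assoc)
  note unit_simps = inverse_unit power2_eq_square
  have "(a, b) \<in> g2_roots"
  proof (cases "Z oct_i = 0")
    case False
    have ti: "?t z w oct_i = oct_i" for z w by (simp add: oct_torus_elt_apply)
    note eq = comp[OF adZ[of _ _ oct_i], unfolded ti oct_torus_elt_apply fst_conv snd_conv]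
    have "(a, b) = (0, 0) \<or> (a, b) = (- (0), - (0))" if nz: "fst (fst (Z oct_i)) \<noteq> 0"
    proof (rule root[OF nz, of "\<lambda>z w. 1" "0" "0"])
      fix z w :: complex assume n: "norm z = 1" "norm w = 1"
      show "(1) * fst (fst (Z oct_i)) + cnj (1) * fst (fst (Z oct_i)) =
          of_real (2 * Re (m z w)) * fst (fst (Z oct_i))"
        using eq[OF n] by (simp add: unit_cancel n mult_ac)
      show "z powi (0) * w powi (0) = 1"
        using n by (simp add: unit_simps mult_ac)
    qed
    moreover have "(a, b) = (1, 0) \<or> (a, b) = (- (1), - (0))" if nz: "snd (fst (Z oct_i)) \<noteq> 0"
    proof (rule root[OF nz, of "\<lambda>z w. z" "1" "0"])
      fix z w :: complex assume n: "norm z = 1" "norm w = 1"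
      show "(z) * snd (fst (Z oct_i)) + cnj (z) * snd (fst (Z oct_i)) =
          of_real (2 * Re (m z w)) * snd (fst (Z oct_i))"
        using eq[OF n] by (simp add: unit_cancel n mult_ac)
      show "z powi (1) * w powi (0) = z"
        using n by (simp add: unit_simps mult_ac)
    qed
    moreover have "(a, b) = (0, 1) \<or> (a, b) = (- (0), - (1))" if nz: "fst (snd (Z oct_i)) \<noteq> 0"
    proof (rule root[OF nz, of "\<lambda>z w. w" "0" "1"])
      fix z w :: complex assume n: "norm z = 1" "norm w = 1"
      show "(w) * fst (snd (Z oct_i)) + cnj (w) * fst (snd (Z oct_i)) =
          of_real (2 * Re (m z w)) * fst (snd (Z oct_i))"
        using eq[OF n] by (simp add: unit_cancel n mult_ac)
      show "z powi (0) * w powi (1) = w"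
        using n by (simp add: unit_simps mult_ac)
    qed
    moreover have "(a, b) = (1, 1) \<or> (a, b) = (- (1), - (1))" if nz: "snd (snd (Z oct_i)) \<noteq> 0"
    proof (rule root[OF nz, of "\<lambda>z w. z * w" "1" "1"])
      fix z w :: complex assume n: "norm z = 1" "norm w = 1"
      show "(z * w) * snd (snd (Z oct_i)) + cnj (z * w) * snd (snd (Z oct_i)) =
          of_real (2 * Re (m z w)) * snd (snd (Z oct_i))"
        using eq[OF n] by (simp add: unit_cancel n mult_ac)
      show "z powi (1) * w powi (1) = z * w"
        using n by (simp add: unit_simps mult_ac)
    qed
    moreover have "fst (fst (Z oct_i)) \<noteq> 0 \<or> snd (fst (Z oct_i)) \<noteq> 0 \<or> fst (snd (Z oct_i)) \<noteq> 0 \<or> snd (snd (Z oct_i)) \<noteq> 0"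
      using False by (auto simp: prod_eq_iff)
    ultimately have "(a, b) \<in> {(0, 0), (- (0), - (0)), (1, 0), (- (1), - (0)), (0, 1), (- (0), - (1)), (1, 1), (- (1), - (1))}"
      by blast
    then show ?thesis using k0 by (auto simp: g2_roots_def)
  next
    case True
    \<comment> \<open>The torus acts on \<open>oct_j\<close> and \<open>oct_l\<close> by complex
      scalars, and \<open>Z\<close> now commutes with these.\<close>
    note cmul = derivation_oct_complex[OF Z(1) True]
    show ?thesis
    proof (cases "Z oct_j = 0")
      case False
      have tj: "?t z w oct_j = oct_mult (oct_of_complex oct_i z) oct_j" for z w
        by (rule oct_eqI) (simp_all add: oct_torus_elt_apply oct_of_complex_def oct_simps complex_eq_iff)
      \<comment> \<open>Because of the conjugate in the last coordinate, the scalar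
        \<open>cnj z\<close> pulled out of \<open>Z\<close> reappears there as \<open>z\<close>. The
        factor becomes \<open>z * w * z\<close>, the long root (2, 1).\<close>
      have lm: "oct_mult (oct_of_complex oct_i c) x =
         ((c * fst (fst x), c * snd (fst x)), (c * fst (snd x), cnj c * snd (snd x)))" for c x
        by (rule oct_eqI) (simp_all add: oct_of_complex_def oct_simps complex_eq_iff algebra_simps)
      note eq = comp[OF adZ[of _ _ oct_j], unfolded tj, unfolded cmul, unfolded oct_torus_elt_apply lm fst_conv snd_conv]
      have "(a, b) = (-1, 0) \<or> (a, b) = (- (-1), - (0))" if nz: "fst (fst (Z oct_j)) \<noteq> 0"
      proof (rule root[OF nz, of "\<lambda>z w. cnj z" "-1" "0"])
        fix z w :: complex assume n: "norm z = 1" "norm w = 1"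
        show "(cnj z) * fst (fst (Z oct_j)) + cnj (cnj z) * fst (fst (Z oct_j)) =
            of_real (2 * Re (m z w)) * fst (fst (Z oct_j))"
          using eq[OF n] by (simp add: unit_cancel n mult_ac)
        show "z powi (-1) * w powi (0) = cnj z"
          using n by (simp add: unit_simps mult_ac)
      qed
      moreover have "(a, b) = (0, 0) \<or> (a, b) = (- (0), - (0))" if nz: "snd (fst (Z oct_j)) \<noteq> 0"
      proof (rule root[OF nz, of "\<lambda>z w. 1" "0" "0"])
        fix z w :: complex assume n: "norm z = 1" "norm w = 1"
        show "(1) * snd (fst (Z oct_j)) + cnj (1) * snd (fst (Z oct_j)) =
            of_real (2 * Re (m z w)) * snd (fst (Z oct_j))"
          using eq[OF n] by (simp add: unit_cancel n mult_ac)
        show "z powi (0) * w powi (0) = 1"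
          using n by (simp add: unit_simps mult_ac)
      qed
      moreover have "(a, b) = (-1, 1) \<or> (a, b) = (- (-1), - (1))" if nz: "fst (snd (Z oct_j)) \<noteq> 0"
      proof (rule root[OF nz, of "\<lambda>z w. w * cnj z" "-1" "1"])
        fix z w :: complex assume n: "norm z = 1" "norm w = 1"
        show "(w * cnj z) * fst (snd (Z oct_j)) + cnj (w * cnj z) * fst (snd (Z oct_j)) =
            of_real (2 * Re (m z w)) * fst (snd (Z oct_j))"
          using eq[OF n] by (simp add: unit_cancel n mult_ac)
        show "z powi (-1) * w powi (1) = w * cnj z"
          using n by (simp add: unit_simps mult_ac)
      qed
      moreover have "(a, b) = (2, 1) \<or> (a, b) = (- (2), - (1))" if nz: "snd (snd (Z oct_j)) \<noteq> 0"
      proof (rule root[OF nz, of "\<lambda>z w. z * w * z" "2" "1"])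
        fix z w :: complex assume n: "norm z = 1" "norm w = 1"
        show "(z * w * z) * snd (snd (Z oct_j)) + cnj (z * w * z) * snd (snd (Z oct_j)) =
            of_real (2 * Re (m z w)) * snd (snd (Z oct_j))"
          using eq[OF n] by (simp add: unit_cancel n mult_ac)
        show "z powi (2) * w powi (1) = z * w * z"
          using n by (simp add: unit_simps mult_ac)
      qed
      moreover have "fst (fst (Z oct_j)) \<noteq> 0 \<or> snd (fst (Z oct_j)) \<noteq> 0 \<or> fst (snd (Z oct_j)) \<noteq> 0 \<or> snd (snd (Z oct_j)) \<noteq> 0"
        using False by (auto simp: prod_eq_iff)
      ultimately have "(a, b) \<in> {(-1, 0), (- (-1), - (0)), (0, 0), (- (0), - (0)), (-1, 1), (- (-1), - (1)), (2, 1), (- (2), - (1))}"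
        by blast
      then show ?thesis using k0 by (auto simp: g2_roots_def)
    next
      case j: True
      have "Z oct_l \<noteq> 0" using derivation_eq_zero[OF Z(1) True j] Z(2) by blast
      have tl: "?t z w oct_l = oct_mult (oct_of_complex oct_i w) oct_l" for z w
        by (rule oct_eqI) (simp_all add: oct_torus_elt_apply oct_of_complex_def oct_simps complex_eq_iff)
      have lm: "oct_mult (oct_of_complex oct_i c) x =
         ((c * fst (fst x), c * snd (fst x)), (c * fst (snd x), cnj c * snd (snd x)))" for c x
        by (rule oct_eqI) (simp_all add: oct_of_complex_def oct_simps complex_eq_iff algebra_simps)
      note eq = comp[OF adZ[of _ _ oct_l], unfolded tl, unfolded cmul, unfolded oct_torus_elt_apply lm fst_conv snd_conv]
      have "(a, b) = (0, -1) \<or> (a, b) = (- (0), - (-1))" if nz: "fst (fst (Z oct_l)) \<noteq> 0"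
      proof (rule root[OF nz, of "\<lambda>z w. cnj w" "0" "-1"])
        fix z w :: complex assume n: "norm z = 1" "norm w = 1"
        show "(cnj w) * fst (fst (Z oct_l)) + cnj (cnj w) * fst (fst (Z oct_l)) =
            of_real (2 * Re (m z w)) * fst (fst (Z oct_l))"
          using eq[OF n] by (simp add: unit_cancel n mult_ac)
        show "z powi (0) * w powi (-1) = cnj w"
          using n by (simp add: unit_simps mult_ac)
      qed
      moreover have "(a, b) = (1, -1) \<or> (a, b) = (- (1), - (-1))" if nz: "snd (fst (Z oct_l)) \<noteq> 0"
      proof (rule root[OF nz, of "\<lambda>z w. z * cnj w" "1" "-1"])
        fix z w :: complex assume n: "norm z = 1" "norm w = 1"
        show "(z * cnj w) * snd (fst (Z oct_l)) + cnj (z * cnj w) * snd (fst (Z oct_l)) =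
            of_real (2 * Re (m z w)) * snd (fst (Z oct_l))"
          using eq[OF n] by (simp add: unit_cancel n mult_ac)
        show "z powi (1) * w powi (-1) = z * cnj w"
          using n by (simp add: unit_simps mult_ac)
      qed
      moreover have "(a, b) = (0, 0) \<or> (a, b) = (- (0), - (0))" if nz: "fst (snd (Z oct_l)) \<noteq> 0"
      proof (rule root[OF nz, of "\<lambda>z w. 1" "0" "0"])
        fix z w :: complex assume n: "norm z = 1" "norm w = 1"
        show "(1) * fst (snd (Z oct_l)) + cnj (1) * fst (snd (Z oct_l)) =
            of_real (2 * Re (m z w)) * fst (snd (Z oct_l))"
          using eq[OF n] by (simp add: unit_cancel n mult_ac)
        show "z powi (0) * w powi (0) = 1"
          using n by (simp add: unit_simps mult_ac)
      qed
      moreover have "(a, b) = (1, 2) \<or> (a, b) = (- (1), - (2))" if nz: "snd (snd (Z oct_l)) \<noteq> 0"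
      proof (rule root[OF nz, of "\<lambda>z w. z * w * w" "1" "2"])
        fix z w :: complex assume n: "norm z = 1" "norm w = 1"
        show "(z * w * w) * snd (snd (Z oct_l)) + cnj (z * w * w) * snd (snd (Z oct_l)) =
            of_real (2 * Re (m z w)) * snd (snd (Z oct_l))"
          using eq[OF n] by (simp add: unit_cancel n mult_ac)
        show "z powi (1) * w powi (2) = z * w * w"
          using n by (simp add: unit_simps mult_ac)
      qed
      moreover have "fst (fst (Z oct_l)) \<noteq> 0 \<or> snd (fst (Z oct_l)) \<noteq> 0 \<or> fst (snd (Z oct_l)) \<noteq> 0 \<or> snd (snd (Z oct_l)) \<noteq> 0"
        using \<open>Z oct_l \<noteq> 0\<close> by (auto simp: prod_eq_iff)
      ultimately have "(a, b) \<in> {(0, -1), (- (0), - (-1)), (1, -1), (- (1), - (-1)), (0, 0), (- (0), - (0)), (1, 2), (- (1), - (2))}"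
        by blast
      then show ?thesis using k0 by (auto simp: g2_roots_def)
    qed
  qed
  then show "\<mu> \<in> oct_torus_weight ` g2_roots" unfolding k ab by blast
qed

section \<open>Root vectors from curves of unit quaternions\<close>

lemma quat_mult_assoc: "quat_mult (quat_mult x y) z = quat_mult x (quat_mult y z)"
  by (simp add: quat_mult_def algebra_simps)

lemma quat_mult_add: "quat_mult (x + y) z = quat_mult x z + quat_mult y z"
  "quat_mult x (y + z) = quat_mult x y + quat_mult x z"
  by (simp_all add: quat_mult_def algebra_simps)

lemma quat_mult_scaleR: "quat_mult (r *\<^sub>R x) y = r *\<^sub>R quat_mult x y"
  "quat_mult x (r *\<^sub>R y) = r *\<^sub>R quat_mult x y"
  by (simp_all add: quat_mult_def scaleR_conv_of_real algebra_simps)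

lemma bounded_bilinear_quat_mult: "bounded_bilinear quat_mult"
  by (intro bilinear_conv_bounded_bilinear[THEN iffD1])
     (auto simp: bilinear_def intro!: linearI quat_mult_add quat_mult_scaleR)

interpretation quat_mult: bounded_bilinear quat_mult
  by (rule bounded_bilinear_quat_mult)

lemma quat_cnj_mult: "quat_cnj (quat_mult x y) = quat_mult (quat_cnj y) (quat_cnj x)"
  by (simp add: quat_mult_def quat_cnj_def algebra_simps)

lemma quat_cnj_cnj: "quat_cnj (quat_cnj x) = x"
  by (simp add: quat_cnj_def)

lemma linear_quat_cnj: "linear quat_cnj"
  by (intro linearI) (simp_all add: quat_cnj_def)

lemma quat_mult_one: "quat_mult (1, 0) x = x" "quat_mult x (1, 0) = x"
  by (simp_all add: quat_mult_def)

definition quat_unit :: "quat \<Rightarrow> bool" where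
  "quat_unit u \<longleftrightarrow> quat_mult (quat_cnj u) u = (1, 0)"

text \<open>For unit quaternions these maps form the copy of SO(4) in \<open>G2\<close> that
  stabilises the quaternion subalgebra.\<close>

definition oct_of_units :: "quat \<Rightarrow> quat \<Rightarrow> (oct \<Rightarrow>\<^sub>L oct)" where
  "oct_of_units u v = Blinfun (\<lambda>x. (quat_mult (quat_mult u (fst x)) (quat_cnj u),
                                  quat_mult (quat_mult v (snd x)) (quat_cnj u)))"

lemma oct_of_units_apply:
  "blinfun_apply (oct_of_units u v) x = (quat_mult (quat_mult u (fst x)) (quat_cnj u),
                                  quat_mult (quat_mult v (snd x)) (quat_cnj u))"
proof -
  have "linear (\<lambda>x. (quat_mult (quat_mult u (fst x)) (quat_cnj u),
                                  quat_mult (quat_mult v (snd x)) (quat_cnj u)))"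
    by (rule linearI) (simp_all add: quat_mult_add quat_mult_scaleR)
  then show ?thesis
    unfolding oct_of_units_def by (simp add: bounded_linear_Blinfun_apply linear_conv_bounded_linear)
qed

lemma oct_of_units_in_G2:
  assumes "quat_unit u" "quat_unit v"
  shows "oct_of_units u v \<in> G2"
proof (intro oct_alg_hom_in_G2)
  have c: "quat_mult (quat_cnj u) (quat_mult u x) = x" "quat_mult (quat_cnj v) (quat_mult v x) = x" for x
    using assms by (simp_all add: quat_unit_def quat_mult_one flip: quat_mult_assoc)
  have uu: "quat_mult u (quat_cnj u) = (1, 0)"
    using assms(1) unfolding quat_unit_def
    by (simp add: quat_mult_def quat_cnj_def algebra_simps)
  have "oct_of_units u v (oct_mult x y) = oct_mult (oct_of_units u v x) (oct_of_units u v y)" for x y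
    unfolding oct_of_units_apply oct_mult_def
    by (simp add: quat_mult_assoc quat_cnj_mult quat_cnj_cnj c quat_mult_add quat_mult.diff_left
        quat_mult.diff_right)
  moreover have "oct_of_units u v oct_one = oct_one"
    unfolding oct_of_units_apply oct_one_def
    using uu by (simp add: quat_mult_one quat_mult.zero_left quat_mult.zero_right flip: zero_prod_def)
  ultimately show "oct_alg_hom (oct_of_units u v)"
    unfolding oct_alg_hom_def using linear_blinfun_apply by blast
qed

text \<open>In finite dimension pointwise convergence of operators on a basis is norm convergence,
  so the derivative may be computed pointwise.\<close>

lemma blinfun_has_vector_derivative:
  fixes \<gamma> :: "real \<Rightarrow> ('a::euclidean_space \<Rightarrow>\<^sub>L 'b::real_normed_vector)" and X :: "'a \<Rightarrow>\<^sub>L 'b"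
  assumes "\<And>x. ((\<lambda>s. blinfun_apply (\<gamma> s) x) has_vector_derivative blinfun_apply X x) (at a)"
  shows "(\<gamma> has_vector_derivative X) (at a)"
  unfolding has_vector_derivative_def has_derivative_at2
proof (intro conjI)
  show "bounded_linear (\<lambda>s. s *\<^sub>R X)" by (rule bounded_linear_scaleR_left)
  show "(\<lambda>y. (1 / norm (y - a)) *\<^sub>R (\<gamma> y - (\<gamma> a + (y - a) *\<^sub>R X))) \<midarrow>a\<rightarrow> 0"
  proof (rule tendsto_componentwise1)
    fix i :: 'a
    have "(\<lambda>y. (1 / norm (y - a)) *\<^sub>R (\<gamma> y i - (\<gamma> a i + (y - a) *\<^sub>R X i))) \<midarrow>a\<rightarrow> 0"
      using assms[of i] unfolding has_vector_derivative_def has_derivative_at2 by blast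
    then show "(\<lambda>y. ((1 / norm (y - a)) *\<^sub>R (\<gamma> y - (\<gamma> a + (y - a) *\<^sub>R X))) i) \<midarrow>a\<rightarrow> blinfun_apply 0 i"
      by (simp add: blinfun.bilinear_simps)
  qed
qed

text \<open>The derivative of \<open>oct_of_units\<close> at the identity in imaginary directions
  \<open>h\<close> and \<open>k\<close>; the minus signs come from
  \<open>quat_cnj u\<close>.\<close>

definition oct_of_imag :: "quat \<Rightarrow> quat \<Rightarrow> (oct \<Rightarrow>\<^sub>L oct)" where
  "oct_of_imag h k = Blinfun (\<lambda>x. (quat_mult h (fst x) - quat_mult (fst x) h,
                                  quat_mult k (snd x) - quat_mult (snd x) h))"

lemma oct_of_imag_apply:
  "blinfun_apply (oct_of_imag h k) x = (quat_mult h (fst x) - quat_mult (fst x) h,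
                                  quat_mult k (snd x) - quat_mult (snd x) h)"
proof -
  have "linear (\<lambda>x. (quat_mult h (fst x) - quat_mult (fst x) h,
                                  quat_mult k (snd x) - quat_mult (snd x) h))"
    by (rule linearI) (simp_all add: quat_mult_add quat_mult_scaleR scaleR_diff_right)
  then show ?thesis
    unfolding oct_of_imag_def by (simp add: bounded_linear_Blinfun_apply linear_conv_bounded_linear)
qed

lemma quat_unit_curve:
  assumes "norm \<eta> = 1 \<or> \<eta> = 0"
  obtains u where "\<And>s::real. quat_unit (u s)" "u 0 = (1, 0)"
    "(u has_vector_derivative (0, \<eta>)) (at 0)"
proof (cases "\<eta> = 0")
  case True
  show ?thesis
  proof (rule that[of "\<lambda>_. (1, 0)"])
    show "((\<lambda>_. (1, 0)) has_vector_derivative (0, \<eta>)) (at 0)"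
      unfolding True zero_prod_def[symmetric] by (rule has_vector_derivative_const)
  qed (simp_all add: quat_unit_def quat_mult_def quat_cnj_def)
next
  case False
  \<comment> \<open>The great circle through the unit with the prescribed initial velocity.\<close>
  define u :: "real \<Rightarrow> quat" where "u = (\<lambda>s. cos s *\<^sub>R (1, 0) + sin s *\<^sub>R (0, \<eta>))"
  have n: "cnj \<eta> * \<eta> = 1" "\<eta> * cnj \<eta> = 1" using assms False cnj_mult_unit by auto
  show ?thesis
  proof (rule that[of u])
    fix s :: real
    have "quat_mult (quat_cnj (u s)) (u s) =
        (of_real ((cos s)\<^sup>2) + of_real ((sin s)\<^sup>2) * (cnj \<eta> * \<eta>), 0)"
      by (simp add: u_def quat_mult_def quat_cnj_def scaleR_conv_of_real power2_eq_square algebra_simps)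
    also have "\<dots> = (of_real ((cos s)\<^sup>2 + (sin s)\<^sup>2), 0)"
      unfolding n of_real_add by simp
    finally show "quat_unit (u s)" by (simp add: quat_unit_def)
    show "u 0 = (1, 0)" by (simp add: u_def)
    have "(u has_vector_derivative (cos 0 *\<^sub>R 0 + (- sin 0) *\<^sub>R (1, 0)) + (sin 0 *\<^sub>R 0 + cos 0 *\<^sub>R (0, \<eta>))) (at 0)"
      unfolding u_def
      by (intro has_vector_derivative_add has_vector_derivative_scaleR has_vector_derivative_const
          DERIV_cos DERIV_sin)
    then show "(u has_vector_derivative (0, \<eta>)) (at 0)" by simp
  qed
qed

lemma oct_of_imag_in_lie_algebra:
  assumes "norm \<eta> = 1 \<or> \<eta> = 0" "norm \<kappa> = 1 \<or> \<kappa> = 0"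
  shows "oct_of_imag (0, \<eta>) (0, \<kappa>) \<in> lie_algebra G2"
proof -
  obtain u where u: "\<And>s::real. quat_unit (u s)" "u 0 = (1, 0)" "(u has_vector_derivative (0, \<eta>)) (at 0)"
    using quat_unit_curve[OF assms(1)] by blast
  obtain v where v: "\<And>s::real. quat_unit (v s)" "v 0 = (1, 0)" "(v has_vector_derivative (0, \<kappa>)) (at 0)"
    using quat_unit_curve[OF assms(2)] by blast
  have cu: "((\<lambda>s. quat_cnj (u s)) has_vector_derivative quat_cnj (0, \<eta>)) (at 0)"
  proof (rule bounded_linear.has_vector_derivative[OF _ u(3)])
    show "bounded_linear quat_cnj"
      using linear_quat_cnj by (simp add: linear_conv_bounded_linear)
  qed
  have c1: "quat_cnj (1, 0) = (1, 0)" "quat_cnj (0, \<eta>) = (0, - \<eta>)" "quat_mult q (0, - \<eta>) = - quat_mult q (0, \<eta>)" for q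
    by (simp_all add: quat_cnj_def quat_mult_def)
  note prod = bounded_bilinear.has_vector_derivative[OF bounded_bilinear_quat_mult]
  have "((\<lambda>s. oct_of_units (u s) (v s)) has_vector_derivative oct_of_imag (0, \<eta>) (0, \<kappa>)) (at 0)"
  proof (rule blinfun_has_vector_derivative)
    fix x :: oct
    have "((\<lambda>s. quat_mult (quat_mult (u s) (fst x)) (quat_cnj (u s))) has_vector_derivative
        quat_mult (quat_mult (u 0) (fst x)) (quat_cnj (0, \<eta>)) +
        quat_mult (quat_mult (u 0) 0 + quat_mult (0, \<eta>) (fst x)) (quat_cnj (u 0))) (at 0)"
      by (intro prod u cu has_vector_derivative_const)
    moreover have "((\<lambda>s. quat_mult (quat_mult (v s) (snd x)) (quat_cnj (u s))) has_vector_derivative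
        quat_mult (quat_mult (v 0) (snd x)) (quat_cnj (0, \<eta>)) +
        quat_mult (quat_mult (v 0) 0 + quat_mult (0, \<kappa>) (snd x)) (quat_cnj (u 0))) (at 0)"
      by (intro prod v cu has_vector_derivative_const)
    ultimately show "((\<lambda>s. oct_of_units (u s) (v s) x) has_vector_derivative oct_of_imag (0, \<eta>) (0, \<kappa>) x) (at 0)"
      unfolding oct_of_units_apply oct_of_imag_apply
      by (intro has_vector_derivative_Pair)
         (simp_all add: u(2) v(2) c1 quat_mult_one quat_mult.zero_right)
  qed
  moreover have "oct_of_units (u 0) (v 0) = id_blinfun"
    by (rule blinfun_eqI) (simp add: oct_of_units_apply u v c1 quat_mult_one)
  ultimately show ?thesis
    unfolding lie_algebra_def using oct_of_units_in_G2[OF u(1) v(1)]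
    by (intro CollectI exI[of _ "\<lambda>s. oct_of_units (u s) (v s)"]) simp
qed

text \<open>When the torus rotates the complex parameter of a real-linear family \<open>F\<close> by
  a character, the pair \<open>F 1\<close>, \<open>- F \<i>\<close> is an eigenvector for it.
  Membership in \<open>lie_algebra G2\<close> is asked for on the unit circle, which contains the
  parameter of \<open>- F \<i>\<close>, so no closure under negation enters.\<close>

lemma oct_torus_rootI:
  assumes k: "k \<noteq> (0, 0)" and lie: "\<And>\<eta>. norm \<eta> = 1 \<Longrightarrow> F \<eta> \<in> lie_algebra G2"
    and add: "\<And>\<eta> r. F (of_real r * \<eta>) = r *\<^sub>R F \<eta>" "\<And>\<eta> \<zeta>. F (\<eta> + \<zeta>) = F \<eta> + F \<zeta>"
    and nz: "F 1 \<noteq> 0"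
    and ad: "\<And>z w \<eta>. norm z = 1 \<Longrightarrow> norm w = 1 \<Longrightarrow>
      oct_torus_elt z w o\<^sub>L F \<eta> o\<^sub>L oct_torus_elt (cnj z) (cnj w) = F (z powi fst k * w powi snd k * \<eta>)"
  shows "oct_torus_weight k \<in> roots G2 oct_torus"
  unfolding roots_def
proof (intro CollectI conjI)
  show "oct_torus_weight k \<in> weights oct_torus" by (rule oct_torus_weight_in)
  show "\<exists>t\<in>oct_torus. oct_torus_weight k t \<noteq> 1"
  proof (rule ccontr)
    assume "\<not> ?thesis"
    then have "oct_torus_weight k (oct_torus_elt z w) = oct_torus_weight (0, 0) (oct_torus_elt z w)"
      if "norm z = 1" "norm w = 1" for z w
    proof -
      have "oct_torus_elt z w \<in> oct_torus" unfolding in_oct_torus using that by blast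
      then have "oct_torus_weight k (oct_torus_elt z w) = 1"
        using \<open>\<not> (\<exists>t\<in>oct_torus. oct_torus_weight k t \<noteq> 1)\<close> by blast
      then show ?thesis using that by (simp add: oct_torus_weight_elt)
    qed
    then have "oct_torus_weight k = oct_torus_weight (0, 0)"
      by (intro weight_eqI oct_torus_weight_extensional)
    then show False using k inj_oct_torus_weight by (simp add: inj_eq)
  qed
  have split: "F m = Re m *\<^sub>R F 1 + Im m *\<^sub>R F \<i>" for m
    using add(2)[of "of_real (Re m) * 1" "of_real (Im m) * \<i>"] unfolding add(1)
    by (simp add: complex_eq[of m, symmetric] mult.commute)
  have "t o\<^sub>L F 1 o\<^sub>L op_inv t = Re (oct_torus_weight k t) *\<^sub>R F 1 - Im (oct_torus_weight k t) *\<^sub>R (- F \<i>) \<and>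
      t o\<^sub>L - F \<i> o\<^sub>L op_inv t = Im (oct_torus_weight k t) *\<^sub>R F 1 + Re (oct_torus_weight k t) *\<^sub>R (- F \<i>)"
    if "t \<in> oct_torus" for t
  proof -
    obtain z w where zw: "norm z = 1" "norm w = 1" "t = oct_torus_elt z w"
      using \<open>t \<in> oct_torus\<close> unfolding in_oct_torus by blast
    define m where "m = z powi fst k * w powi snd k"
    have m: "oct_torus_weight k t = m" using zw by (simp add: oct_torus_weight_elt m_def)
    have 1: "t o\<^sub>L F 1 o\<^sub>L op_inv t = F m" "t o\<^sub>L F \<i> o\<^sub>L op_inv t = F (m * \<i>)"
      using ad[OF zw(1,2)] zw by (simp_all add: op_inv_oct_torus_elt m_def)
    have "t o\<^sub>L - F \<i> o\<^sub>L op_inv t = - (t o\<^sub>L F \<i> o\<^sub>L op_inv t)"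
      by (rule blinfun_eqI) (simp add: blinfun.bilinear_simps)
    moreover have "F (m * \<i>) = - Im m *\<^sub>R F 1 + Re m *\<^sub>R F \<i>"
      using split[of "m * \<i>"] by simp
    ultimately show ?thesis
      unfolding 1 m using split[of m] by simp
  qed
  moreover have "F 1 \<in> lie_algebra G2" "- F \<i> \<in> lie_algebra G2"
    using lie[of 1] lie[of "- \<i>"] add(1)[of "-1" \<i>] by simp_all
  ultimately show "\<exists>X\<in>lie_algebra G2. \<exists>Y\<in>lie_algebra G2. (X \<noteq> 0 \<or> Y \<noteq> 0) \<and>
      (\<forall>t\<in>oct_torus.
        t o\<^sub>L X o\<^sub>L op_inv t = Re (oct_torus_weight k t) *\<^sub>R X - Im (oct_torus_weight k t) *\<^sub>R Y \<and>
        t o\<^sub>L Y o\<^sub>L op_inv t = Im (oct_torus_weight k t) *\<^sub>R X + Re (oct_torus_weight k t) *\<^sub>R Y)"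
    using nz by blast
qed

lemma oct_torus_short_root: "oct_torus_weight (1, 0) \<in> roots G2 oct_torus"
proof (rule oct_torus_rootI[where F = "\<lambda>\<eta>. oct_of_imag (0, \<eta>) (0, 0)"])
  show "oct_of_imag (0, 1) (0, 0) \<noteq> 0"
  proof
    assume "oct_of_imag (0, 1) (0, 0) = 0"
    then have "oct_of_imag (0, 1) (0, 0) oct_l = 0" by simp
    then show False by (simp add: oct_of_imag_apply quat_mult_def prod_eq_iff)
  qed
  fix z w \<eta> :: complex assume "norm z = 1" "norm w = 1"
  note unit = cnj_mult_unit(1)[OF this(1)] cnj_mult_unit(1)[OF this(2)]
  show "oct_torus_elt z w o\<^sub>L oct_of_imag (0, \<eta>) (0, 0) o\<^sub>L oct_torus_elt (cnj z) (cnj w) =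
      oct_of_imag (0, z powi fst (1, 0) * w powi snd (1, 0) * \<eta>) (0, 0)"
    by (intro blinfun_eqI oct_eqI;
        simp add: oct_torus_elt_apply oct_of_imag_apply quat_mult_def;
        (use unit in algebra | simp add: algebra_simps))
qed (auto intro!: blinfun_eqI oct_of_imag_in_lie_algebra
      simp: oct_of_imag_apply quat_mult_def scaleR_conv_of_real blinfun.bilinear_simps algebra_simps)

text \<open>The root vector acts on the second quaternion alone and interchanges its two coordinates
  up to conjugation. The torus factors \<open>w\<close> and \<open>z * w\<close> of these therefore
  multiply, which explains the exponents (1, 2).\<close>

lemma oct_torus_long_root: "oct_torus_weight (1, 2) \<in> roots G2 oct_torus"
proof (rule oct_torus_rootI[where F = "\<lambda>\<eta>. oct_of_imag (0, 0) (0, \<eta>)"])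
  show "oct_of_imag (0, 0) (0, 1) \<noteq> 0"
  proof
    assume "oct_of_imag (0, 0) (0, 1) = 0"
    then have "oct_of_imag (0, 0) (0, 1) oct_l = 0" by simp
    then show False by (simp add: oct_of_imag_apply quat_mult_def prod_eq_iff)
  qed
  fix z w \<eta> :: complex assume "norm z = 1" "norm w = 1"
  note unit = cnj_mult_unit(1)[OF this(1)] cnj_mult_unit(1)[OF this(2)]
  show "oct_torus_elt z w o\<^sub>L oct_of_imag (0, 0) (0, \<eta>) o\<^sub>L oct_torus_elt (cnj z) (cnj w) =
      oct_of_imag (0, 0) (0, z powi fst (1, 2) * w powi snd (1, 2) * \<eta>)"
    by (intro blinfun_eqI oct_eqI;
        simp add: oct_torus_elt_apply oct_of_imag_apply quat_mult_def power2_eq_square;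
        (use unit in algebra | simp add: algebra_simps))
qed (auto intro!: blinfun_eqI oct_of_imag_in_lie_algebra
      simp: oct_of_imag_apply quat_mult_def scaleR_conv_of_real blinfun.bilinear_simps algebra_simps)

text \<open>The complex vector given by \<open>(Y, X)\<close> is the imaginary unit times the
  conjugate of that given by \<open>(X, Y)\<close>. Swapping the pair thus conjugates the character
  without leaving \<open>lie_algebra G2\<close>.\<close>

lemma roots_oct_torus_uminus:
  assumes "oct_torus_weight k \<in> roots G2 oct_torus"
  shows "oct_torus_weight (- k) \<in> roots G2 oct_torus"
proof -
  have c: "oct_torus_weight (- k) t = cnj (oct_torus_weight k t)" if "t \<in> oct_torus" for t
    using that by (auto simp: in_oct_torus oct_torus_weight_elt power_int_minus inverse_unit
        power_int_inverse[symmetric])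
  obtain X Y where XY: "X \<in> lie_algebra G2" "Y \<in> lie_algebra G2" "X \<noteq> 0 \<or> Y \<noteq> 0"
    and ad: "\<And>t. t \<in> oct_torus \<Longrightarrow> t o\<^sub>L X o\<^sub>L op_inv t =
        Re (oct_torus_weight k t) *\<^sub>R X - Im (oct_torus_weight k t) *\<^sub>R Y"
      "\<And>t. t \<in> oct_torus \<Longrightarrow> t o\<^sub>L Y o\<^sub>L op_inv t =
        Im (oct_torus_weight k t) *\<^sub>R X + Re (oct_torus_weight k t) *\<^sub>R Y"
    using assms unfolding roots_def by blast
  have "\<exists>t\<in>oct_torus. oct_torus_weight (- k) t \<noteq> 1"
    using assms c by (auto simp: roots_def complex_cnj_one_iff)
  moreover have "\<forall>t\<in>oct_torus. t o\<^sub>L Y o\<^sub>L op_inv t =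
        Re (oct_torus_weight (- k) t) *\<^sub>R Y - Im (oct_torus_weight (- k) t) *\<^sub>R X \<and>
      t o\<^sub>L X o\<^sub>L op_inv t =
        Im (oct_torus_weight (- k) t) *\<^sub>R Y + Re (oct_torus_weight (- k) t) *\<^sub>R X"
    using ad c by simp
  ultimately show ?thesis
    unfolding roots_def using oct_torus_weight_in XY by blast
qed

section \<open>A symmetry of order three and the complete root system\<close>

definition oct_cycle :: "oct \<Rightarrow>\<^sub>L oct" where
  "oct_cycle = Blinfun (\<lambda>x. ((fst (fst x), cnj (snd (snd x))), (snd (fst x), cnj (fst (snd x)))))"

lemma oct_cycle_apply:
  "blinfun_apply oct_cycle x = ((fst (fst x), cnj (snd (snd x))), (snd (fst x), cnj (fst (snd x))))"
proof -
  have "linear (\<lambda>x::oct. ((fst (fst x), cnj (snd (snd x))), (snd (fst x), cnj (fst (snd x)))))"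
    by (rule linearI) simp_all
  then show ?thesis
    unfolding oct_cycle_def by (simp add: bounded_linear_Blinfun_apply linear_conv_bounded_linear)
qed

text \<open>In the complex coordinates \<open>b\<close>, \<open>c\<close>, \<open>cnj d\<close>, in
  which the torus is diagonal, this is a cyclic permutation; it has determinant one and so lies in
  SU(3).\<close>

lemma oct_cycle_in_G2: "oct_cycle \<in> G2"
proof (rule oct_alg_hom_in_G2)
  have "oct_cycle (oct_mult x y) = oct_mult (oct_cycle x) (oct_cycle y)" for x y
    by (rule oct_eqI) (simp_all add: oct_cycle_apply oct_simps algebra_simps)
  moreover have "oct_cycle oct_one = oct_one"
    by (simp add: oct_cycle_apply oct_one_def)
  ultimately show "oct_alg_hom oct_cycle"
    unfolding oct_alg_hom_def using linear_blinfun_apply by blast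
qed

lemma op_conj_eqI:
  fixes g s t :: "'v::euclidean_space \<Rightarrow>\<^sub>L 'v"
  assumes "bij (blinfun_apply g)" "\<And>x. blinfun_apply g (blinfun_apply t x) = blinfun_apply s (g x)"
  shows "op_conj g t = s"
  by (rule blinfun_eqI) (simp add: op_conj_apply assms)

lemma op_conj_oct_cycle:
  assumes "norm z = 1"
  shows "op_conj oct_cycle (oct_torus_elt z w) = oct_torus_elt (cnj (z * w)) z"
proof (rule op_conj_eqI[OF G2_bij[OF oct_cycle_in_G2]])
  have "cnj z * w * z = w" for w
    using cnj_mult_unit(1)[OF assms] by (simp add: mult_ac)
  then show "oct_cycle (oct_torus_elt z w x) = oct_torus_elt (cnj (z * w)) z (oct_cycle x)" for x
    by (simp add: oct_cycle_apply oct_torus_elt_apply)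
qed

lemma oct_cycle_normalizer: "oct_cycle \<in> normalizer G2 oct_torus"
proof -
  have "op_conj oct_cycle ` oct_torus = oct_torus"
  proof
    show "op_conj oct_cycle ` oct_torus \<subseteq> oct_torus"
    proof
      fix s assume "s \<in> op_conj oct_cycle ` oct_torus"
      then obtain t where "t \<in> oct_torus" "s = op_conj oct_cycle t" by blast
      then obtain z w where "norm z = 1" "norm w = 1" "s = op_conj oct_cycle (oct_torus_elt z w)"
        unfolding in_oct_torus by blast
      then show "s \<in> oct_torus"
        unfolding in_oct_torus
        by (intro exI[of _ "cnj (z * w)"] exI[of _ z]) (simp add: op_conj_oct_cycle norm_mult del: complex_cnj_mult)
    qed
    show "oct_torus \<subseteq> op_conj oct_cycle ` oct_torus"
    proof
      fix s assume "s \<in> oct_torus"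
      then obtain z w where zw: "norm z = 1" "norm w = 1" "s = oct_torus_elt z w"
        unfolding in_oct_torus by blast
      have "oct_torus_elt w (cnj (z * w)) \<in> oct_torus"
        unfolding in_oct_torus using zw by (intro exI[of _ w] exI[of _ "cnj (z * w)"]) (simp add: norm_mult)
      moreover have "cnj (w * cnj (z * w)) = z"
        using cnj_mult_unit(1)[OF zw(2)] by (simp add: mult_ac)
      then have "s = op_conj oct_cycle (oct_torus_elt w (cnj (z * w)))"
        by (simp only: op_conj_oct_cycle[OF zw(2)] zw(3))
      ultimately show "s \<in> op_conj oct_cycle ` oct_torus" by blast
    qed
  qed
  then show ?thesis using oct_cycle_in_G2 by (simp add: normalizer_iff)
qed

lemma weyl_act_oct_cycle:
  "weyl_act oct_torus oct_cycle (oct_torus_weight k) = oct_torus_weight (- snd k, fst k - snd k)"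
proof (rule weight_eqI)
  show "weyl_act oct_torus oct_cycle (oct_torus_weight k) \<in> extensional oct_torus"
    by (simp add: weyl_act_def)
  fix z w :: complex assume n: "norm z = 1" "norm w = 1"
  have nz: "z \<noteq> 0" "w \<noteq> 0" using n by auto
  have im: "op_conj oct_cycle ` oct_torus = oct_torus"
    using oct_cycle_normalizer by (simp add: normalizer_iff)
  have n': "norm (cnj (z * w)) = 1" using n by (simp add: norm_mult)
  have t: "oct_torus_elt w (cnj (z * w)) \<in> oct_torus"
    unfolding in_oct_torus using n n' by blast
  have "cnj (w * cnj (z * w)) = z"
    using cnj_mult_unit(1)[OF n(2)] by (simp add: mult_ac)
  then have "op_conj oct_cycle (oct_torus_elt w (cnj (z * w))) = oct_torus_elt z w"
    by (simp only: op_conj_oct_cycle[OF n(2)])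
  then have "weyl_act oct_torus oct_cycle (oct_torus_weight k) (oct_torus_elt z w) =
      oct_torus_weight k (oct_torus_elt w (cnj (z * w)))"
    using weyl_act_op_conj[OF G2_bij[OF oct_cycle_in_G2] t, of "oct_torus_weight k"] by (simp add: im)
  also have "\<dots> = w powi fst k * inverse (z * w) powi snd k"
    using n n' by (simp only: oct_torus_weight_elt inverse_unit[of "z * w"] norm_mult mult_1)
  also have "\<dots> = z powi (- snd k) * w powi (fst k - snd k)"
    using nz by (simp add: power_int_diff power_int_minus power_int_inverse power_int_mult_distrib field_simps)
  finally show "weyl_act oct_torus oct_cycle (oct_torus_weight k) (oct_torus_elt z w) =
      oct_torus_weight (- snd k, fst k - snd k) (oct_torus_elt z w)"
    using n by (simp add: oct_torus_weight_elt)
qed (rule oct_torus_weight_extensional)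

text \<open>One short and one long root, moved by the cycle of order three and by negation, give all
  twelve.\<close>

lemma roots_oct_torus: "roots G2 oct_torus = oct_torus_weight ` g2_roots"
proof (rule antisym[OF roots_oct_torus_subset])
  have lg: "linear_group oct_torus" using torus_oct_torus by (simp add: torus_def)
  have im: "op_conj oct_cycle ` oct_torus = oct_torus"
    using oct_cycle_normalizer by (simp add: normalizer_iff)
  have cyc: "oct_torus_weight (- l, k - l) \<in> roots G2 oct_torus"
    if "oct_torus_weight (k, l) \<in> roots G2 oct_torus" for k l
    using roots_op_conj[OF linear_group_G2 oct_cycle_in_G2 lg that] by (simp add: im weyl_act_oct_cycle)
  have neg: "oct_torus_weight (- k, - l) \<in> roots G2 oct_torus"
    if "oct_torus_weight (k, l) \<in> roots G2 oct_torus" for k l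
    using roots_oct_torus_uminus[OF that] by simp
  note short = oct_torus_short_root cyc[OF oct_torus_short_root] cyc[OF cyc[OF oct_torus_short_root]]
  note long = oct_torus_long_root cyc[OF oct_torus_long_root] cyc[OF cyc[OF oct_torus_long_root]]
  show "oct_torus_weight ` g2_roots \<subseteq> roots G2 oct_torus"
    using short short[THEN neg] long long[THEN neg] by (simp add: g2_roots_def)
qed

text \<open>All that the lattice count takes from the group: integer coordinates on the weights, the
  roots in them, and one Weyl group element.\<close>

theorem maximal_torus_G2_weights:
  assumes "maximal_torus G2 T"
  obtains \<omega> n where "bij_betw \<omega> UNIV (weights T)"
    "\<And>a b. weight_add T (\<omega> a) (\<omega> b) = \<omega> (a + b)"
    "roots G2 T = \<omega> ` g2_roots" "n \<in> normalizer G2 T"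
    "\<And>k. weyl_act T n (\<omega> k) = \<omega> (- snd k, fst k - snd k)"
proof -
  obtain g where g: "g \<in> G2" "T = op_conj g ` oct_torus"
    using maximal_torus_G2_conjugate[OF assms] by blast
  have lg: "linear_group oct_torus" using torus_oct_torus by (simp add: torus_def)
  note b = G2_bij[OF g(1)]
  define \<omega> where "\<omega> = weyl_act T g \<circ> oct_torus_weight"
  show ?thesis
  proof (rule that[of \<omega> "op_conj g oct_cycle"])
    have "bij_betw oct_torus_weight UNIV (weights oct_torus)"
      using inj_oct_torus_weight weights_oct_torus by (simp add: bij_betw_def)
    then show "bij_betw \<omega> UNIV (weights T)"
      unfolding \<omega>_def g(2) using bij_betw_weights_op_conj[OF b lg] by (rule bij_betw_trans)
    show "weight_add T (\<omega> a) (\<omega> b) = \<omega> (a + b)" for a b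
      using weyl_act_weight_add[OF b, of oct_torus "oct_torus_weight a" "oct_torus_weight b"]
      by (simp add: \<omega>_def g(2) weight_add_oct_torus)
    show "roots G2 T = \<omega> ` g2_roots"
      using roots_op_conj_image[OF linear_group_G2 g(1) lg]
      by (simp add: \<omega>_def g(2) roots_oct_torus image_comp)
    note n = normalizer_op_conj[OF linear_group_G2 g(1) oct_cycle_normalizer]
    show "op_conj g oct_cycle \<in> normalizer G2 T" using n(1) g(2) by simp
    show "weyl_act T (op_conj g oct_cycle) (\<omega> k) = \<omega> (- snd k, fst k - snd k)" for k
      using n(2)[of "oct_torus_weight k"] by (simp add: \<omega>_def g(2) weyl_act_oct_cycle)
  qed
qed

section \<open>The lattice count\<close>

lemma denom_power_iff:
  assumes "prime p"
  shows "denom_power p x \<longleftrightarrow> (\<exists>s. \<exists>n::int. x * real p ^ s = of_int n)"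
proof
  assume "denom_power p x"
  then obtain q k where q: "x = of_rat q" "snd (quotient_of q) = int p ^ k"
    unfolding denom_power_def by blast
  obtain a b where ab: "quotient_of q = (a, b)" by fastforce
  have "x = of_int a / of_int b"
    using q(1) quotient_of_div[OF ab] by (simp add: of_rat_divide)
  moreover have "real_of_int b = real p ^ k" using q(2) ab by simp
  ultimately have "x * real p ^ k = of_int a"
    using assms prime_gt_0_nat by simp
  then show "\<exists>s. \<exists>n::int. x * real p ^ s = of_int n" by blast
next
  assume "\<exists>s. \<exists>n::int. x * real p ^ s = of_int n"
  then obtain s and n :: int where n: "x * real p ^ s = of_int n" by blast
  have p: "0 < p" using assms prime_gt_0_nat by blast
  define q where "q = Fract n (int p ^ s)"
  have x: "x = of_rat q"
    using n p by (simp add: q_def Fract_of_int_quotient of_rat_divide of_rat_power field_simps)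
  \<comment> \<open>The reduced denominator divides a prime power and is hence a power of the same
    prime.\<close>
  have "snd (quotient_of q) = int p ^ s div gcd n (int p ^ s)"
    using p by (simp add: q_def quotient_of_Fract normalize_def Let_def)
  then have d: "snd (quotient_of q) dvd int p ^ s"
    by (metis dvd_triv_right dvd_mult_div_cancel gcd_dvd2)
  have "0 < snd (quotient_of q)" by (rule quotient_of_denom_pos')
  then have "nat (snd (quotient_of q)) dvd p ^ s"
    using d by (metis int_dvd_int_iff int_nat_eq less_imp_le of_nat_power)
  then obtain k where "nat (snd (quotient_of q)) = p ^ k"
    using divides_primepow_nat[OF assms] by blast
  then have "snd (quotient_of q) = int p ^ k"
    using \<open>0 < snd (quotient_of q)\<close> by (metis int_nat_eq less_imp_le of_nat_power)
  then show "denom_power p x" using x unfolding denom_power_def by blast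
qed

text \<open>\<open>d\<close> is the part of \<open>3 * m\<close> prime to \<open>p\<close>, which
  has to cancel against \<open>c\<close>. The 3 is there because weights pair in thirds.\<close>

lemma denom_power_div_iff:
  fixes c :: int
  assumes p: "prime p" and m: "m = p ^ i * m'" "\<not> p dvd m'"
    and d: "d = (if p = 3 then int m' else 3 * int m')"
  shows "denom_power p (of_int c / (3 * real m)) \<longleftrightarrow> d dvd c"
proof -
  have pos: "0 < p" "0 < m'" using p prime_gt_0_nat m(2) by (auto intro: Nat.gr0I)
  have cop: "coprime d (int p ^ s)" for s
  proof -
    have "coprime p m'" using p m(2) by (simp add: prime_imp_coprime)
    moreover have "coprime p 3" if "p \<noteq> 3"
      using that p primes_coprime[of p 3] by simp
    ultimately have "coprime (nat d) (p ^ s)"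
      by (auto simp: d nat_mult_distrib coprime_commute)
    then show ?thesis using coprime_int_iff[of "nat d" "p ^ s"] by (simp add: d split: if_splits)
  qed
  have "denom_power p (of_int c / (3 * real m)) \<longleftrightarrow> (\<exists>s. 3 * int m dvd c * int p ^ s)"
  proof -
    have "of_int c / (3 * real m) * real p ^ s = of_int n \<longleftrightarrow> c * int p ^ s = 3 * int m * n" for s n
    proof -
      have "of_int c / (3 * real m) * real p ^ s = of_int n \<longleftrightarrow>
          real_of_int (c * int p ^ s) = of_int (3 * int m * n)"
        using pos m(1) by (simp add: field_simps)
      then show ?thesis by (simp only: of_int_eq_iff)
    qed
    then show ?thesis unfolding denom_power_iff[OF p] dvd_def by simp
  qed
  also have "\<dots> \<longleftrightarrow> d dvd c"
  proof
    assume "\<exists>s. 3 * int m dvd c * int p ^ s"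
    then obtain s where "3 * int m dvd c * int p ^ s" by blast
    moreover have "d dvd 3 * int m" using m(1) by (simp add: d)
    ultimately have "d dvd c * int p ^ s" by (rule dvd_trans[rotated])
    then show "d dvd c" using cop[of s] by (simp add: coprime_dvd_mult_left_iff)
  next
    assume "d dvd c"
    \<comment> \<open>The exponent exceeds \<open>i\<close> by one so that for \<open>p = 3\<close>
      the additional factor supplies the 3 in \<open>3 * m\<close>.\<close>
    moreover have "d * int p ^ (i + 1) = 3 * int m * (if p = 3 then 1 else int p)"
      using m(1) by (simp add: d)
    then have "3 * int m dvd d * int p ^ (i + 1)"
      by (rule dvdI)
    ultimately have "3 * int m dvd c * int p ^ (i + 1)"
      by (meson dvd_trans mult_dvd_mono dvd_refl)
    then show "\<exists>s. 3 * int m dvd c * int p ^ s" by blast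
  qed
  finally show ?thesis .
qed

text \<open>The two divisibilities combine to \<open>d dvd 3 * k\<close> and
  \<open>d dvd 3 * l\<close>, which makes \<open>k\<close> and \<open>l\<close> multiples of
  \<open>m'\<close>. Dividing by \<open>m'\<close> turns the bound \<open>m\<close> into
  \<open>p ^ i\<close> and leaves a congruence modulo 3 exactly when \<open>p\<close> is not
  3.\<close>

lemma card_hexagonal_solutions:
  fixes m' p i m :: nat
  assumes p: "prime p" and m: "m = p ^ i * m'" "\<not> p dvd m'"
    and d: "d = (if p = 3 then int m' else 3 * int m')"
  shows "card {(k :: int, l :: int). 2 * l > k \<and> k > l \<and> k < int m \<and> d dvd 2 * k - l \<and> d dvd 2 * l - k} =
    card {(b1 :: int, b2 :: int). 2 * b2 > b1 \<and> b1 > b2 \<and> b2 > 0 \<and> int p ^ i > b1 \<and>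
      (p \<noteq> 3 \<longrightarrow> 3 dvd (b1 + b2))}"
    (is "card ?K = card ?B")
proof -
  have m'0: "0 < int m'" using m(2) by (auto intro: Nat.gr0I)
  have cop: "coprime (int m') 3" if "p = 3"
  proof -
    have "coprime (3::nat) m'" using p m(2) that by (simp add: prime_imp_coprime)
    then show ?thesis using coprime_int_iff[of m' 3] by (simp add: coprime_commute)
  qed
  have scale: "d dvd 2 * (int m' * b1) - int m' * b2 \<and> d dvd 2 * (int m' * b2) - int m' * b1 \<longleftrightarrow>
      (p \<noteq> 3 \<longrightarrow> 3 dvd b1 + b2)" for b1 b2
  proof (cases "p = 3")
    case True
    then show ?thesis by (simp add: d)
  next
    case False
    have *: "d dvd 2 * (int m' * x) - int m' * y \<longleftrightarrow> 3 dvd 2 * x - y" for x y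
    proof -
      have "2 * (int m' * x) - int m' * y = int m' * (2 * x - y)" by (simp add: algebra_simps)
      moreover have "d = int m' * 3" using False by (simp add: d)
      ultimately show ?thesis using m'0 by simp
    qed
    \<comment> \<open>Modulo 3 both differences are the negative of \<open>b1 + b2\<close>.\<close>
    have "(3 dvd 2 * b1 - b2 \<and> 3 dvd 2 * b2 - b1) = (3 dvd b1 + b2)" by presburger
    then show ?thesis using False by (simp add: *)
  qed
  have "bij_betw (\<lambda>(b1, b2). (int m' * b1, int m' * b2)) ?B ?K"
    unfolding bij_betw_def
  proof
    show "inj_on (\<lambda>(b1, b2). (int m' * b1, int m' * b2)) ?B"
      using m'0 by (auto simp: inj_on_def)
    \<comment> \<open>Positivity of \<open>b2\<close> results from \<open>2 * b2 > b1\<close>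
      together with \<open>b1 > b2\<close>.\<close>
    have ineq: "2 * (int m' * b2) > int m' * b1 \<and> int m' * b1 > int m' * b2 \<and> int m' * b1 < int m \<longleftrightarrow>
        2 * b2 > b1 \<and> b1 > b2 \<and> b2 > 0 \<and> int p ^ i > b1" for b1 b2
    proof -
      have "2 * (int m' * b2) > int m' * b1 \<longleftrightarrow> 2 * b2 > b1"
        using m'0 mult_less_cancel_left_pos[of "int m'" b1 "2 * b2"] by (simp add: mult_ac)
      moreover have "int m' * b1 > int m' * b2 \<longleftrightarrow> b1 > b2" using m'0 by simp
      moreover have "int m' * b1 < int m \<longleftrightarrow> b1 < int p ^ i"
        using m'0 mult_less_cancel_left_pos[of "int m'" b1 "int p ^ i"] m(1) by (simp add: mult_ac)
      ultimately show ?thesis by linarith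
    qed
    show "(\<lambda>(b1, b2). (int m' * b1, int m' * b2)) ` ?B = ?K"
    proof
      show "(\<lambda>(b1, b2). (int m' * b1, int m' * b2)) ` ?B \<subseteq> ?K"
        using ineq scale by force
      show "?K \<subseteq> (\<lambda>(b1, b2). (int m' * b1, int m' * b2)) ` ?B"
      proof
        fix x assume "x \<in> ?K"
        then obtain k l where x: "x = (k, l)" and kl: "2 * l > k" "k > l" "k < int m"
          and dv: "d dvd 2 * k - l" "d dvd 2 * l - k" by auto
        have "d dvd 2 * (2 * k - l) + (2 * l - k)" "d dvd 2 * (2 * l - k) + (2 * k - l)"
          using dv by (simp_all only: dvd_add dvd_mult)
        then have d3: "d dvd 3 * k" "d dvd 3 * l" by (simp_all add: algebra_simps)
        have "int m' dvd k \<and> int m' dvd l"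
        proof (cases "p = 3")
          case True
          then show ?thesis using d3 cop by (simp add: d coprime_dvd_mult_right_iff)
        next
          case False
          then show ?thesis using d3 by (simp add: d)
        qed
        then obtain b1 b2 where b: "k = int m' * b1" "l = int m' * b2" by (auto simp: dvd_def)
        have "(b1, b2) \<in> ?B"
          using kl dv ineq[of b1 b2] scale[of b1 b2] unfolding b by simp
        then show "x \<in> (\<lambda>(b1, b2). (int m' * b1, int m' * b2)) ` ?B"
          unfolding x b by force
      qed
    qed
  qed
  then show ?thesis by (simp add: bij_betw_same_card)
qed

section \<open>Hexagonal bases, positive systems and the alcove\<close>

definition int_comb :: "'e::real_vector \<Rightarrow> 'e \<Rightarrow> int \<times> int \<Rightarrow> 'e" where
  "int_comb A B k = of_int (fst k) *\<^sub>R A + of_int (snd k) *\<^sub>R B"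

lemma int_comb_of_additive:
  fixes h :: "int \<times> int \<Rightarrow> 'e::real_vector"
  assumes add: "\<And>a b. h (a + b) = h a + h b"
  shows "h k = int_comb (h (1, 0)) (h (0, 1)) k"
proof -
  have zero: "h (0, 0) = 0" using add[of "(0, 0)" "(0, 0)"] by simp
  have neg: "h (- a, - b) = - h (a, b)" for a b
    using add[of "(a, b)" "(- a, - b)"] zero by (simp add: add_eq_0_iff)
  have fstn: "h (int n, 0) = of_int (int n) *\<^sub>R h (1, 0)" for n
  proof (induction n)
    case (Suc n)
    then show ?case using add[of "(1, 0)" "(int n, 0)"] by (simp add: algebra_simps)
  qed (simp add: zero)
  have sndn: "h (0, int n) = of_int (int n) *\<^sub>R h (0, 1)" for n
  proof (induction n)
    case (Suc n)
    then show ?case using add[of "(0, 1)" "(0, int n)"] by (simp add: algebra_simps)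
  qed (simp add: zero)
  have "h (i, 0) = of_int i *\<^sub>R h (1, 0)" for i
    using fstn[of "nat i"] fstn[of "nat (- i)"] neg[of i 0] by (cases "0 \<le> i") simp_all
  note fst_eq = this[of "fst k"]
  have "h (0, i) = of_int i *\<^sub>R h (0, 1)" for i
    using sndn[of "nat i"] sndn[of "nat (- i)"] neg[of 0 i] by (cases "0 \<le> i") simp_all
  note snd_eq = this[of "snd k"]
  show ?thesis
    using add[of "(fst k, 0)" "(0, snd k)"] unfolding int_comb_def fst_eq snd_eq by simp
qed

text \<open>\<open>A\<close> and \<open>B\<close> are short roots at an angle of 120 degrees; \<open>L\<close> is the weight lattice and \<open>\<Phi>\<close> the root system.\<close>

definition g2_basis :: "'e::euclidean_space set \<Rightarrow> 'e set \<Rightarrow> 'e \<Rightarrow> 'e \<Rightarrow> bool" where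
  "g2_basis L \<Phi> A B \<longleftrightarrow> A \<bullet> A = 2 / 3 \<and> B \<bullet> B = 2 / 3 \<and> A \<bullet> B = - (1 / 3) \<and>
     L = range (int_comb A B) \<and> \<Phi> = int_comb A B ` g2_roots"

lemma g2_basis_change:
  assumes "g2_basis L \<Phi> A B" "surj f" "f ` g2_roots = g2_roots"
    and "\<And>k. int_comb A' B' k = int_comb A B (f k)"
    and "A' \<bullet> A' = 2 / 3" "B' \<bullet> B' = 2 / 3" "A' \<bullet> B' = - (1 / 3)"
  shows "g2_basis L \<Phi> A' B'"
proof -
  have "int_comb A' B' = int_comb A B \<circ> f" using assms(4) by auto
  then have "range (int_comb A' B') = range (int_comb A B)"
    "int_comb A' B' ` g2_roots = int_comb A B ` g2_roots"
    using assms(2,3) by (metis image_comp)+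
  then show ?thesis using assms unfolding g2_basis_def by simp
qed

text \<open>The swap, the negation and the cycle of the next two lemmas generate the dihedral group
  of order 12, the Weyl group, which permutes the chambers simply transitively.\<close>

lemma g2_basis_swap:
  assumes "g2_basis L \<Phi> A B"
  shows "g2_basis L \<Phi> B A"
proof (rule g2_basis_change[OF assms, where f = "\<lambda>k. (snd k, fst k)"])
  show "surj (\<lambda>k :: int \<times> int. (snd k, fst k))"
    by (rule surjI[where f = "\<lambda>k. (snd k, fst k)"]) simp
  show "(\<lambda>k. (snd k, fst k)) ` g2_roots = g2_roots"
    by (auto simp: g2_roots_def)
qed (use assms in \<open>simp_all add: g2_basis_def int_comb_def inner_commute\<close>)

lemma g2_basis_uminus:
  assumes "g2_basis L \<Phi> A B"
  shows "g2_basis L \<Phi> (- A) (- B)"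
proof (rule g2_basis_change[OF assms, where f = "\<lambda>k. (- fst k, - snd k)"])
  show "surj (\<lambda>k :: int \<times> int. (- fst k, - snd k))"
    by (rule surjI[where f = "\<lambda>k. (- fst k, - snd k)"]) simp
  show "(\<lambda>k. (- fst k, - snd k)) ` g2_roots = g2_roots"
    by (auto simp: g2_roots_def)
qed (use assms in \<open>simp_all add: g2_basis_def int_comb_def\<close>)

lemma g2_basis_cycle:
  assumes "g2_basis L \<Phi> A B"
  shows "g2_basis L \<Phi> B (- A - B)"
proof (rule g2_basis_change[OF assms, where f = "\<lambda>k. (- snd k, fst k - snd k)"])
  show "surj (\<lambda>k :: int \<times> int. (- snd k, fst k - snd k))"
    by (rule surjI[where f = "\<lambda>k. (snd k - fst k, - fst k)"]) simp
  show "(\<lambda>k. (- snd k, fst k - snd k)) ` g2_roots = g2_roots"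
    by (auto simp: g2_roots_def)
qed (use assms in \<open>simp_all add: g2_basis_def int_comb_def inner_simps inner_commute algebra_simps\<close>)

text \<open>The short roots \<open>A\<close>, \<open>B\<close> and \<open>- A - B\<close> have sum
  zero, so the values of \<open>v\<close> on two of them share a sign opposite to the third; on the
  differences, which are long roots, \<open>v\<close> does not vanish. Choosing that pair, its sign
  and its order accounts for the twelve cases.\<close>

lemma g2_basis_dominant:
  assumes AB: "g2_basis L \<Phi> A B" and v: "\<forall>\<alpha>\<in>\<Phi>. v \<bullet> \<alpha> \<noteq> 0"
  obtains A' B' where "g2_basis L \<Phi> A' B'" "v \<bullet> B' > 0" "v \<bullet> A' > v \<bullet> B'"
proof -
  define x y where "x = v \<bullet> A" and "y = v \<bullet> B"
  have r: "v \<bullet> int_comb A B k = of_int (fst k) * x + of_int (snd k) * y" for k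
    by (simp add: int_comb_def inner_add_right x_def y_def)
  have "of_int (fst k) * x + of_int (snd k) * y \<noteq> 0" if "k \<in> g2_roots" for k
    using v that AB unfolding g2_basis_def r[symmetric] by blast
  from this[of "(1, 0)"] this[of "(0, 1)"] this[of "(1, 1)"] this[of "(1, -1)"] this[of "(1, 2)"] this[of "(2, 1)"]
  have nz: "x \<noteq> 0" "y \<noteq> 0" "x + y \<noteq> 0" "x \<noteq> y" "x + 2 * y \<noteq> 0" "2 * x + y \<noteq> 0"
    by (simp_all add: g2_roots_def)
  note c1 = g2_basis_cycle[OF AB] and c2 = g2_basis_cycle[OF g2_basis_cycle[OF AB]]
  have C: "v \<bullet> (- A - B) = - x - y" "v \<bullet> (- B - (- A - B)) = x"
    by (simp_all add: inner_diff_right x_def y_def)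
  note defs = x_def[symmetric] y_def[symmetric]
  have "0 < y \<and> y < x \<or> 0 < x \<and> x < y \<or> 0 < - x - y \<and> - x - y < y \<or> 0 < y \<and> y < - x - y \<or>
      0 < x \<and> x < - x - y \<or> 0 < - x - y \<and> - x - y < x \<or>
      0 < - y \<and> - y < - x \<or> 0 < - x \<and> - x < - y \<or> 0 < x + y \<and> x + y < - y \<or> 0 < - y \<and> - y < x + y \<or>
      0 < - x \<and> - x < x + y \<or> 0 < x + y \<and> x + y < - x"
    using nz by (smt (verit))
  then show ?thesis
  proof (elim disjE)
    assume "0 < y \<and> y < x" then show ?thesis using that[OF AB] by (simp add: defs)
  next
    assume "0 < x \<and> x < y" then show ?thesis using that[OF g2_basis_swap[OF AB]] by (simp add: defs)
  next
    assume "0 < - x - y \<and> - x - y < y" then show ?thesis using that[OF c1] by (simp add: defs C)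
  next
    assume "0 < y \<and> y < - x - y" then show ?thesis using that[OF g2_basis_swap[OF c1]] by (simp add: defs C)
  next
    assume "0 < x \<and> x < - x - y" then show ?thesis using that[OF c2] unfolding C by simp
  next
    assume "0 < - x - y \<and> - x - y < x" then show ?thesis using that[OF g2_basis_swap[OF c2]] unfolding C by simp
  next
    assume "0 < - y \<and> - y < - x" then show ?thesis using that[OF g2_basis_uminus[OF AB]] by (simp add: defs)
  next
    assume "0 < - x \<and> - x < - y" then show ?thesis
      using that[OF g2_basis_uminus[OF g2_basis_swap[OF AB]]] by (simp add: defs)
  next
    assume "0 < x + y \<and> x + y < - y" then show ?thesis
      using that[OF g2_basis_uminus[OF c1]] unfolding inner_minus_right C defs by simp
  next
    assume "0 < - y \<and> - y < x + y" then show ?thesis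
      using that[OF g2_basis_uminus[OF g2_basis_swap[OF c1]]] unfolding inner_minus_right C defs by simp
  next
    assume "0 < - x \<and> - x < x + y" then show ?thesis
      using that[OF g2_basis_uminus[OF c2]] unfolding inner_minus_right C by simp
  next
    assume "0 < x + y \<and> x + y < - x" then show ?thesis
      using that[OF g2_basis_uminus[OF g2_basis_swap[OF c2]]] unfolding inner_minus_right C by simp
  qed
qed

lemma g2_positive_roots:
  assumes AB: "g2_basis L \<Phi> A B" and v: "v \<bullet> B > 0" "v \<bullet> A > v \<bullet> B"
  shows "{\<alpha>\<in>\<Phi>. v \<bullet> \<alpha> > 0} = {A, B, A + B, A - B, A + 2 *\<^sub>R B, 2 *\<^sub>R A + B}"
proof -
  have \<Phi>: "\<Phi> = {A, B, - A - B, - A, - B, A + B, A - B, A + 2 *\<^sub>R B, - 2 *\<^sub>R A - B, B - A, - A - 2 *\<^sub>R B, 2 *\<^sub>R A + B}"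
    using AB by (simp add: g2_basis_def g2_roots_def int_comb_def)
  show ?thesis
    unfolding \<Phi> using v by (auto simp: inner_simps)
qed

text \<open>A nonnegative combination of positive roots pairs nonnegatively with \<open>v\<close>.
  Comparison with the single root \<open>2 *\<^sub>R A + B\<close>, the strict maximiser of
  \<open>v\<close> among the roots, identifies \<open>\<theta>\<close>.\<close>

lemma g2_highest_root:
  assumes AB: "g2_basis L \<Phi> A B" and v: "v \<bullet> B > 0" "v \<bullet> A > v \<bullet> B"
    and \<theta>: "highest_root \<Phi> {\<alpha>\<in>\<Phi>. v \<bullet> \<alpha> > 0} \<theta>"
  shows "\<theta> = 2 *\<^sub>R A + B"
proof -
  have \<Phi>: "\<Phi> = {A, B, - A - B, - A, - B, A + B, A - B, A + 2 *\<^sub>R B, - 2 *\<^sub>R A - B, B - A, - A - 2 *\<^sub>R B, 2 *\<^sub>R A + B}"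
    using AB by (simp add: g2_basis_def g2_roots_def int_comb_def)
  have "\<theta> \<in> \<Phi>" using \<theta> by (simp add: highest_root_def)
  obtain c :: "'a \<Rightarrow> nat" where "\<theta> - (2 *\<^sub>R A + B) = (\<Sum>\<alpha>\<in>{\<alpha>\<in>\<Phi>. v \<bullet> \<alpha> > 0}. of_nat (c \<alpha>) *\<^sub>R \<alpha>)"
    using \<theta> unfolding highest_root_def \<Phi> by blast
  then have "v \<bullet> (\<theta> - (2 *\<^sub>R A + B)) = (\<Sum>\<alpha>\<in>{\<alpha>\<in>\<Phi>. v \<bullet> \<alpha> > 0}. of_nat (c \<alpha>) * (v \<bullet> \<alpha>))"
    by (simp add: inner_sum_right)
  also have "\<dots> \<ge> 0" by (intro sum_nonneg) simp
  finally have ge: "v \<bullet> \<theta> \<ge> 2 * (v \<bullet> A) + v \<bullet> B" by (simp add: inner_simps)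
  then show ?thesis
    using \<open>\<theta> \<in> \<Phi>\<close> v unfolding \<Phi> by (auto simp: inner_simps)
qed

text \<open>The simple roots are \<open>B\<close> and \<open>A - B\<close>, and the other positive
  roots are nonnegative combinations of them. Three half-spaces with nonzero normals remain, whose
  interiors are the strict inequalities.\<close>

lemma interior_g2_alcove:
  assumes AB: "g2_basis L \<Phi> A B"
  shows "interior (alcove {A, B, A + B, A - B, A + 2 *\<^sub>R B, 2 *\<^sub>R A + B} (2 *\<^sub>R A + B) m) =
    {x. x \<bullet> B > 0 \<and> x \<bullet> (A - B) > 0 \<and> x \<bullet> (2 *\<^sub>R A + B) < real m}"
proof -
  have g: "A \<bullet> A = 2 / 3" "B \<bullet> B = 2 / 3" "A \<bullet> B = - (1 / 3)" "B \<bullet> A = - (1 / 3)"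
    using AB by (simp_all add: g2_basis_def inner_commute)
  have eq: "alcove {A, B, A + B, A - B, A + 2 *\<^sub>R B, 2 *\<^sub>R A + B} (2 *\<^sub>R A + B) m =
      {x. B \<bullet> x \<ge> 0} \<inter> {x. (A - B) \<bullet> x \<ge> 0} \<inter> {x. (2 *\<^sub>R A + B) \<bullet> x \<le> real m}"
    by (auto simp: alcove_def weyl_chamber_def inner_simps inner_commute)
  have "(A - B) \<bullet> (A - B) = 2" "(2 *\<^sub>R A + B) \<bullet> (2 *\<^sub>R A + B) = 2"
    by (simp_all add: inner_simps g)
  then have nz: "B \<noteq> 0" "A - B \<noteq> 0" "2 *\<^sub>R A + B \<noteq> 0"
    using g(2) by (metis inner_zero_left zero_neq_numeral divide_eq_0_iff)+
  show ?thesis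
    unfolding eq interior_Int interior_halfspace_ge[OF nz(1)] interior_halfspace_ge[OF nz(2)]
      interior_halfspace_le[OF nz(3)]
    by (auto simp: inner_commute)
qed

theorem card_g2_lattice_points:
  fixes \<Phi> :: "'e::euclidean_space set"
  assumes AB0: "g2_basis L \<Phi> A0 B0" and P: "positive_system \<Phi> P" and \<theta>: "highest_root \<Phi> P \<theta>"
    and p: "prime p" and m: "m = p ^ i * m'" "\<not> p dvd m'"
  shows "card {x \<in> L. x \<in> interior (alcove P \<theta> m) \<and> (\<forall>y\<in>L. denom_power p ((y \<bullet> x) / real m))} =
    card {(b1 :: int, b2 :: int). 2 * b2 > b1 \<and> b1 > b2 \<and> b2 > 0 \<and> int p ^ i > b1 \<and>
      (p \<noteq> 3 \<longrightarrow> 3 dvd (b1 + b2))}"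
proof -
  obtain v where v: "\<forall>\<alpha>\<in>\<Phi>. v \<bullet> \<alpha> \<noteq> 0" "P = {\<alpha>\<in>\<Phi>. v \<bullet> \<alpha> > 0}"
    using P unfolding positive_system_def by blast
  obtain A B where AB: "g2_basis L \<Phi> A B" and vAB: "v \<bullet> B > 0" "v \<bullet> A > v \<bullet> B"
    using g2_basis_dominant[OF AB0 v(1)] by blast
  have \<theta>_eq: "\<theta> = 2 *\<^sub>R A + B" using g2_highest_root[OF AB vAB] \<theta> v(2) by simp
  have P_eq: "P = {A, B, A + B, A - B, A + 2 *\<^sub>R B, 2 *\<^sub>R A + B}"
    using g2_positive_roots[OF AB vAB] v(2) by simp
  have g: "A \<bullet> A = 2 / 3" "B \<bullet> B = 2 / 3" "A \<bullet> B = - (1 / 3)" "B \<bullet> A = - (1 / 3)"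
    and L: "L = range (int_comb A B)"
    using AB by (simp_all add: g2_basis_def inner_commute)
  have iA: "int_comb A B k \<bullet> A = of_int (2 * fst k - snd k) / 3"
    and iB: "int_comb A B k \<bullet> B = of_int (2 * snd k - fst k) / 3" for k
    by (simp_all add: int_comb_def inner_simps g field_simps)
  have inj: "inj (int_comb A B)"
  proof (rule injI)
    fix k l assume "int_comb A B k = int_comb A B l"
    then have "real_of_int (2 * fst k - snd k) = of_int (2 * fst l - snd l)"
      "real_of_int (2 * snd k - fst k) = of_int (2 * snd l - fst l)"
      using iA[of k] iA[of l] iB[of k] iB[of l] by simp_all
    then have "2 * fst k - snd k = 2 * fst l - snd l" "2 * snd k - fst k = 2 * snd l - fst l"
      by (simp_all only: of_int_eq_iff)
    then show "k = l" by (simp add: prod_eq_iff)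
  qed
  define d where "d = (if p = 3 then int m' else 3 * int m')"
  have dp: "denom_power p (of_int c / (3 * real m)) \<longleftrightarrow> d dvd c" for c
    by (rule denom_power_div_iff[OF p m d_def])
  have alc: "int_comb A B k \<in> interior (alcove P \<theta> m) \<longleftrightarrow>
      2 * snd k > fst k \<and> fst k > snd k \<and> fst k < int m" for k
  proof -
    \<comment> \<open>Against the long roots \<open>A - B\<close> and
      \<open>2 *\<^sub>R A + B\<close> the thirds cancel, so these walls have integral equations in
      the coordinates.\<close>
    have "int_comb A B k \<bullet> (A - B) = of_int (fst k - snd k)"
      "int_comb A B k \<bullet> (2 *\<^sub>R A + B) = of_int (fst k)"
      by (simp_all add: inner_diff_right inner_add_right iA iB field_simps)
    then show ?thesis
      unfolding P_eq \<theta>_eq interior_g2_alcove[OF AB] mem_Collect_eq iB by auto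
  qed
  have den: "(\<forall>y\<in>L. denom_power p ((y \<bullet> int_comb A B k) / real m)) \<longleftrightarrow>
      d dvd 2 * fst k - snd k \<and> d dvd 2 * snd k - fst k" for k
  proof -
    have "(int_comb A B l \<bullet> int_comb A B k) / real m =
        of_int (fst l * (2 * fst k - snd k) + snd l * (2 * snd k - fst k)) / (3 * real m)" for l
    proof -
      have "int_comb A B l \<bullet> int_comb A B k =
          of_int (fst l) * (int_comb A B k \<bullet> A) + of_int (snd l) * (int_comb A B k \<bullet> B)"
        by (simp add: int_comb_def[of A B l] inner_add_left inner_add_right inner_commute)
      then show ?thesis
        unfolding iA iB by (simp add: add_divide_distrib)
    qed
    then have "denom_power p ((int_comb A B l \<bullet> int_comb A B k) / real m) \<longleftrightarrow>
        d dvd fst l * (2 * fst k - snd k) + snd l * (2 * snd k - fst k)" for l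
      by (simp only: dp)
    then have "(\<forall>y\<in>L. denom_power p ((y \<bullet> int_comb A B k) / real m)) \<longleftrightarrow>
        (\<forall>l. d dvd fst l * (2 * fst k - snd k) + snd l * (2 * snd k - fst k))"
      unfolding L by simp
    \<comment> \<open>Divisibility for all weights reduces to the generators \<open>A\<close> and
      \<open>B\<close>.\<close>
    also have "\<dots> \<longleftrightarrow> d dvd 2 * fst k - snd k \<and> d dvd 2 * snd k - fst k"
    proof
      assume *: "\<forall>l. d dvd fst l * (2 * fst k - snd k) + snd l * (2 * snd k - fst k)"
      show "d dvd 2 * fst k - snd k \<and> d dvd 2 * snd k - fst k"
        using *[rule_format, of "(1, 0)"] *[rule_format, of "(0, 1)"] by simp
    qed (simp add: dvd_add dvd_mult)
    finally show ?thesis .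
  qed
  have "{x \<in> L. x \<in> interior (alcove P \<theta> m) \<and> (\<forall>y\<in>L. denom_power p ((y \<bullet> x) / real m))} =
      int_comb A B ` {k. int_comb A B k \<in> interior (alcove P \<theta> m) \<and>
        (\<forall>y\<in>L. denom_power p ((y \<bullet> int_comb A B k) / real m))}"
    unfolding L by blast
  also have "\<dots> = int_comb A B ` {(k, l). 2 * l > k \<and> k > l \<and> k < int m \<and> d dvd 2 * k - l \<and> d dvd 2 * l - k}"
    unfolding alc den by (intro arg_cong[of _ _ "image (int_comb A B)"]) auto
  finally show ?thesis
    using card_image[OF inj_on_subset[OF inj subset_UNIV]]
      card_hexagonal_solutions[OF p m d_def] by simp
qed

section \<open>The scale of the inner product, and the final count\<close>

lemma g2_basis_weight_space:
  fixes \<iota> :: "oct character \<Rightarrow> 'e::euclidean_space"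
  assumes T: "maximal_torus G2 T" and ws: "weight_space T \<iota>" and ip: "basic_inner_product G2 T \<iota>"
  obtains A B where "g2_basis (\<iota> ` weights T) (\<iota> ` roots G2 T) A B"
proof -
  obtain \<omega> n where \<omega>: "bij_betw \<omega> UNIV (weights T)"
    and add: "\<And>a b. weight_add T (\<omega> a) (\<omega> b) = \<omega> (a + b)"
    and roots: "roots G2 T = \<omega> ` g2_roots" and n: "n \<in> normalizer G2 T"
    and act: "\<And>k. weyl_act T n (\<omega> k) = \<omega> (- snd k, fst k - snd k)"
    using maximal_torus_G2_weights[OF T] by metis
  have wt: "\<omega> k \<in> weights T" for k using \<omega> by (auto simp: bij_betw_def)
  have rng: "weights T = range \<omega>" using \<omega> by (simp add: bij_betw_def)
  have inj: "inj_on \<iota> (weights T)" using ws by (auto simp: weight_space_def bij_betw_def)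
  define A B where "A = \<iota> (\<omega> (1, 0))" and "B = \<iota> (\<omega> (0, 1))"
  have h_add: "\<iota> (\<omega> (a + b)) = \<iota> (\<omega> a) + \<iota> (\<omega> b)" for a b
    using ws wt[of a] wt[of b] unfolding weight_space_def add[symmetric] by blast
  have h: "\<iota> (\<omega> k) = int_comb A B k" for k
    using int_comb_of_additive[of "\<lambda>k. \<iota> (\<omega> k)"] h_add unfolding A_def B_def by blast
  have W: "int_comb A B (- snd k, fst k - snd k) \<bullet> int_comb A B (- snd l, fst l - snd l) =
      int_comb A B k \<bullet> int_comb A B l" for k l
    using ip n wt[of k] wt[of l] unfolding basic_inner_product_def h[symmetric] act[symmetric] by blast
  define s where "s = A \<bullet> A"
  have BB: "B \<bullet> B = s" using W[of "(1, 0)" "(1, 0)"] by (simp add: int_comb_def s_def)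
  \<comment> \<open>The cycle sends \<open>A\<close> to \<open>B\<close> and \<open>B\<close> to
    \<open>- A - B\<close>; solving this equation gives the angle of 120 degrees.\<close>
  have "B \<bullet> (- A - B) = A \<bullet> B" using W[of "(1, 0)" "(0, 1)"] by (simp add: int_comb_def)
  then have AB: "A \<bullet> B = - s / 2" using BB by (simp add: inner_diff_right inner_commute)
  \<comment> \<open>The integral form is 1 on the first row of \<open>g2_roots\<close> and 3 on the
    second. Hence (1, 2) has maximal length, and its square length 2 fixes \<open>s\<close>.\<close>
  have nrm: "int_comb A B k \<bullet> int_comb A B k =
      s * of_int (fst k * fst k - fst k * snd k + snd k * snd k)" for k
    using AB BB by (simp add: int_comb_def inner_simps inner_commute s_def[symmetric] algebra_simps)
  have "\<omega> (1, 0) \<noteq> \<omega> (0, 0)" using \<omega> by (auto simp: bij_betw_def inj_eq)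
  \<comment> \<open>The trivial weight is mapped to zero, so injectivity of \<open>\<iota>\<close>
    shows that \<open>A\<close> is nonzero.\<close>
  then have "A \<noteq> \<iota> (\<omega> (0, 0))" using inj wt by (auto simp: A_def inj_on_eq_iff)
  then have "s > 0" by (simp add: h int_comb_def s_def)
  have "int_comb A B (1, 2) \<bullet> int_comb A B (1, 2) = 2"
  proof -
    have "norm (int_comb A B k) \<le> norm (int_comb A B (1, 2))" if "k \<in> g2_roots" for k
      unfolding norm_eq_sqrt_inner nrm using that \<open>s > 0\<close> by (auto simp: g2_roots_def)
    then have "\<forall>v\<in>\<iota> ` roots G2 T. norm v \<le> norm (int_comb A B (1, 2))"
      unfolding roots by (auto simp: h)
    moreover have "int_comb A B (1, 2) \<in> \<iota> ` roots G2 T"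
      unfolding roots by (intro image_eqI[of _ _ "\<omega> (1, 2)"]) (auto simp: h g2_roots_def)
    ultimately show ?thesis using ip unfolding basic_inner_product_def by blast
  qed
  then have "s = 2 / 3" unfolding nrm by simp
  moreover have "\<iota> ` weights T = range (int_comb A B)" "\<iota> ` roots G2 T = int_comb A B ` g2_roots"
    unfolding rng roots by (simp_all add: image_image h)
  ultimately have "g2_basis (\<iota> ` weights T) (\<iota> ` roots G2 T) A B"
    using BB AB s_def by (simp add: g2_basis_def)
  then show ?thesis by (rule that)
qed

lemma N_regular_eq_card:
  assumes "weight_space T \<iota>"
  shows "N_regular T \<iota> P \<theta> m p =
    card {x \<in> \<iota> ` weights T. x \<in> interior (alcove P \<theta> m) \<and>
      (\<forall>y\<in>\<iota> ` weights T. denom_power p ((y \<bullet> x) / real m))}"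
proof -
  define K where "K = {a \<in> regular_weights T \<iota> P \<theta> m. \<forall>w\<in>weights T. denom_power p ((\<iota> w \<bullet> \<iota> a) / real m)}"
  have "inj_on \<iota> (weights T)" using assms by (auto simp: weight_space_def bij_betw_def)
  then have "inj_on \<iota> K" by (rule inj_on_subset) (auto simp: K_def regular_weights_def)
  moreover have "\<iota> ` K = {x \<in> \<iota> ` weights T. x \<in> interior (alcove P \<theta> m) \<and>
      (\<forall>y\<in>\<iota> ` weights T. denom_power p ((y \<bullet> x) / real m))}"
    by (auto simp: K_def regular_weights_def)
  ultimately show ?thesis
    unfolding N_regular_def K_def[symmetric] by (metis card_image)
qed

theorem mainTheorem6:
  fixes T :: "(oct \<Rightarrow>\<^sub>L oct) set"
    and \<iota> :: "oct character \<Rightarrow> 'e::euclidean_space"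
    and P :: "'e set" and \<theta> :: 'e
    and m p i m' :: nat
  assumes "maximal_torus G2 T"
    and "weight_space T \<iota>"
    and "basic_inner_product G2 T \<iota>"
    and "positive_system (\<iota> ` roots G2 T) P"
    and "highest_root (\<iota> ` roots G2 T) P \<theta>"
    and "m > 0"
    and "prime p"
    and "m = p ^ i * m'"
    and "\<not> p dvd m'"
  shows "(p = 3 \<longrightarrow>
           N_regular T \<iota> P \<theta> m p =
             card {(b1, b2) :: int \<times> int |b1 b2.
                    2 * b2 > b1 \<and> b1 > b2 \<and> b2 > 0 \<and> int p ^ i > b1}) \<and>
         (p \<noteq> 3 \<longrightarrow>
           N_regular T \<iota> P \<theta> m p =
             card {(b1, b2) :: int \<times> int |b1 b2.
                    2 * b2 > b1 \<and> b1 > b2 \<and> b2 > 0 \<and> int p ^ i > b1 \<and> 3 dvd (b1 + b2)})"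
proof -
  obtain A B where "g2_basis (\<iota> ` weights T) (\<iota> ` roots G2 T) A B"
    using g2_basis_weight_space[OF assms(1-3)] by blast
  from card_g2_lattice_points[OF this assms(4,5,7-9)]
  have "N_regular T \<iota> P \<theta> m p =
      card {(b1 :: int, b2 :: int). 2 * b2 > b1 \<and> b1 > b2 \<and> b2 > 0 \<and> int p ^ i > b1 \<and>
        (p \<noteq> 3 \<longrightarrow> 3 dvd (b1 + b2))}"
    unfolding N_regular_eq_card[OF assms(2)] .
  moreover have "{(b1, b2) :: int \<times> int |b1 b2. Q b1 b2} = {(b1, b2). Q b1 b2}" for Q
    by auto
  ultimately show ?thesis by (cases "p = 3") simp_all
qed

end
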